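(* Let $\mu$ be a Radon measure on $\mathbb{R}^n$, let $1\leq p<\infty$, and let $c>0$. Then the measure $$\mu\llcorner\{x\in\mathbb{R}^n:\underline{D}^1(\mu,x)>(3/2)\sqrt n\cdot c\text{ and }J^{*,c}_p(\mu,x)<\infty\}$$ is 1-rectifiable.
   Context: A Radon measure is 1-rectifiable if there are countably many Lipschitz $f_i:[0,1]\to\mathbb{R}^n$ with $\mu(\mathbb{R}^n\setminus\bigcup_if_i([0,1]))=0$. $\underline{D}^1(\mu,x)=\liminf_{r\downarrow0}\mu(B(x,r))/(2r)$. Dyadic cubes are half open cubes $Q=\prod_{i=1}^n[j_i2^{-k},(j_i+1)2^{-k})$, $k,j_i\in\mathbb{Z}$, with side length $\ell(Q)=2^{-k}$ and $\mathrm{diam}\,Q=2^{-k}\sqrt n$; $\Delta_1(\mathbb{R}^n)$ denotes dyadic cubes of side length at most 1; $\lambda Q$ is the concentric dilate by $\lambda$. For a bounded Borel set $E$ of positive diameter and a line $\ell$, $\beta_p(\mu,E,\ell)^p=\int_E(\mathrm{dist}(x,\ell)/\mathrm{diam}\,E)^p\,d\mu(x)/\mu(E)$ ($=0$ if $\mu(E)=0$). $\Delta^*(Q)$ is the set of dyadic $R$ with $\ell(Q)\leq\ell(R)\leq2\ell(Q)$ and $3R\subseteq1600\sqrt n\,Q$. Define $$\beta^{*,c}_p(\mu,Q)^2=\inf_\ell\max\{\beta_p(\mu,3R,\ell)^2\min\{c,1\}:R\in\Delta^*(Q),\ \mu(3R)\geq c\,\mathrm{diam}\,3R\},$$ infimum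 over lines $\ell$, with $\beta^{*,c}_p(\mu,Q)=0$ if no $R\in\Delta^*(Q)$ satisfies $\mu(3R)\geq c\,\mathrm{diam}\,3R$; and $J^{*,c}_p(\mu,x)=\sum_{Q\in\Delta_1(\mathbb{R}^n)}\beta^{*,c}_p(\mu,Q)^2\frac{\mathrm{diam}\,Q}{\mu(Q)}\chi_Q(x)$, with $0/0=0$, $1/0=\infty$. *)

theory Defs
  imports "HOL-Analysis.Analysis"
begin

text \<open>Radon measures on R^n = locally finite Borel measures.\<close>
definition radon_measure :: "(real^'n) measure \<Rightarrow> bool" where
  "radon_measure M \<longleftrightarrow> sets M = sets borel \<and> (\<forall>K. compact K \<longrightarrow> emeasure M K < \<infinity>)"

text \<open>The restricted measure M restricted to A is 1-rectifiable: there are countably many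
 Lipschitz curves f i on [0,1] whose images cover A up to a set of (outer) M-measure zero.\<close>
definition restr_one_rectifiable :: "(real^'n) measure \<Rightarrow> (real^'n) set \<Rightarrow> bool" where
  "restr_one_rectifiable M A \<longleftrightarrow>
     (\<exists>f :: nat \<Rightarrow> real \<Rightarrow> real^'n.
        (\<forall>i. \<exists>L. L-lipschitz_on {0..1} (f i)) \<and>
        (\<exists>N \<in> null_sets M. A - (\<Union>i. f i ` {0..1}) \<subseteq> N))"

text \<open>Lower 1-density.\<close>
definition lower_density1 :: "(real^'n) measure \<Rightarrow> real^'n \<Rightarrow> ennreal" where
  "lower_density1 M x = Liminf (at_right 0) (\<lambda>r. emeasure M (cball x r) / ennreal (2 * r))"

text \<open>Dyadic cube with index (k, j): side length 2^-k, corners j i * 2^-k.\<close>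
definition side :: "int \<Rightarrow> real" where
  "side k = 2 powr (- real_of_int k)"

definition dcube :: "int \<Rightarrow> ('n::finite \<Rightarrow> int) \<Rightarrow> (real^'n) set" where
  "dcube k j = {x. \<forall>i. real_of_int (j i) * side k \<le> x $ i \<and> x $ i < (real_of_int (j i) + 1) * side k}"

text \<open>Concentric dilate lambda Q of the (half-open) dyadic cube Q.\<close>
definition dilate :: "real \<Rightarrow> int \<Rightarrow> ('n::finite \<Rightarrow> int) \<Rightarrow> (real^'n) set" where
  "dilate lam k j = {x. \<forall>i. (real_of_int (j i) + 1/2) * side k - lam * side k / 2 \<le> x $ i
                          \<and> x $ i < (real_of_int (j i) + 1/2) * side k + lam * side k / 2}"

definition lines :: "(real^'n) set set" where
  "lines = {L. \<exists>a v. v \<noteq> 0 \<and> L = {a + t *\<^sub>R v | t. True}}"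

text \<open>beta_p(mu,E,l) (the p-th root of the normalized integral); 0 if mu(E) = 0.\<close>
definition beta_p :: "(real^'n) measure \<Rightarrow> real \<Rightarrow> (real^'n) set \<Rightarrow> (real^'n) set \<Rightarrow> real" where
  "beta_p M p E L =
     (if emeasure M E = 0 then 0
      else (enn2real ((\<integral>\<^sup>+ x\<in>E. ennreal ((infdist x L / diameter E) powr p) \<partial>M) / emeasure M E))
             powr (1 / p))"

text \<open>Delta^*(Q), as a set of indices.\<close>
definition delta_star :: "int \<Rightarrow> ('n::finite \<Rightarrow> int) \<Rightarrow> (int \<times> ('n \<Rightarrow> int)) set" where
  "delta_star k j = {(k', j'). side k \<le> side k' \<and> side k' \<le> 2 * side k \<and>
        dilate 3 k' j' \<subseteq> dilate (1600 * sqrt (real CARD('n))) k j}"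

text \<open>The R in Delta^*(Q) with mu(3R) >= c diam 3R.\<close>
definition heavy_star :: "(real^'n::finite) measure \<Rightarrow> real \<Rightarrow> int \<Rightarrow> ('n \<Rightarrow> int) \<Rightarrow> (int \<times> ('n \<Rightarrow> int)) set" where
  "heavy_star M c k j = {(k', j') \<in> delta_star k j.
        emeasure M (dilate 3 k' j') \<ge> ennreal (c * diameter (dilate 3 k' j'))}"

text \<open>(beta^{*,c}_p(mu,Q))^2.\<close>
definition beta_star_sq :: "(real^'n::finite) measure \<Rightarrow> real \<Rightarrow> real \<Rightarrow> int \<Rightarrow> ('n \<Rightarrow> int) \<Rightarrow> real" where
  "beta_star_sq M c p k j =
     (if heavy_star M c k j = {} then 0
      else (INF L\<in>lines. Max ((\<lambda>(k', j'). (beta_p M p (dilate 3 k' j') L)\<^sup>2 * min c 1) ` heavy_star M c k j)))"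

text \<open>J^{*,c}_p(mu,x): sum over dyadic cubes of side length at most 1 (k >= 0),
  with the conventions 0/0 = 0 and a/0 = infinity for a > 0 (ennreal division).\<close>
definition J_star :: "(real^'n::finite) measure \<Rightarrow> real \<Rightarrow> real \<Rightarrow> real^'n \<Rightarrow> ennreal" where
  "J_star M c p x =
     (\<integral>\<^sup>+ Q. ennreal (beta_star_sq M c p (fst Q) (snd Q) * diameter (dcube (fst Q) (snd Q)))
              / emeasure M (dcube (fst Q) (snd Q)) * indicator (dcube (fst Q) (snd Q)) x
        \<partial>count_space {Q :: int \<times> ('n \<Rightarrow> int). fst Q \<ge> 0})"

end

theory Submission
  imports Defs "HOL-Complex_Analysis.Great_Picard"
begin

text \<open>
  Fix a set of points of positive lower density on which \<open>J\<close> is bounded, and discard the dyadic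
  cubes that carry only a small proportion of it. On the remaining tree of cubes the sum of
  \<open>\<beta>\<^sup>2 diam\<close> is finite, because integrating \<open>J\<close> over the set cancels the weights \<open>1/\<mu>(Q)\<close>.
  The centres of mass \<open>z\<^sub>R\<close> of \<open>3R\<close> over two consecutive generations lie near a common
  line by convexity of the distance, so it remains to prove a travelling salesman theorem for the points
  \<open>z\<^sub>R\<close>.

  Let \<open>r\<^sub>j = r\<^sub>0/2^j\<close>. In generation \<open>j\<close> choose a \<open>4r\<^sub>j\<close>-separated net of centres and a
  connected graph on it minimising the sum over all edges of \<open>t + min t (68 r\<^sub>j)\<close>, where \<open>t\<close> is the
  length of the edge. Passing to generation \<open>j + 1\<close>, the net points move along the nearby lines, the
  first order changes of the short edges cancel in pairs at each vertex with a neighbour on both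
  sides, and new points are inserted into short edges; all this costs \<open>O(\<beta>\<^sup>2 r\<^sub>j)\<close>. A missing
  neighbour costs \<open>O(r\<^sub>j)\<close>. As a connected graph has at least as many edges as vertices minus one, the
  missing neighbours are counted by the long edges, and each long edge pays for its share because
  its weight drops by \<open>34 r\<^sub>j\<close> when the cap \<open>68 r\<^sub>j\<close> is halved. Hence the total length stays
  bounded, the graphs are traversed by uniformly Lipschitz closed walks, and a limit of these walks
  covers the set.
\<close>

subsection \<open>Connected graphs and closed walks\<close>

text \<open>A net point may move by \<open>r_j\<close> from one generation to the next, so a single
  edge can change its length by far more than \<beta>^2 pays for. Only the motion across the lines
  is of second order. The motion along them enters linearly and drops out of the total when every
  vertex has one neighbour on either side; minimality of the graph ensures that there is never more
  than one. The vacant sides fix the constants, in units of \<open>r_j\<close>. The weight counts a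
  short length twice, so at a vacant side an uncancelled shift of 1 costs 2 and a path of length 7
  to the new points costs 14, together 16. Counting edges leaves two vacant sides per long edge, so
  a long edge has to yield 32 although its ends may move apart by 2. Halving its cap must therefore
  release 34, whence the cap 68. A tree has one edge fewer than vertices, which leaves a debt of
  \<open>32 r_j\<close> per generation, a geometric series.\<close>

definition conn :: "'b set \<Rightarrow> ('b \<times> 'b) set \<Rightarrow> bool" where
  "conn V E \<longleftrightarrow> E \<subseteq> V \<times> V \<and> (\<forall>u\<in>V. \<forall>v\<in>V. (u, v) \<in> (E \<union> E\<inverse>)\<^sup>*)"

text \<open>Induction along a spanning tree: as long as \<open>U\<close> misses a vertex,
  connectedness yields an edge leaving \<open>U\<close>, whose far end becomes a new leaf. The
  invariant \<open>P\<close> sees both vertices and tree edges, which serves for counting edges and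
  for building walks.\<close>

lemma conn_grow [consumes 3, case_names base step]:
  assumes "finite V" "conn V E" "v0 \<in> V"
    and base: "P {v0} {}"
    and step: "\<And>U D a b e. \<lbrakk>U \<subseteq> V; D \<subseteq> E \<inter> U \<times> U; a \<in> U; b \<in> V - U; e \<in> E; e = (a, b) \<or> e = (b, a);
      P U D\<rbrakk> \<Longrightarrow> P (insert b U) (insert e D)"
  shows "\<exists>D\<subseteq>E. P V D"
proof -
  have "\<exists>U D. U \<subseteq> V \<and> v0 \<in> U \<and> card U = Suc k \<and> D \<subseteq> E \<inter> U \<times> U \<and> P U D" if "k < card V" for k
    using that
  proof (induction k)
    case 0
    then show ?case
      using base assms(3) by (intro exI[of _ "{v0}"] exI[of _ "{}"]) auto
  next
    case (Suc k)
    then obtain U D where UD: "U \<subseteq> V" "v0 \<in> U" "card U = Suc k" "D \<subseteq> E \<inter> U \<times> U" "P U D"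
      by auto
    have "U \<noteq> V"
      using UD Suc.prems by auto
    then obtain w where w: "w \<in> V" "w \<notin> U"
      using UD by blast
    have "\<exists>a b. a \<in> U \<and> b \<notin> U \<and> (a, b) \<in> E \<union> E\<inverse>"
    proof (rule ccontr)
      assume no: "\<not> ?thesis"
      have "(v0, w) \<in> (E \<union> E\<inverse>)\<^sup>*"
        using assms(2,3) w by (auto simp: conn_def)
      then have "w \<in> U"
        by (induction rule: rtrancl_induct) (use no UD in auto)
      with w show False by simp
    qed
    then obtain a b e where e: "a \<in> U" "b \<notin> U" "e \<in> E" "e = (a, b) \<or> e = (b, a)"
      by blast
    have b: "b \<in> V - U"
      using e assms(2) by (auto simp: conn_def)
    have "P (insert b U) (insert e D)"
      using step UD e b by blast
    moreover have "card (insert b U) = Suc (Suc k)"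
      using UD e finite_subset[OF UD(1) assms(1)] by simp
    moreover have "insert e D \<subseteq> E \<inter> insert b U \<times> insert b U"
      using UD e by auto
    ultimately show ?case
      using UD b by (intro exI[of _ "insert b U"] exI[of _ "insert e D"]) auto
  qed
  from this[of "card V - 1"] obtain U D where
    UD: "U \<subseteq> V" "card U = card V" "D \<subseteq> E" "P U D"
    using assms(1,3) by (metis Suc_diff_1 card_gt_0_iff diff_less empty_iff le_inf_iff less_numeral_extra(1))
  then show ?thesis
    using card_subset_eq[OF assms(1)] by metis
qed

lemma conn_card_le:
  assumes "finite V" "conn V E"
  shows "card V \<le> card E + 1"
proof (cases "V = {}")
  case False
  then obtain v0 where v0: "v0 \<in> V" by blast
  have fE: "finite E"
    using assms by (auto simp: conn_def intro: finite_subset)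
  have "\<exists>D\<subseteq>E. finite V \<and> card V = card D + 1"
  proof (rule conn_grow[OF assms v0])
    fix U D a b e
    assume A: "U \<subseteq> V" "D \<subseteq> E \<inter> U \<times> U" "a \<in> U" "b \<in> V - U" "e \<in> E" "e = (a, b) \<or> e = (b, a)"
      "finite U \<and> card U = card D + 1"
    have "e \<notin> D" using A by auto
    moreover have "finite D" using A fE finite_subset by (metis le_inf_iff)
    ultimately show "finite (insert b U) \<and> card (insert b U) = card (insert e D) + 1"
      using A by auto
  qed auto
  then show ?thesis
    using card_mono[OF fE] by fastforce
qed simp

section \<open>Walks through a graph and their Lipschitz parametrisation\<close>

fun wlen :: "('b \<Rightarrow> 'a::metric_space) \<Rightarrow> 'b list \<Rightarrow> real" where
  "wlen p (x # y # xs) = dist (p x) (p y) + wlen p (y # xs)"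
| "wlen p xs = 0"

lemma wlen_nonneg: "0 \<le> wlen p xs"
  by (induction p xs rule: wlen.induct) auto

lemma wlen_append: "wlen p (ys @ a # zs) = wlen p (ys @ [a]) + wlen p (a # zs)"
proof (induction ys)
  case (Cons y ys)
  then show ?case by (cases ys) auto
qed simp

text \<open>A leaf \<open>b\<close> attached at \<open>a\<close> is visited by a detour
  \<open>a, b, a\<close> spliced in at an occurrence of \<open>a\<close>, so each tree edge is
  traversed twice; edges outside the tree only enlarge the bound.\<close>

lemma conn_walk:
  assumes "finite V" "conn V E" "V \<noteq> {}"
  shows "\<exists>xs. xs \<noteq> [] \<and> set xs = V \<and> wlen p xs \<le> 2 * (\<Sum>(u, v)\<in>E. dist (p u) (p v))"
proof -
  obtain v0 where v0: "v0 \<in> V" using assms by blast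
  have fE: "finite E"
    using assms by (auto simp: conn_def intro: finite_subset)
  have "\<exists>D\<subseteq>E. \<exists>xs. xs \<noteq> [] \<and> set xs = V \<and> wlen p xs \<le> 2 * (\<Sum>(u, v)\<in>D. dist (p u) (p v))"
  proof (rule conn_grow[OF assms(1,2) v0])
    show "\<exists>xs. xs \<noteq> [] \<and> set xs = {v0} \<and> wlen p xs \<le> 2 * (\<Sum>(u, v)\<in>{}. dist (p u) (p v))"
      by (intro exI[of _ "[v0]"]) auto
  next
    fix U D a b e
    assume A: "U \<subseteq> V" "D \<subseteq> E \<inter> U \<times> U" "a \<in> U" "b \<in> V - U" "e \<in> E" "e = (a, b) \<or> e = (b, a)"
      "\<exists>xs. xs \<noteq> [] \<and> set xs = U \<and> wlen p xs \<le> 2 * (\<Sum>(u, v)\<in>D. dist (p u) (p v))"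
    then obtain xs where xs: "set xs = U" "wlen p xs \<le> 2 * (\<Sum>(u, v)\<in>D. dist (p u) (p v))"
      by blast
    then obtain ys zs where yz: "xs = ys @ a # zs"
      using A(3) split_list by metis
    have "e \<notin> D" using A by auto
    moreover have "finite D" using A fE finite_subset by (metis le_inf_iff)
    ultimately have "(\<Sum>(u, v)\<in>insert e D. dist (p u) (p v)) = dist (p a) (p b) + (\<Sum>(u, v)\<in>D. dist (p u) (p v))"
      using A(6) by (auto simp: dist_commute)
    moreover have "wlen p (ys @ a # b # a # zs) = wlen p xs + 2 * dist (p a) (p b)"
      using wlen_append[of p ys a zs] wlen_append[of p ys a "b # a # zs"]
      by (simp add: yz dist_commute)
    ultimately show "\<exists>xs. xs \<noteq> [] \<and> set xs = insert b U \<and> wlen p xs \<le> 2 * (\<Sum>(u, v)\<in>insert e D. dist (p u) (p v))"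
      using xs yz by (intro exI[of _ "ys @ a # b # a # zs"]) auto
  qed
  then obtain D xs where D: "D \<subseteq> E" "xs \<noteq> []" "set xs = V" "wlen p xs \<le> 2 * (\<Sum>(u, v)\<in>D. dist (p u) (p v))"
    by blast
  have "(\<Sum>(u, v)\<in>D. dist (p u) (p v)) \<le> (\<Sum>(u, v)\<in>E. dist (p u) (p v))"
    using D(1) fE by (intro sum_mono2) auto
  with D show ?thesis
    by (intro exI[of _ xs]) auto
qed

lemma walk_lipschitz:
  fixes p :: "'b \<Rightarrow> 'a::real_normed_vector"
  assumes "xs \<noteq> []"
  shows "\<exists>f. 1-lipschitz_on {0..wlen p xs} f \<and> f 0 = p (hd xs) \<and> p ` set xs \<subseteq> f ` {0..wlen p xs}"
  using assms
proof (induction p xs rule: wlen.induct)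
  case (1 p x y xs)
  let ?l = "wlen p (y # xs)" and ?d = "dist (p x) (p y)"
  from 1 obtain f where f: "1-lipschitz_on {0..?l} f" "f 0 = p y" "p ` set (y # xs) \<subseteq> f ` {0..?l}"
    by auto
  have l0: "0 \<le> ?l" by (rule wlen_nonneg)
  \<comment> \<open>For \<open>p x = p y\<close> the first piece shrinks to \<open>t = 0\<close>,
    where the convention \<open>t / 0 = 0\<close> makes it the point \<open>p x\<close>.\<close>
  define g where "g t = (if t \<le> ?d then p x + (t / ?d) *\<^sub>R (p y - p x) else f (t - ?d))" for t
  have "1-lipschitz_on {0..?d} (\<lambda>t. p x + (t / ?d) *\<^sub>R (p y - p x))"
  proof (rule lipschitz_onI)
    fix s t :: real
    have "dist (p x + (s / ?d) *\<^sub>R (p y - p x)) (p x + (t / ?d) *\<^sub>R (p y - p x))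
      = norm ((s / ?d - t / ?d) *\<^sub>R (p y - p x))"
      by (simp add: dist_norm algebra_simps)
    also have "\<dots> = \<bar>s - t\<bar> / ?d * ?d"
      by (simp add: dist_norm norm_minus_commute diff_divide_distrib [symmetric])
    also have "\<dots> \<le> \<bar>s - t\<bar>" by simp
    finally show "dist (p x + (s / ?d) *\<^sub>R (p y - p x)) (p x + (t / ?d) *\<^sub>R (p y - p x)) \<le> 1 * dist s t"
      by (simp add: dist_real_def)
  qed simp
  moreover have "1-lipschitz_on {?d..?d + ?l} (\<lambda>t. f (t - ?d))"
  proof (rule lipschitz_onI)
    fix s t assume "s \<in> {?d..?d + ?l}" "t \<in> {?d..?d + ?l}"
    then have "dist (f (s - ?d)) (f (t - ?d)) \<le> 1 * dist (s - ?d) (t - ?d)"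
      by (intro lipschitz_onD[OF f(1)]) auto
    then show "dist (f (s - ?d)) (f (t - ?d)) \<le> 1 * dist s t"
      by (simp add: dist_real_def)
  qed simp
  ultimately have "1-lipschitz_on {0..?d + ?l} g"
    unfolding g_def using f(2) by (intro lipschitz_on_concat) auto
  moreover have "g 0 = p x" by (simp add: g_def)
  moreover have "p ` set (x # y # xs) \<subseteq> g ` {0..?d + ?l}"
  proof -
    have "p x \<in> g ` {0..?d + ?l}"
      using \<open>g 0 = p x\<close> l0 by (metis add_nonneg_nonneg atLeastAtMost_iff imageI order_refl zero_le_dist)
    moreover have "f t \<in> g ` {0..?d + ?l}" if "t \<in> {0..?l}" for t
    proof -
      have "g (t + ?d) = f t"
        using that f(2) by (auto simp: g_def)
      then show ?thesis
        using that by (metis (no_types, lifting) add.commute add_increasing add_left_mono atLeastAtMost_iff imageI zero_le_dist)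
    qed
    moreover from this have "f ` {0..?l} \<subseteq> g ` {0..?d + ?l}" by blast
    ultimately show ?thesis
      using subset_trans[OF f(3)] by auto
  qed
  ultimately show ?case by auto
next
  case ("2_2" p x)
  show ?case
    by (rule exI[of _ "\<lambda>_. p x"]) (simp add: lipschitz_on_def)
qed simp

lemma conn_lipschitz:
  fixes p :: "'b \<Rightarrow> 'a::real_normed_vector"
  assumes "finite V" "conn V E" "V \<noteq> {}" "(\<Sum>(u, v)\<in>E. dist (p u) (p v)) \<le> L"
  shows "\<exists>f. (2 * L)-lipschitz_on {0..1::real} f \<and> p ` V \<subseteq> f ` {0..1}"
proof -
  obtain xs where xs: "xs \<noteq> []" "set xs = V" "wlen p xs \<le> 2 * (\<Sum>(u, v)\<in>E. dist (p u) (p v))"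
    using conn_walk[OF assms(1-3)] by blast
  let ?l = "wlen p xs"
  obtain f where f: "1-lipschitz_on {0..?l} f" "p ` V \<subseteq> f ` {0..?l}"
    using walk_lipschitz[OF xs(1), of p] xs(2) by auto
  have l0: "0 \<le> ?l" by (rule wlen_nonneg)
  have "(2 * L)-lipschitz_on {0..1} (\<lambda>t. f (?l * t))"
  proof (rule lipschitz_onI)
    show "0 \<le> 2 * L" using xs(3) assms(4) l0 by linarith
    fix s t :: real assume "s \<in> {0..1}" "t \<in> {0..1}"
    then have "dist (f (?l * s)) (f (?l * t)) \<le> 1 * dist (?l * s) (?l * t)"
      using l0 by (intro lipschitz_onD[OF f(1)]) (auto simp: mult_left_le)
    also have "\<dots> = ?l * dist s t"
      using l0 by (simp add: dist_real_def abs_mult flip: right_diff_distrib)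
    also have "\<dots> \<le> 2 * L * dist s t"
      using xs(3) assms(4) by (intro mult_right_mono) auto
    finally show "dist (f (?l * s)) (f (?l * t)) \<le> 2 * L * dist s t" .
  qed
  moreover have "f ` {0..?l} \<subseteq> (\<lambda>t. f (?l * t)) ` {0..1}"
  proof
    fix y assume "y \<in> f ` {0..?l}"
    then obtain t where t: "t \<in> {0..?l}" "y = f t" by blast
    show "y \<in> (\<lambda>t. f (?l * t)) ` {0..1}"
    proof (cases "?l = 0")
      case True
      then show ?thesis using t by force
    next
      case False
      then have "y = f (?l * (t / ?l))" "t / ?l \<in> {0..1}"
        using t l0 by auto
      then show ?thesis by blast
    qed
  qed
  ultimately show ?thesis
    using f(2) by (intro exI[of _ "\<lambda>t. f (?l * t)"]) blast
qed

section \<open>Connected graphs of minimal weight\<close>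

lemma conn_minimal:
  fixes w :: "'b \<times> 'b \<Rightarrow> real"
  assumes "finite V" "conn V E0"
  obtains E where "conn V E" "sum w E \<le> sum w E0" "\<And>E'. conn V E' \<Longrightarrow> sum w E \<le> sum w E'"
proof -
  have fin: "finite {E. conn V E}"
    by (rule finite_subset[of _ "Pow (V \<times> V)"]) (use assms in \<open>auto simp: conn_def\<close>)
  have "\<exists>E\<in>{E. conn V E}. \<forall>E'\<in>{E. conn V E}. sum w E \<le> sum w E'"
    using assms(2) arg_min_if_finite(1)[OF fin, of "sum w"] arg_min_least[OF fin, of _ "sum w"] by blast
  then show thesis
    using that assms(2) by blast
qed

text \<open>A path that uses the edge \<open>(u, v)\<close> reaches \<open>u\<close> or
  \<open>v\<close> before its first use, and that initial segment avoids the edge.\<close>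

lemma rtrancl_remove_edge:
  assumes "(x, y) \<in> (E \<union> E\<inverse>)\<^sup>*" and E0: "E0 = E - {(u, v)}"
  shows "(x, y) \<in> (E0 \<union> E0\<inverse>)\<^sup>* \<or> (x, u) \<in> (E0 \<union> E0\<inverse>)\<^sup>* \<or> (x, v) \<in> (E0 \<union> E0\<inverse>)\<^sup>*"
  using assms(1)
proof (induction rule: rtrancl_induct)
  case (step y z)
  have "(y, z) \<in> E0 \<union> E0\<inverse> \<or> y = u \<or> y = v"
    using step(2) E0 by auto
  with step(3) show ?case
    by (meson rtrancl.rtrancl_into_rtrancl)
qed simp

lemma sym_rtrancl_sym: "(x, y) \<in> (E \<union> E\<inverse>)\<^sup>* \<Longrightarrow> (y, x) \<in> (E \<union> E\<inverse>)\<^sup>*"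
  by (metis converse_Un converse_converse rtrancl_converseI sup_commute)

text \<open>Without \<open>(u, v)\<close> the vertex \<open>w\<close> is still joined to
  \<open>u\<close> or to \<open>v\<close>. An edge from \<open>w\<close> to the other end reconnects
  \<open>u\<close> with \<open>v\<close>, and every path through the deleted edge can be
  rerouted.\<close>

lemma conn_exchange:
  assumes "conn V E" "(u, v) \<in> E" "w \<in> V" "w \<noteq> u" "w \<noteq> v"
  defines "E0 \<equiv> E - {(u, v)}"
  shows "conn V (insert (u, w) E0) \<or> conn V (insert (w, v) E0)"
proof -
  have sub: "E \<subseteq> V \<times> V" and uv: "u \<in> V" "v \<in> V"
    using assms by (auto simp: conn_def)
  have key: "conn V (insert f E0)" if f: "f \<in> V \<times> V" "(u, v) \<in> (insert f E0 \<union> (insert f E0)\<inverse>)\<^sup>*" for f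
  proof -
    have "(x, y) \<in> (insert f E0 \<union> (insert f E0)\<inverse>)\<^sup>*" if "x \<in> V" "y \<in> V" for x y
    proof -
      have "(x, y) \<in> (E \<union> E\<inverse>)\<^sup>*" using assms(1) that by (auto simp: conn_def)
      then show ?thesis
      proof (induction rule: rtrancl_induct)
        case (step y z)
        have "(y, z) \<in> (insert f E0 \<union> (insert f E0)\<inverse>)\<^sup>*"
        proof (cases "(y, z) = (u, v) \<or> (z, y) = (u, v)")
          case True
          then show ?thesis using f(2) sym_rtrancl_sym[OF f(2)] by auto
        next
          case False
          then show ?thesis using step(2) unfolding E0_def by blast
        qed
        with step show ?case by (meson rtrancl_trans)
      qed simp
    qed
    then show ?thesis
      using f(1) sub by (auto simp: conn_def E0_def)
  qed
  have "(w, u) \<in> (E0 \<union> E0\<inverse>)\<^sup>* \<or> (w, v) \<in> (E0 \<union> E0\<inverse>)\<^sup>*"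
    using rtrancl_remove_edge[of w u E E0 u v] assms uv unfolding conn_def by blast
  then show ?thesis
  proof
    assume "(w, u) \<in> (E0 \<union> E0\<inverse>)\<^sup>*"
    then have "(u, w) \<in> (E0 \<union> E0\<inverse>)\<^sup>*" by (rule sym_rtrancl_sym)
    moreover have "E0 \<union> E0\<inverse> \<subseteq> insert (w, v) E0 \<union> (insert (w, v) E0)\<inverse>" by auto
    ultimately have "(u, w) \<in> (insert (w, v) E0 \<union> (insert (w, v) E0)\<inverse>)\<^sup>*"
      using rtrancl_mono by blast
    then have "(u, v) \<in> (insert (w, v) E0 \<union> (insert (w, v) E0)\<inverse>)\<^sup>*"
      by (rule rtrancl.rtrancl_into_rtrancl) simp
    then show ?thesis using key[of "(w, v)"] assms uv by simp
  next
    assume "(w, v) \<in> (E0 \<union> E0\<inverse>)\<^sup>*"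
    moreover have "E0 \<union> E0\<inverse> \<subseteq> insert (u, w) E0 \<union> (insert (u, w) E0)\<inverse>" by auto
    ultimately have "(w, v) \<in> (insert (u, w) E0 \<union> (insert (u, w) E0)\<inverse>)\<^sup>*"
      using rtrancl_mono by blast
    then have "(u, v) \<in> (insert (u, w) E0 \<union> (insert (u, w) E0)\<inverse>)\<^sup>*"
      by (rule converse_rtrancl_into_rtrancl[rotated]) simp
    then show ?thesis using key[of "(u, w)"] assms uv by simp
  qed
qed

text \<open>The first summand makes the weight strictly increasing, so that a minimal graph admits
  no exchange for a shorter edge; the second is a reserve, of which an edge longer than
  \<open>g\<close> releases \<open>g / 2\<close> when \<open>g\<close> is halved.\<close>

definition phi :: "real \<Rightarrow> real \<Rightarrow> real" where
  "phi g t = t + min t g"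

definition gweight :: "real \<Rightarrow> ('b \<Rightarrow> 'a::metric_space) \<Rightarrow> ('b \<times> 'b) set \<Rightarrow> real" where
  "gweight g p E = (\<Sum>(u, v)\<in>E. phi g (dist (p u) (p v)))"

lemma phi_strict_mono: "s < t \<Longrightarrow> phi g s < phi g t"
  by (auto simp: phi_def)

text \<open>If \<open>w\<close> were closer to each end of the edge than the ends are to each other,
  \<open>conn_exchange\<close> would replace the edge by a strictly shorter one. Edges have empty
  lunes, as in a minimum spanning tree.\<close>

lemma minimal_conn_lune:
  assumes fin: "finite V" and E: "conn V E" and g: "0 < g"
    and min: "\<And>E'. conn V E' \<Longrightarrow> gweight g p E \<le> gweight g p E'"
  shows "(u, v) \<in> E \<Longrightarrow> w \<in> V \<Longrightarrow> dist (p u) (p w) < dist (p u) (p v) \<Longrightarrow> dist (p u) (p v) \<le> dist (p w) (p v)"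
proof -
  have fE: "finite E" using fin E by (auto simp: conn_def intro: finite_subset)
  assume A: "(u, v) \<in> E" "w \<in> V" "dist (p u) (p w) < dist (p u) (p v)"
  show "dist (p u) (p v) \<le> dist (p w) (p v)"
  proof (rule ccontr)
    assume "\<not> ?thesis"
    then have B: "dist (p w) (p v) < dist (p u) (p v)" by simp
    let ?E0 = "E - {(u, v)}"
    have w: "w \<noteq> u" "w \<noteq> v" using A B by auto
    have lt: "gweight g p (insert (x, y) ?E0) < gweight g p E"
      if "dist (p x) (p y) < dist (p u) (p v)" for x y
    proof -
      have "0 \<le> phi g (dist (p x) (p y))" using g by (simp add: phi_def)
      then have "gweight g p (insert (x, y) ?E0) \<le> phi g (dist (p x) (p y)) + gweight g p ?E0"
        using fE unfolding gweight_def by (subst sum.insert_if) auto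
      also have "\<dots> < phi g (dist (p u) (p v)) + gweight g p ?E0"
        using phi_strict_mono[OF that] by simp
      also have "\<dots> = gweight g p E"
        using fE A(1) unfolding gweight_def by (subst (2) sum.remove[of _ "(u, v)"]) auto
      finally show ?thesis .
    qed
    show False
      using conn_exchange[OF E A(1,2) w] lt[of u w] lt[of w v] A(3) B min by (meson linorder_not_le)
  qed
qed

subsection \<open>Points close to a line\<close>

definition perp :: "'a::real_inner \<Rightarrow> 'a \<Rightarrow> 'a" where
  "perp e w = w - (w \<bullet> e) *\<^sub>R e"

lemma perp_diff: "perp e (x - y) = perp e x - perp e y"
  by (simp add: perp_def inner_diff_left algebra_simps)

lemma inner_decomp:
  assumes "norm e = 1"
  shows "x \<bullet> y = (x \<bullet> e) * (y \<bullet> e) + perp e x \<bullet> perp e y"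
  using assms by (simp add: perp_def inner_diff_left inner_diff_right dot_square_norm inner_commute)

lemma norm_sq_decomp:
  assumes "norm e = 1"
  shows "(norm x)\<^sup>2 = (x \<bullet> e)\<^sup>2 + (norm (perp e x))\<^sup>2"
  using inner_decomp[OF assms, of x x] unfolding power2_norm_eq_inner by (simp add: power2_eq_square)

lemma norm_perp_le:
  assumes "norm e = 1"
  shows "norm (perp e x) \<le> norm x"
proof (rule power2_le_imp_le)
  show "(norm (perp e x))\<^sup>2 \<le> (norm x)\<^sup>2"
    unfolding norm_sq_decomp[OF assms, of x] by simp
qed simp

lemma abs_inner_unit_le: "norm e = 1 \<Longrightarrow> \<bar>x \<bullet> e\<bar> \<le> norm x"
  using Cauchy_Schwarz_ineq2[of x e] by simp

text \<open>Pythagoras: the leg along \<open>e\<close> is bounded below and the other is at most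
  \<open>2 * \<alpha>\<close>, so the hypotenuse exceeds the first leg only by a term quadratic in
  \<alpha>. This is the source of the square in \<beta>^2.\<close>

lemma norm_near_line_pair:
  assumes e: "norm e = 1" and h: "norm (perp e w) \<le> 2 * \<alpha>" and \<alpha>: "0 \<le> \<alpha>" "\<alpha> \<le> 1/10" and w: "2 \<le> norm w"
  shows "19/10 \<le> \<bar>w \<bullet> e\<bar>" "norm w \<le> \<bar>w \<bullet> e\<bar> + 2 * \<alpha>\<^sup>2"
proof -
  have h2: "(norm (perp e w))\<^sup>2 \<le> 4 * \<alpha>\<^sup>2"
    using power_mono[OF h, of 2] by (simp add: power_mult_distrib)
  have a2: "\<alpha>\<^sup>2 \<le> 1/100"
    using power_mono[OF \<alpha>(2,1), of 2] by (simp add: power2_eq_square)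
  have w2: "4 \<le> (norm w)\<^sup>2" using power_mono[OF w, of 2] by simp
  have "(19/10)\<^sup>2 \<le> \<bar>w \<bullet> e\<bar>\<^sup>2"
    using norm_sq_decomp[OF e, of w] h2 a2 w2 by (simp add: power2_eq_square)
  then show 1: "19/10 \<le> \<bar>w \<bullet> e\<bar>" by (rule power2_le_imp_le) simp
  have "(norm w)\<^sup>2 \<le> \<bar>w \<bullet> e\<bar>\<^sup>2 + 4 * \<alpha>\<^sup>2"
    using norm_sq_decomp[OF e, of w] h2 by simp
  also have "\<dots> \<le> (\<bar>w \<bullet> e\<bar> + 2 * \<alpha>\<^sup>2)\<^sup>2"
  proof -
    have "1 * \<alpha>\<^sup>2 \<le> \<bar>w \<bullet> e\<bar> * \<alpha>\<^sup>2" using 1 by (intro mult_right_mono) auto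
    moreover have "(\<bar>w \<bullet> e\<bar> + 2 * \<alpha>\<^sup>2)\<^sup>2 = \<bar>w \<bullet> e\<bar>\<^sup>2 + 4 * (\<bar>w \<bullet> e\<bar> * \<alpha>\<^sup>2) + 4 * (\<alpha>\<^sup>2)\<^sup>2"
      by (simp add: power2_sum power_mult_distrib)
    moreover have "0 \<le> (\<alpha>\<^sup>2)\<^sup>2" by simp
    ultimately show ?thesis unfolding power2_abs by linarith
  qed
  finally show "norm w \<le> \<bar>w \<bullet> e\<bar> + 2 * \<alpha>\<^sup>2"
    by (rule power2_le_imp_le) simp
qed

text \<open>The sine of the angle between \<open>d\<close> and \<open>e\<close> is at most
  \<open>\<alpha> / 2\<close>, and for an acute angle the chord is at most \<open>sqrt 2\<close>
  times the sine.\<close>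

lemma unit_dir_close:
  assumes e: "norm e = 1" and d: "4 \<le> norm d" "norm (perp e d) \<le> 2 * \<alpha>" "0 < d \<bullet> e" and \<alpha>: "0 \<le> \<alpha>"
  shows "norm (d /\<^sub>R norm d - e) \<le> \<alpha>"
proof -
  let ?u = "d /\<^sub>R norm d"
  have "norm d \<noteq> 0" using d(1) by linarith
  then have nu: "norm ?u = 1" by simp
  have c0: "0 \<le> ?u \<bullet> e" using d by simp
  have c1: "?u \<bullet> e \<le> 1" using abs_inner_unit_le[OF e, of ?u] nu by simp
  have "norm (perp e ?u) = norm (perp e d) / norm d"
  proof -
    have "perp e ?u = (1 / norm d) *\<^sub>R perp e d"
      by (simp add: perp_def algebra_simps divide_inverse)
    then show ?thesis by simp
  qed
  also have "\<dots> \<le> \<alpha> / 2"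
  proof -
    have "\<alpha> * 4 \<le> \<alpha> * norm d" using d(1) \<alpha> by (intro mult_left_mono) auto
    moreover have "0 < norm d" using d by auto
    ultimately show ?thesis using d(2) by (simp add: divide_simps)
  qed
  finally have h: "(norm (perp e ?u))\<^sup>2 \<le> \<alpha>\<^sup>2 / 4"
    using power_mono[of "norm (perp e ?u)" "\<alpha>/2" 2] by (simp add: power_divide)
  have "(norm (?u - e))\<^sup>2 = (norm ?u)\<^sup>2 + (norm e)\<^sup>2 - 2 * (?u \<bullet> e)"
    unfolding power2_norm_eq_inner by (simp only: inner_diff_left inner_diff_right) (simp add: inner_commute)
  also have "\<dots> = 2 * (1 - ?u \<bullet> e)" unfolding nu e by simp
  also have "\<dots> \<le> 2 * (1 - (?u \<bullet> e)\<^sup>2)"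
    using c0 c1 by (simp add: power2_eq_square mult_left_le)
  also have "\<dots> = 2 * (norm (perp e ?u))\<^sup>2"
    using norm_sq_decomp[OF e, of ?u] unfolding nu by simp
  also have "\<dots> \<le> \<alpha>\<^sup>2"
    using h zero_le_power2[of "norm (perp e ?u)"] by linarith
  finally show ?thesis using \<alpha> by (rule power2_le_imp_le)
qed

lemma lines_close:
  assumes "norm e = 1" "norm f = 1" "4 \<le> norm d" "norm (perp e d) \<le> 2 * \<alpha>" "norm (perp f d) \<le> 2 * \<beta>"
    "0 < d \<bullet> e" "0 < d \<bullet> f" "0 \<le> \<alpha>" "0 \<le> \<beta>"
  shows "norm (e - f) \<le> \<alpha> + \<beta>"
proof -
  have "norm (e - f) \<le> norm (d /\<^sub>R norm d - f) + norm (d /\<^sub>R norm d - e)"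
    using norm_triangle_ineq4[of "d /\<^sub>R norm d - f" "d /\<^sub>R norm d - e"] by simp
  then show ?thesis
    using unit_dir_close[of e d \<alpha>] unit_dir_close[of f d \<beta>] assms by simp
qed

text \<open>The chord between two points of the unit sphere is tangential up to second
  order.\<close>

lemma inner_unit_diff:
  assumes "norm e = 1" "norm f = 1"
  shows "f \<bullet> (e - f) = - (norm (e - f))\<^sup>2 / 2"
proof -
  have "e \<bullet> e = 1" "f \<bullet> f = 1"
    using assms by (simp_all add: dot_square_norm)
  then show ?thesis
    unfolding power2_norm_eq_inner by (simp add: inner_diff_left inner_diff_right inner_commute)
qed

text \<open>The shift of an endpoint, measured along the lines of the two endpoints of an edge, agrees
  up to second order, because the shift is itself nearly parallel to its line.\<close>

lemma shift_inner_diff: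
  assumes e: "norm e = 1" and f: "norm f = 1" and ef: "norm (e - f) \<le> \<alpha> + \<beta>"
    and q: "norm q \<le> 1" "norm (perp f q) \<le> 2 * \<beta>" and pos: "0 \<le> \<alpha>" "0 \<le> \<beta>"
  shows "\<bar>q \<bullet> e - q \<bullet> f\<bar> \<le> 4 * (\<alpha>\<^sup>2 + \<beta>\<^sup>2)"
proof -
  have "q \<bullet> e - q \<bullet> f = (q \<bullet> f) * (f \<bullet> (e - f)) + perp f q \<bullet> (e - f)"
    by (simp add: perp_def inner_diff_left inner_diff_right algebra_simps)
  then have "\<bar>q \<bullet> e - q \<bullet> f\<bar> \<le> \<bar>q \<bullet> f\<bar> * \<bar>f \<bullet> (e - f)\<bar> + \<bar>perp f q \<bullet> (e - f)\<bar>"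
    by (metis abs_mult abs_triangle_ineq)
  also have "\<bar>q \<bullet> f\<bar> * \<bar>f \<bullet> (e - f)\<bar> \<le> 1 * ((\<alpha> + \<beta>)\<^sup>2 / 2)"
    using abs_inner_unit_le[OF f, of q] q(1) power_mono[OF ef, of 2]
    unfolding inner_unit_diff[OF e f] by (intro mult_mono) auto
  also have "\<bar>perp f q \<bullet> (e - f)\<bar> \<le> (2 * \<beta>) * (\<alpha> + \<beta>)"
    by (rule order_trans[OF Cauchy_Schwarz_ineq2]) (use q(2) ef pos in \<open>intro mult_mono; simp\<close>)
  also have "1 * ((\<alpha> + \<beta>)\<^sup>2 / 2) + (2 * \<beta>) * (\<alpha> + \<beta>) \<le> 4 * (\<alpha>\<^sup>2 + \<beta>\<^sup>2)"
  proof -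
    have "0 \<le> (\<alpha> - \<beta>)\<^sup>2" "0 \<le> \<alpha>\<^sup>2" "0 \<le> \<beta>\<^sup>2" by simp_all
    moreover have "(\<alpha> - \<beta>)\<^sup>2 = \<alpha>\<^sup>2 - 2 * (\<alpha> * \<beta>) + \<beta>\<^sup>2"
      "(\<alpha> + \<beta>)\<^sup>2 = \<alpha>\<^sup>2 + 2 * (\<alpha> * \<beta>) + \<beta>\<^sup>2"
      "(2 * \<beta>) * (\<alpha> + \<beta>) = 2 * (\<alpha> * \<beta>) + 2 * \<beta>\<^sup>2"
      by (simp_all add: power2_eq_square algebra_simps)
    ultimately show ?thesis by (smt (verit) mult.commute field_sum_of_halves)
  qed
  finally show ?thesis by simp
qed

text \<open>Separated points keep their order when projected to a nearby line. In
  \<open>edge_path\<close> this transfers the order along the line of one end of an edge to the line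
  of the other, so that all inserted points fit on one path.\<close>

lemma same_side_of_close_lines:
  assumes e: "norm e = 1" and f: "norm f = 1" and ef: "norm (e - f) \<le> 1/5"
    and w: "norm (perp e w) \<le> 1/5" "19/10 \<le> w \<bullet> e"
  shows "0 < w \<bullet> f"
proof -
  have "w \<bullet> f = (w \<bullet> e) * (1 + e \<bullet> (f - e)) + perp e w \<bullet> (f - e)"
    using e by (simp add: perp_def inner_diff_left inner_diff_right dot_square_norm algebra_simps)
  moreover have "\<bar>perp e w \<bullet> (f - e)\<bar> \<le> 1/5 * (1/5)"
    by (rule order_trans[OF Cauchy_Schwarz_ineq2])
      (use w(1) ef in \<open>intro mult_mono; simp add: norm_minus_commute\<close>)
  moreover have "24/25 \<le> 1 + e \<bullet> (f - e)"
    using power_mono[OF ef, of 2] inner_unit_diff[OF f e]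
    by (simp add: norm_minus_commute power2_eq_square)
  then have "19/10 * (24/25) \<le> (w \<bullet> e) * (1 + e \<bullet> (f - e))"
    using w(2) by (intro mult_mono) auto
  ultimately show ?thesis by simp
qed

text \<open>A point at least as close to the origin as to \<open>d\<close> lies behind the perpendicular bisector,
  hence behind \<open>d + q\<close>.\<close>

lemma closer_point_behind:
  assumes e: "norm e = 1" and d: "4 \<le> norm d" "norm (perp e d) \<le> 1/5" "0 < d \<bullet> e"
    and x: "norm (perp e x) \<le> 1/5" "norm x \<le> norm (x - d)" and q: "norm q \<le> 1"
  shows "0 < (d + q - x) \<bullet> e"
proof (rule ccontr)
  assume "\<not> ?thesis"
  then have "d \<bullet> e + q \<bullet> e \<le> x \<bullet> e" by (simp add: inner_diff_left inner_add_left)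
  then have le: "d \<bullet> e - 1 \<le> x \<bullet> e"
    using abs_inner_unit_le[OF e, of q] q by linarith
  let ?t = "d \<bullet> e"
  have t: "19/10 \<le> ?t"
    using norm_near_line_pair(1)[OF e, of d "1/10"] d by simp
  have "(norm x)\<^sup>2 \<le> (norm (x - d))\<^sup>2" using x(2) by (intro power_mono) auto
  then have "2 * (x \<bullet> d) \<le> (norm d)\<^sup>2"
    unfolding power2_norm_eq_inner by (simp add: inner_diff_left inner_diff_right inner_commute)
  moreover have "x \<bullet> d = (x \<bullet> e) * ?t + perp e x \<bullet> perp e d"
    by (rule inner_decomp[OF e])
  moreover have pd: "(norm (perp e d))\<^sup>2 \<le> 1/25"
    using power_mono[OF d(2), of 2] by (simp add: power2_eq_square)
  moreover have "\<bar>perp e x \<bullet> perp e d\<bar> \<le> 1/5 * (1/5)"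
    by (rule order_trans[OF Cauchy_Schwarz_ineq2]) (use x(1) d(2) in \<open>intro mult_mono; simp\<close>)
  moreover have "(?t - 1) * ?t \<le> (x \<bullet> e) * ?t"
    using le t by (intro mult_right_mono) auto
  moreover have "(norm d)\<^sup>2 = ?t\<^sup>2 + (norm (perp e d))\<^sup>2" by (rule norm_sq_decomp[OF e])
  ultimately have "2 * ((?t - 1) * ?t) \<le> ?t\<^sup>2 + 3/25"
    by (simp add: power2_eq_square)
  \<comment> \<open>Lying beyond \<open>d + q\<close> and yet on the near side of the bisector would
    force \<open>?t * (?t - 2) \<le> 3/25\<close>, whereas \<open>4 \<le> norm d\<close> gives
    \<open>39/10 \<le> ?t\<close>.\<close>
  then have A: "?t * ?t - 2 * ?t \<le> 3/25" by (simp add: power2_eq_square algebra_simps)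
  have "16 \<le> ?t\<^sup>2 + 1/25"
    using power_mono[OF d(1), of 2] norm_sq_decomp[OF e, of d] pd by simp
  then have "(39/10)\<^sup>2 \<le> ?t\<^sup>2" by (simp add: power2_eq_square)
  then have "39/10 \<le> ?t" by (rule power2_le_imp_le) (use t in auto)
  then have "39/10 * (19/10) \<le> ?t * (?t - 2)" by (intro mult_mono) auto
  with A show False by (simp add: algebra_simps)
qed

text \<open>When the points are visited in the order of their projections, the projections of the
  \<open>card I + 1\<close> edges telescope, and each edge exceeds its projection by at most
  \<open>2 * \<alpha>\<^sup>2\<close>. Gaps of at least 19/10 bound the number of edges by the
  span.\<close>

lemma path_along_line:
  fixes p :: "'b \<Rightarrow> 'a::real_inner" and \<alpha> :: real
  assumes e: "norm e = 1" and \<alpha>: "0 \<le> \<alpha>" "\<alpha> \<le> 1/10" and "finite I" and "a \<notin> I" "b \<notin> I" "a \<noteq> b"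
    and sep: "\<And>x y. x \<in> insert a (insert b I) \<Longrightarrow> y \<in> insert a (insert b I) \<Longrightarrow> x \<noteq> y \<Longrightarrow> 2 \<le> dist (p x) (p y)"
    and near: "\<And>x. x \<in> insert a (insert b I) \<Longrightarrow> norm (perp e (p x - o')) \<le> \<alpha>"
    and I: "\<And>x. x \<in> I \<Longrightarrow> 0 < (p x - p a) \<bullet> e \<and> 0 < (p b - p x) \<bullet> e"
    and ab: "0 < (p b - p a) \<bullet> e"
  shows "\<exists>P. finite P \<and> P \<subseteq> insert a (insert b I) \<times> insert a (insert b I) \<and>
    (\<forall>x\<in>insert a (insert b I). (a, x) \<in> (P \<union> P\<inverse>)\<^sup>*) \<and>
    (\<Sum>(x, y)\<in>P. dist (p x) (p y)) \<le> (p b - p a) \<bullet> e + 2 * \<alpha>\<^sup>2 * (card I + 1) \<and>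
    19/10 * (card I + 1) \<le> (p b - p a) \<bullet> e"
  using assms(4-)
proof (induction "card I" arbitrary: I b)
  have pair: "19/10 \<le> (p y - p x) \<bullet> e" "dist (p x) (p y) \<le> (p y - p x) \<bullet> e + 2 * \<alpha>\<^sup>2"
    if "2 \<le> dist (p x) (p y)" "norm (perp e (p x - o')) \<le> \<alpha>" "norm (perp e (p y - o')) \<le> \<alpha>"
      "0 < (p y - p x) \<bullet> e" for x y
  proof -
    have "perp e (p y - p x) = perp e (p y - o') - perp e (p x - o')"
      by (simp flip: perp_diff)
    then have "norm (perp e (p y - p x)) \<le> 2 * \<alpha>"
      using that(2,3) norm_triangle_ineq4[of "perp e (p y - o')" "perp e (p x - o')"] by simp
    then show "19/10 \<le> (p y - p x) \<bullet> e" "dist (p x) (p y) \<le> (p y - p x) \<bullet> e + 2 * \<alpha>\<^sup>2"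
      using norm_near_line_pair[OF e, of "p y - p x" \<alpha>] \<alpha> that(1,4) by (auto simp: dist_norm norm_minus_commute)
  qed
  {
    case 0
    then have "I = {}" by simp
    then show ?case
      using pair[of a b] 0 by (intro exI[of _ "{(a, b)}"]) auto
  next
    case (Suc n)
    then have "I \<noteq> {}" by auto
    obtain m where m: "m \<in> I" "\<And>x. x \<in> I \<Longrightarrow> p x \<bullet> e \<le> p m \<bullet> e"
      using arg_min_if_finite[OF Suc.prems(1) \<open>I \<noteq> {}\<close>, of "\<lambda>x. - (p x \<bullet> e)"]
      by (meson linorder_not_le neg_less_iff_less)
    let ?J = "I - {m}"
    have cJ: "card I = card ?J + 1"
      using Suc.prems(1) m(1) by (metis Suc_eq_plus1 card.remove)
    have mlt: "0 < (p m - p x) \<bullet> e" if "x \<in> ?J" for x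
    proof -
      have "x \<noteq> m" "x \<in> I" using that by auto
      have "perp e (p m - p x) = perp e (p m - o') - perp e (p x - o')"
        by (simp flip: perp_diff)
      then have "norm (perp e (p m - p x)) \<le> 2 * \<alpha>"
        using Suc.prems(6)[of m] Suc.prems(6)[of x] m(1) \<open>x \<in> I\<close>
          norm_triangle_ineq4[of "perp e (p m - o')" "perp e (p x - o')"] by simp
      then have "19/10 \<le> \<bar>(p m - p x) \<bullet> e\<bar>"
        using norm_near_line_pair(1)[OF e, of "p m - p x" \<alpha>] \<alpha> Suc.prems(5)[of m x] m(1) \<open>x \<in> I\<close> \<open>x \<noteq> m\<close>
        by (auto simp: dist_norm)
      then show ?thesis
        using m(2)[OF \<open>x \<in> I\<close>] by (simp add: inner_diff_left)
    qed
    have "\<exists>P. finite P \<and> P \<subseteq> insert a (insert m ?J) \<times> insert a (insert m ?J) \<and>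
      (\<forall>x\<in>insert a (insert m ?J). (a, x) \<in> (P \<union> P\<inverse>)\<^sup>*) \<and>
      (\<Sum>(x, y)\<in>P. dist (p x) (p y)) \<le> (p m - p a) \<bullet> e + 2 * \<alpha>\<^sup>2 * (card ?J + 1) \<and>
      19/10 * (card ?J + 1) \<le> (p m - p a) \<bullet> e"
    proof (rule Suc.hyps(1))
      show "n = card ?J" using Suc.hyps(2) cJ by simp
    qed (use Suc.prems m mlt in auto)
    then obtain P where P: "finite P" "P \<subseteq> insert a I \<times> insert a I"
      "\<forall>x\<in>insert a I. (a, x) \<in> (P \<union> P\<inverse>)\<^sup>*"
      "(\<Sum>(x, y)\<in>P. dist (p x) (p y)) \<le> (p m - p a) \<bullet> e + 2 * \<alpha>\<^sup>2 * (card ?J + 1)"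
      "19/10 * (card ?J + 1) \<le> (p m - p a) \<bullet> e"
      using m(1) by (auto simp: insert_absorb)
    have mb: "0 < (p b - p m) \<bullet> e" using Suc.prems(7)[OF m(1)] by simp
    have pm: "19/10 \<le> (p b - p m) \<bullet> e" "dist (p m) (p b) \<le> (p b - p m) \<bullet> e + 2 * \<alpha>\<^sup>2"
      using pair[of m b] Suc.prems(5)[of m b] Suc.prems(3) m(1) mb Suc.prems(6)[of m] Suc.prems(6)[of b]
      by auto
    have split: "(p b - p a) \<bullet> e = (p b - p m) \<bullet> e + (p m - p a) \<bullet> e"
      by (simp add: inner_diff_left)
    have notin: "(m, b) \<notin> P" using P(2) Suc.prems(3,4) by auto
    let ?P = "insert (m, b) P"
    have sub: "(P \<union> P\<inverse>)\<^sup>* \<subseteq> (?P \<union> ?P\<inverse>)\<^sup>*" by (rule rtrancl_mono) auto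
    have "(a, m) \<in> (?P \<union> ?P\<inverse>)\<^sup>*" using P(3) m(1) sub by auto
    then have ab: "(a, b) \<in> (?P \<union> ?P\<inverse>)\<^sup>*" by (rule rtrancl.rtrancl_into_rtrancl) simp
    have "(\<Sum>(x, y)\<in>?P. dist (p x) (p y)) \<le> (p b - p a) \<bullet> e + 2 * \<alpha>\<^sup>2 * (card I + 1)"
      using P(1,4) notin pm(2) split cJ by (simp add: algebra_simps)
    moreover have "19/10 * (card I + 1) \<le> (p b - p a) \<bullet> e"
      using P(5) pm(1) split cJ by (simp add: algebra_simps add_divide_distrib)
    moreover have "\<forall>x\<in>insert a (insert b I). (a, x) \<in> (?P \<union> ?P\<inverse>)\<^sup>*"
      using P(3) ab sub by auto
    moreover have "?P \<subseteq> insert a (insert b I) \<times> insert a (insert b I)"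
      using P(2) m(1) by auto
    ultimately show ?case using P(1) by (intro exI[of _ ?P]) auto
  }
qed

subsection \<open>Refining a network by one scale\<close>

lemma perp_unit_mult: "b = 1 \<or> b = - 1 \<Longrightarrow> perp (b *\<^sub>R e) w = perp e w"
  by (auto simp: perp_def)

text \<open>Paths built for different edges or sides may share edges, so only subadditivity is
  available for the weight of their union.\<close>

lemma sum_UN_le:
  fixes f :: "'c \<Rightarrow> real"
  assumes "finite I" "\<And>i. i \<in> I \<Longrightarrow> finite (A i)" "\<And>x. 0 \<le> f x"
  shows "sum f (\<Union>i\<in>I. A i) \<le> (\<Sum>i\<in>I. sum f (A i))"
  using assms(1,2)
proof (induction I)
  case (insert i I)
  have "sum f (A i \<union> (\<Union>i\<in>I. A i)) \<le> sum f (A i) + sum f (\<Union>i\<in>I. A i)"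
    using insert assms(3) by (subst sum.union_inter[symmetric]) (auto intro!: sum_nonneg)
  then show ?case using insert by auto
qed simp

lemma sum_Un_le:
  fixes f :: "'c \<Rightarrow> real"
  assumes "finite A" "finite B" "\<And>x. 0 \<le> f x"
  shows "sum f (A \<union> B) \<le> sum f A + sum f B"
  using sum_UN_le[of "{True, False}" "\<lambda>b. if b then A else B" f] assms by (auto simp: Un_commute)

text \<open>
  One refinement step, scaled so that \<open>r\<^sub>j = 1\<close>: \<open>V\<close> and \<open>V'\<close> are consecutive nets placed by \<open>p\<close>, \<open>h\<close>
  selects a child of each vertex, and \<open>F\<close> consists of the flat vertices \<open>v\<close>, with a nearby line
  through \<open>o' v\<close> of direction \<open>e v\<close>. The radius 80 exceeds \<open>68 + 5\<close>, so that this line controls both ends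
  of a short edge and all points inserted into it.
\<close>

locale tst_step =
  fixes V V' :: "'b set" and p :: "'b \<Rightarrow> 'a::euclidean_space" and h :: "'b \<Rightarrow> 'b" and F :: "'b set"
    and \<alpha> :: "'b \<Rightarrow> real" and e o' :: "'b \<Rightarrow> 'a" and E :: "('b \<times> 'b) set" and N0 :: nat
  assumes fin: "finite V" "finite V'" "V \<noteq> {}"
    and hat: "\<And>v. v \<in> V \<Longrightarrow> h v \<in> V'" "\<And>v. v \<in> V \<Longrightarrow> dist (p (h v)) (p v) \<le> 1"
    and sep: "\<And>u v. u \<in> V \<Longrightarrow> v \<in> V \<Longrightarrow> u \<noteq> v \<Longrightarrow> 4 \<le> dist (p u) (p v)"
    and sep': "\<And>x y. x \<in> V' \<Longrightarrow> y \<in> V' \<Longrightarrow> x \<noteq> y \<Longrightarrow> 2 \<le> dist (p x) (p y)"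
    and cover: "\<And>x. x \<in> V' \<Longrightarrow> \<exists>v\<in>V. dist (p x) (p v) \<le> 5"
    and F: "F \<subseteq> V"
    and \<alpha>: "\<And>v. v \<in> F \<Longrightarrow> 0 \<le> \<alpha> v \<and> \<alpha> v \<le> 1/10"
    and unit: "\<And>v. v \<in> F \<Longrightarrow> norm (e v) = 1"
    and near: "\<And>v y. v \<in> F \<Longrightarrow> y \<in> V \<union> V' \<Longrightarrow> dist (p y) (p v) \<le> 80 \<Longrightarrow> norm (perp (e v) (p y - o' v)) \<le> \<alpha> v"
    and connE: "conn V E"
    and lune: "\<And>u v w. (u, v) \<in> E \<Longrightarrow> w \<in> V \<Longrightarrow> dist (p u) (p w) < dist (p u) (p v) \<Longrightarrow> dist (p u) (p v) \<le> dist (p w) (p v)"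
    and irr: "\<And>v. (v, v) \<notin> E" and anti: "\<And>u v. (u, v) \<in> E \<Longrightarrow> (v, u) \<notin> E"
    and pack: "\<And>v. v \<in> V \<Longrightarrow> card {u \<in> V. dist (p u) (p v) \<le> 68} \<le> N0"
    and pack': "\<And>v. v \<in> V \<Longrightarrow> card {x \<in> V'. dist (p x) (p v) \<le> 5} \<le> N0"
begin

text \<open>The old vertex to which a new point is assigned. Being nearest puts the point on the
  near side of the bisector of every edge at that vertex, as \<open>closer_point_behind\<close>
  requires.\<close>

definition "pr x = (SOME v. v \<in> V \<and> (\<forall>u\<in>V. dist (p x) (p v) \<le> dist (p x) (p u)))"

lemma pr: "pr x \<in> V" "u \<in> V \<Longrightarrow> dist (p x) (p (pr x)) \<le> dist (p x) (p u)"
proof -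
  have "\<exists>v. v \<in> V \<and> (\<forall>u\<in>V. dist (p x) (p v) \<le> dist (p x) (p u))"
    using arg_min_if_finite[OF fin(1,3), of "\<lambda>v. dist (p x) (p v)"] by (meson linorder_not_le)
  from someI_ex[OF this] show "pr x \<in> V" "u \<in> V \<Longrightarrow> dist (p x) (p (pr x)) \<le> dist (p x) (p u)"
    by (auto simp: pr_def)
qed

lemma pr_dist: "x \<in> V' \<Longrightarrow> dist (p x) (p (pr x)) \<le> 5"
  using cover pr(2) by (meson order_trans)

definition "E1 = {(u, v) \<in> E. u \<in> F \<and> v \<in> F \<and> dist (p u) (p v) \<le> 68}"
definition "S = E1 \<union> E1\<inverse>"
definition "dir v u = sgn ((p u - p v) \<bullet> e v)"
definition "q v = (p (h v) - p v) \<bullet> e v"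
text \<open>The vacant sides of flat vertices. They arise at ends of the net, at long edges and next
  to non-flat vertices alike.\<close>

definition "Miss = {(v, b) \<in> F \<times> {1, - 1 :: real}. \<forall>u. (v, u) \<in> S \<longrightarrow> dir v u \<noteq> b}"

lemma finE: "finite E"
  using connE fin by (auto simp: conn_def intro: finite_subset)

lemma finF: "finite F"
  using F fin by (auto intro: finite_subset)

lemma finE1: "finite E1"
  using finE by (auto simp: E1_def intro: finite_subset)

lemma finMiss: "finite Miss"
  using finF by (auto simp: Miss_def intro: finite_subset[of _ "F \<times> {1, - 1}"])

lemma S_D:
  assumes "(v, u) \<in> S"
  shows "v \<in> F" "u \<in> F" "v \<in> V" "u \<in> V" "v \<noteq> u" "dist (p v) (p u) \<le> 68" "4 \<le> dist (p v) (p u)" "(u, v) \<in> S"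
proof -
  show *: "v \<in> F" "u \<in> F" "dist (p v) (p u) \<le> 68" "(u, v) \<in> S"
    using assms by (auto simp: S_def E1_def dist_commute)
  show "v \<in> V" "u \<in> V" using * F by auto
  show "v \<noteq> u" using assms irr by (auto simp: S_def E1_def)
  then show "4 \<le> dist (p v) (p u)" using sep \<open>v \<in> V\<close> \<open>u \<in> V\<close> by auto
qed

lemma near_pair:
  assumes "v \<in> F" "x \<in> V \<union> V'" "y \<in> V \<union> V'" "dist (p x) (p v) \<le> 80" "dist (p y) (p v) \<le> 80"
  shows "norm (perp (e v) (p y - p x)) \<le> 2 * \<alpha> v"
    and "2 \<le> dist (p x) (p y) \<Longrightarrow> 19/10 \<le> \<bar>(p y - p x) \<bullet> e v\<bar>"
    and "2 \<le> dist (p x) (p y) \<Longrightarrow> dist (p x) (p y) \<le> \<bar>(p y - p x) \<bullet> e v\<bar> + 2 * (\<alpha> v)\<^sup>2"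
proof -
  have "perp (e v) (p y - p x) = perp (e v) (p y - o' v) - perp (e v) (p x - o' v)"
    by (simp flip: perp_diff)
  then show 1: "norm (perp (e v) (p y - p x)) \<le> 2 * \<alpha> v"
    using near[OF assms(1,2,4)] near[OF assms(1,3,5)]
      norm_triangle_ineq4[of "perp (e v) (p y - o' v)" "perp (e v) (p x - o' v)"] by simp
  assume "2 \<le> dist (p x) (p y)"
  then show "19/10 \<le> \<bar>(p y - p x) \<bullet> e v\<bar>" "dist (p x) (p y) \<le> \<bar>(p y - p x) \<bullet> e v\<bar> + 2 * (\<alpha> v)\<^sup>2"
    using norm_near_line_pair[OF unit[OF assms(1)] 1] \<alpha>[OF assms(1)]
    by (auto simp: dist_norm norm_minus_commute)
qed

lemma alpha_sq: "v \<in> F \<Longrightarrow> (\<alpha> v)\<^sup>2 \<le> 1/100"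
  using \<alpha>[of v] power_mono[of "\<alpha> v" "1/10" 2] by (simp add: power2_eq_square)

section \<open>The two sides of a flat vertex\<close>

lemma S_proj: "(v, u) \<in> S \<Longrightarrow> 19/10 \<le> \<bar>(p u - p v) \<bullet> e v\<bar>"
  using near_pair(2)[of v v u] S_D[of v u] by (simp add: dist_commute)

lemma dir_pm: "(v, u) \<in> S \<Longrightarrow> dir v u = 1 \<or> dir v u = - 1"
  using S_proj[of v u] by (auto simp: dir_def sgn_if)

lemma dir_pos: "(v, u) \<in> S \<Longrightarrow> 19/10 \<le> (p u - p v) \<bullet> (dir v u *\<^sub>R e v)"
  using S_proj[of v u] by (auto simp: dir_def sgn_if split: if_splits)

lemma lune_S:
  assumes "(v, u) \<in> S" "w \<in> V" "dist (p v) (p w) < dist (p v) (p u)"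
  shows "dist (p v) (p u) \<le> dist (p w) (p u)"
proof -
  have "(v, u) \<in> E \<or> (u, v) \<in> E" using assms(1) by (auto simp: S_def E1_def)
  then show ?thesis
    using lune[of v u w] lune[of u v w] assms(2,3) by (smt (verit) dist_commute)
qed

text \<open>On each side a flat vertex has only its nearest flat neighbour: the nearer of two neighbours
  on the same side would lie in the lune of the longer edge.\<close>

lemma dir_inj:
  assumes "(v, u) \<in> S" "(v, w) \<in> S" "dir v u = dir v w"
  shows "u = w"
proof -
  have aux: False
    if A: "(v, u) \<in> S" "(v, w) \<in> S" "dir v u = dir v w" "u \<noteq> w"
      "\<bar>(p w - p v) \<bullet> e v\<bar> \<le> \<bar>(p u - p v) \<bullet> e v\<bar>" for u w
  proof -
    let ?a = "\<bar>(p u - p v) \<bullet> e v\<bar>" and ?b = "\<bar>(p w - p v) \<bullet> e v\<bar>"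
    note D = S_D[OF A(1)] S_D[OF A(2)]
    have vF: "v \<in> F" by (rule D)
    have uw: "4 \<le> dist (p w) (p u)" using sep D A(4) by (metis dist_commute)
    have c: "dist (p u) (p v) \<le> 80" "dist (p w) (p v) \<le> 80"
      using D by (auto simp: dist_commute)
    have eq: "\<bar>(p u - p w) \<bullet> e v\<bar> = ?a - ?b"
    proof -
      have "(p u - p w) \<bullet> e v = (p u - p v) \<bullet> e v - (p w - p v) \<bullet> e v"
        by (simp add: inner_diff_left)
      moreover have "0 \<le> ((p u - p v) \<bullet> e v) * ((p w - p v) \<bullet> e v)"
        using A(3) unfolding dir_def by (metis sgn_mult sgn_zero_iff zero_le_mult_iff zero_le_sgn_iff linorder_linear sgn_le_0_iff)
      ultimately show ?thesis
        using A(5) by (auto simp: abs_if zero_le_mult_iff split: if_splits)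
    qed
    have "19/10 \<le> ?a - ?b" "dist (p w) (p u) \<le> ?a - ?b + 2 * (\<alpha> v)\<^sup>2"
      using near_pair(2,3)[of v w u] uw c D unfolding eq by auto
    moreover have "19/10 \<le> ?b" using S_proj[OF A(2)] .
    moreover have "dist (p v) (p w) \<le> ?b + 2 * (\<alpha> v)\<^sup>2"
      using near_pair(3)[of v v w] c D by auto
    moreover have "?a \<le> dist (p v) (p u)"
      using abs_inner_unit_le[OF unit[OF vF], of "p u - p v"] by (simp add: dist_norm norm_minus_commute)
    moreover note alpha_sq[OF vF]
    ultimately have "dist (p v) (p w) < dist (p v) (p u)" "dist (p w) (p u) < dist (p v) (p u)"
      by auto
    then show False using lune_S[OF A(1)] D by fastforce
  qed
  show ?thesis
    using aux[of u w] aux[of w u] assms by (metis linorder_linear)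
qed

text \<open>By \<open>dir_inj\<close> every oriented short edge occupies a side of its own, so
  oriented edges and vacant sides together exhaust the \<open>2 * card F\<close> sides. Sums over
  edges thus become sums over sides.\<close>

lemma miss_bij: "bij_betw (\<lambda>(v, u). (v, dir v u)) S (F \<times> {1, - 1} - Miss)"
proof (rule bij_betwI')
  show "((case x of (v, u) \<Rightarrow> (v, dir v u)) = (case y of (v, u) \<Rightarrow> (v, dir v u))) = (x = y)"
    if "x \<in> S" "y \<in> S" for x y
    using that dir_inj by (auto split: prod.splits)
  show "(case x of (v, u) \<Rightarrow> (v, dir v u)) \<in> F \<times> {1, - 1} - Miss" if "x \<in> S" for x
    using that S_D(1) dir_pm by (fastforce simp: Miss_def split: prod.splits)
  show "\<exists>x\<in>S. y = (case x of (v, u) \<Rightarrow> (v, dir v u))" if "y \<in> F \<times> {1, - 1} - Miss" for y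
  proof -
    obtain v b where y: "y = (v, b)" by (cases y)
    then have vb: "y = (v, b)" "v \<in> F" "b \<in> {1, - 1}" "(v, b) \<notin> Miss"
      using that by auto
    then obtain u where "dir v u = b" "(v, u) \<in> S" unfolding Miss_def by blast
    with vb(1) show ?thesis by (intro bexI[of _ "(v, u)"]) auto
  qed
qed

lemma Miss_sub: "Miss \<subseteq> F \<times> {1, - 1}"
  by (auto simp: Miss_def)

lemma E1_disj: "E1 \<inter> E1\<inverse> = {}"
  using anti by (auto simp: E1_def)

lemma card_S: "card S = 2 * card E1"
  unfolding S_def using finE1 E1_disj by (subst card_Un_disjoint) (auto simp: card_inverse)

lemma sum_S: "sum f S = (\<Sum>(u, v)\<in>E1. f (u, v) + f (v, u))" for f :: "'b \<times> 'b \<Rightarrow> real"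
proof -
  have "sum f (E1\<inverse>) = (\<Sum>(u, v)\<in>E1. f (v, u))"
    by (rule sum.reindex_bij_witness[of _ prod.swap prod.swap]) auto
  then show ?thesis
    unfolding S_def using finE1 E1_disj
    by (subst sum.union_disjoint) (auto simp: sum.distrib[symmetric] case_prod_unfold)
qed

lemma card_Miss: "card Miss + 2 * card E1 = 2 * card F"
proof -
  have "card S = card (F \<times> {1, - 1 :: real} - Miss)"
    by (rule bij_betw_same_card[OF miss_bij])
  also have "\<dots> = card (F \<times> {1, - 1 :: real}) - card Miss"
    using finF Miss_sub finMiss by (intro card_Diff_subset) auto
  finally have "card S = 2 * card F - card Miss"
    by (simp add: card_cartesian_product)
  moreover have "card Miss \<le> 2 * card F"
    using card_mono[OF _ Miss_sub] finF by (simp add: card_cartesian_product)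
  ultimately show ?thesis using card_S by simp
qed

text \<open>The first order cancellation: over all sides of all flat vertices the two signs cancel
  each \<open>q v\<close>, so the occupied sides contribute the negative of the vacant ones.\<close>

lemma sum_dir_q: "(\<Sum>(v, u)\<in>S. dir v u * q v) = - (\<Sum>(v, b)\<in>Miss. b * q v)"
proof -
  have "(\<Sum>(v, u)\<in>S. dir v u * q v) = (\<Sum>(v, b)\<in>F \<times> {1, - 1} - Miss. b * q v)"
    using sum.reindex_bij_betw[OF miss_bij, of "\<lambda>(v, b). b * q v"] by (simp add: case_prod_unfold)
  also have "\<dots> = (\<Sum>(v, b)\<in>F \<times> {1, - 1}. b * q v) - (\<Sum>(v, b)\<in>Miss. b * q v)"
    using finF Miss_sub by (intro sum_diff) auto
  also have "(\<Sum>(v, b)\<in>F \<times> {1, - 1}. b * q v) = 0"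
    by (simp flip: sum.cartesian_product)
  finally show ?thesis by simp
qed

lemma q_le: "v \<in> F \<Longrightarrow> \<bar>q v\<bar> \<le> 1"
  using abs_inner_unit_le[OF unit, of v "p (h v) - p v"] hat(2)[of v] F
  by (auto simp: q_def dist_norm)

lemma sum_dir_q_le: "- (\<Sum>(v, u)\<in>S. dir v u * q v) \<le> card Miss"
proof -
  have "(\<Sum>(v, b)\<in>Miss. b * q v) \<le> (\<Sum>m\<in>Miss. 1)"
    using q_le by (intro sum_mono) (fastforce simp: Miss_def abs_le_iff)
  then show ?thesis unfolding sum_dir_q by simp
qed

lemma sum_alpha_S: "(\<Sum>(v, u)\<in>S. (\<alpha> v)\<^sup>2) \<le> 2 * (\<Sum>v\<in>F. (\<alpha> v)\<^sup>2)"
proof -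
  have "(\<Sum>(v, u)\<in>S. (\<alpha> v)\<^sup>2) = (\<Sum>(v, b)\<in>F \<times> {1, - 1 :: real} - Miss. (\<alpha> v)\<^sup>2)"
    using sum.reindex_bij_betw[OF miss_bij, of "\<lambda>(v, b). (\<alpha> v)\<^sup>2"] by (simp add: case_prod_unfold)
  also have "\<dots> \<le> (\<Sum>(v, b)\<in>F \<times> {1, - 1 :: real}. (\<alpha> v)\<^sup>2)"
    using finF by (intro sum_mono2) auto
  also have "\<dots> = 2 * (\<Sum>v\<in>F. (\<alpha> v)\<^sup>2)"
    by (simp flip: sum.cartesian_product add: sum_distrib_left)
  finally show ?thesis .
qed

text \<open>The points to insert are those nearest to \<open>u\<close> that lie beyond
  \<open>h u\<close> towards \<open>v\<close>, and those nearest to \<open>v\<close> that lie beyond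
  \<open>h v\<close> towards \<open>u\<close>. All of them are ordered along the line of
  \<open>u\<close>, and the path through them has the old length corrected by the shift of each end
  along its own line, up to second order.\<close>

lemma edge_path:
  assumes "(u, v) \<in> E1"
  shows "\<exists>P. finite P \<and> P \<subseteq> V' \<times> V' \<and> (h u, h v) \<in> (P \<union> P\<inverse>)\<^sup>* \<and>
    (\<forall>x\<in>V'. pr x = u \<and> 0 < dir u v * ((p x - p (h u)) \<bullet> e u) \<longrightarrow> (h u, x) \<in> (P \<union> P\<inverse>)\<^sup>*) \<and>
    (\<forall>x\<in>V'. pr x = v \<and> 0 < dir v u * ((p x - p (h v)) \<bullet> e v) \<longrightarrow> (h u, x) \<in> (P \<union> P\<inverse>)\<^sup>*) \<and>
    (\<Sum>(x, y)\<in>P. dist (p x) (p y)) \<le>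
      dist (p u) (p v) - dir u v * q u - dir v u * q v + 80 * ((\<alpha> u)\<^sup>2 + (\<alpha> v)\<^sup>2)"
proof -
  have uvS: "(u, v) \<in> S" "(v, u) \<in> S" using assms by (auto simp: S_def)
  note D = S_D[OF uvS(1)]
  \<comment> \<open>Both lines are oriented from \<open>u\<close> to \<open>v\<close>; as
    \<open>dir v u\<close> points from \<open>v\<close> to \<open>u\<close>, it enters
    \<open>f1\<close> with a minus sign.\<close>
  define e1 where "e1 = dir u v *\<^sub>R e u"
  define f1 where "f1 = (- dir v u) *\<^sub>R e v"
  define d where "d = p v - p u"
  have pe: "perp e1 w = perp (e u) w" "perp (- e1) w = perp (e u) w" for w
    using dir_pm[OF uvS(1)] perp_unit_mult[of "dir u v" "e u"] perp_unit_mult[of "- dir u v" "e u"]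
    by (auto simp: e1_def)
  have pf: "perp f1 w = perp (e v) w" "perp (- f1) w = perp (e v) w" for w
    using dir_pm[OF uvS(2)] perp_unit_mult[of "dir v u" "e v"] perp_unit_mult[of "- dir v u" "e v"]
    by (auto simp: f1_def)
  have ne: "norm e1 = 1" "norm f1 = 1"
    using dir_pm[OF uvS(1)] dir_pm[OF uvS(2)] unit D by (auto simp: e1_def f1_def)
  have de: "19/10 \<le> d \<bullet> e1" "19/10 \<le> d \<bullet> f1"
    using dir_pos[OF uvS(1)] dir_pos[OF uvS(2)] by (simp_all add: e1_def f1_def d_def inner_diff_left right_diff_distrib)
  have nd: "4 \<le> norm d" using D by (simp add: d_def dist_norm norm_minus_commute)
  have au: "0 \<le> \<alpha> u" "\<alpha> u \<le> 1/10" and av: "0 \<le> \<alpha> v" "\<alpha> v \<le> 1/10" using \<alpha> D by auto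
  have hu: "h u \<in> V'" "dist (p (h u)) (p u) \<le> 1" and hv: "h v \<in> V'" "dist (p (h v)) (p v) \<le> 1"
    using hat D by auto
  have pde: "norm (perp e1 d) \<le> 2 * \<alpha> u"
    using near_pair(1)[of u u v] D by (simp add: pe d_def dist_commute)
  have pdf: "norm (perp f1 d) \<le> 2 * \<alpha> v"
    using near_pair(1)[of v u v] D by (simp add: pf d_def dist_commute)
  have ef: "norm (e1 - f1) \<le> \<alpha> u + \<alpha> v"
    using lines_close[OF ne nd pde pdf] de au av by simp
  have tri: "dist (p y) (p v) \<le> dist (p y) (p u) + 68" "dist (p y) (p u) \<le> dist (p y) (p v) + 68" for y
    using dist_triangle[of "p y" "p v" "p u"] dist_triangle[of "p y" "p u" "p v"] D(6)
    by (auto simp: dist_commute)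
  have pair_u: "norm (perp e1 (p y - p x)) \<le> 1/5"
    if "x \<in> V \<union> V'" "y \<in> V \<union> V'" "dist (p x) (p u) \<le> 80" "dist (p y) (p u) \<le> 80" for x y
    using near_pair(1)[OF D(1) that] au by (simp add: pe)
  have pair_v: "norm (perp f1 (p y - p x)) \<le> 1/5"
    if "x \<in> V \<union> V'" "y \<in> V \<union> V'" "dist (p x) (p v) \<le> 80" "dist (p y) (p v) \<le> 80" for x y
    using near_pair(1)[OF D(2) that] av by (simp add: pf)
  have f_to_e: "0 < (p y - p x) \<bullet> e1"
    if "x \<in> V'" "y \<in> V'" "dist (p x) (p v) \<le> 80" "dist (p y) (p v) \<le> 80" "0 < (p y - p x) \<bullet> f1" for x y
  proof -
    have "x \<noteq> y" using that by auto
    then have "2 \<le> dist (p x) (p y)" using sep' that by auto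
    then have "19/10 \<le> \<bar>(p y - p x) \<bullet> e v\<bar>" using near_pair(2)[of v x y] D that by auto
    then have "19/10 \<le> (p y - p x) \<bullet> f1"
      using that(5) dir_pm[OF uvS(2)] by (auto simp: f1_def)
    then show ?thesis
      using same_side_of_close_lines[of f1 e1 "p y - p x"] ne ef au av pair_v[of x y] that
      by (simp add: norm_minus_commute)
  qed
  define I1 where "I1 = {x \<in> V'. pr x = u \<and> 0 < (p x - p (h u)) \<bullet> e1}"
  define I2 where "I2 = {x \<in> V'. pr x = v \<and> 0 < (p (h v) - p x) \<bullet> f1}"
  \<comment> \<open>A point nearest to \<open>u\<close> lies behind the bisector, hence behind
    \<open>h v\<close>; so only its position relative to \<open>h u\<close> had to be required in
    \<open>I1\<close>.\<close>
  have I1: "0 < (p (h v) - p x) \<bullet> e1" if "x \<in> I1" for x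
  proof -
    have x: "x \<in> V'" "pr x = u" using that by (auto simp: I1_def)
    have "dist (p x) (p u) \<le> dist (p x) (p v)" using pr(2)[of v x] x D by auto
    moreover have "dist (p x) (p u) \<le> 5" using pr_dist[OF x(1)] x by simp
    ultimately have "0 < (d + (p (h v) - p v) - (p x - p u)) \<bullet> e1"
      using closer_point_behind[OF ne(1) nd, of "p x - p u" "p (h v) - p v"] pde au de hv pair_u[of u x] x D
      by (auto simp: dist_norm d_def)
    then show ?thesis by (simp add: d_def algebra_simps)
  qed
  have I2: "0 < (p x - p (h u)) \<bullet> f1" if "x \<in> I2" for x
  proof -
    have x: "x \<in> V'" "pr x = v" using that by (auto simp: I2_def)
    have "dist (p x) (p v) \<le> dist (p x) (p u)" using pr(2)[of u x] x D by auto
    moreover have "dist (p x) (p v) \<le> 5" using pr_dist[OF x(1)] x by simp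
    moreover have "norm (- d) = norm d" "perp (- f1) (- d) = - perp f1 d"
      by (simp_all add: perp_def)
    moreover have "norm (perp f1 (p x - p v)) \<le> 1/5"
      using pair_v[of v x] x D calculation(2) by auto
    moreover have "norm (p x - p v) \<le> norm (p x - p v + d)"
      using calculation(1) by (simp add: d_def dist_norm)
    \<comment> \<open>The same argument seen from \<open>v\<close>, with \<open>- d\<close> and
      \<open>- f1\<close> in place of \<open>d\<close> and \<open>e1\<close>.\<close>
    ultimately have "0 < (- d + (p (h u) - p u) - (p x - p v)) \<bullet> (- f1)"
      using ne nd pdf av de hu by (intro closer_point_behind) (auto simp: pf dist_norm)
    then show ?thesis by (simp add: d_def algebra_simps)
  qed
  have I2e: "0 < (p x - p (h u)) \<bullet> e1 \<and> 0 < (p (h v) - p x) \<bullet> e1" if "x \<in> I2" for x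
  proof -
    have x: "x \<in> V'" "dist (p x) (p v) \<le> 5" "0 < (p (h v) - p x) \<bullet> f1"
      using that pr_dist[of x] by (auto simp: I2_def)
    show ?thesis
      using f_to_e[of "h u" x] f_to_e[of x "h v"] I2[OF that] x hu hv tri(1)[of "h u"] by auto
  qed
  have ab: "0 < (p (h v) - p (h u)) \<bullet> e1"
  proof -
    have "norm (p (h u) - p u) \<le> norm (p (h u) - p u - d)"
      using hu(2) nd norm_triangle_ineq3[of "p (h u) - p u" d] by (simp add: dist_norm)
    then have "0 < (d + (p (h v) - p v) - (p (h u) - p u)) \<bullet> e1"
      using closer_point_behind[OF ne(1) nd, of "p (h u) - p u" "p (h v) - p v"] pde au de hv hu pair_u[of u "h u"] D
      by (auto simp: dist_norm)
    then show ?thesis by (simp add: d_def algebra_simps)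
  qed
  let ?I = "I1 \<union> I2"
  let ?S = "insert (h u) (insert (h v) ?I)"
  have SV: "?S \<subseteq> V'" using hu hv by (auto simp: I1_def I2_def)
  have Snear: "dist (p x) (p u) \<le> 80" if "x \<in> ?S" for x
  proof -
    have "x \<in> I1 \<Longrightarrow> dist (p x) (p u) \<le> 5" "x \<in> I2 \<Longrightarrow> dist (p x) (p v) \<le> 5"
      using pr_dist[of x] by (auto simp: I1_def I2_def)
    then show ?thesis using that hu hv tri(2)[of x] by auto
  qed
  have ex: "\<exists>P. finite P \<and> P \<subseteq> ?S \<times> ?S \<and>
    (\<forall>x\<in>?S. (h u, x) \<in> (P \<union> P\<inverse>)\<^sup>*) \<and>
    (\<Sum>(x, y)\<in>P. dist (p x) (p y)) \<le> (p (h v) - p (h u)) \<bullet> e1 + 2 * (\<alpha> u)\<^sup>2 * (card ?I + 1) \<and>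
    19/10 * (card ?I + 1) \<le> (p (h v) - p (h u)) \<bullet> e1"
  proof (rule path_along_line[OF ne(1) au])
    show "finite ?I" using fin by (auto simp: I1_def I2_def)
    show "h u \<notin> ?I" using I2e[of "h u"] by (auto simp: I1_def)
    show "h v \<notin> ?I" using I1[of "h v"] by (auto simp: I2_def)
    show "h u \<noteq> h v" using ab by auto
    show "2 \<le> dist (p x) (p y)" if "x \<in> ?S" "y \<in> ?S" "x \<noteq> y" for x y
      using sep' that SV by blast
    show "norm (perp e1 (p x - o' u)) \<le> \<alpha> u" if "x \<in> ?S" for x
      unfolding pe using near[OF D(1) _ Snear[OF that]] that SV by blast
    show "0 < (p x - p (h u)) \<bullet> e1 \<and> 0 < (p (h v) - p x) \<bullet> e1" if "x \<in> ?I" for x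
      using that I1 I2e by (auto simp: I1_def)
    show "0 < (p (h v) - p (h u)) \<bullet> e1" by (rule ab)
  qed
  then obtain P where P: "finite P" "P \<subseteq> ?S \<times> ?S" "\<forall>x\<in>?S. (h u, x) \<in> (P \<union> P\<inverse>)\<^sup>*"
    "(\<Sum>(x, y)\<in>P. dist (p x) (p y)) \<le> (p (h v) - p (h u)) \<bullet> e1 + 2 * (\<alpha> u)\<^sup>2 * (card ?I + 1)"
    "19/10 * (card ?I + 1) \<le> (p (h v) - p (h u)) \<bullet> e1"
    by blast
  have "(p (h v) - p (h u)) \<bullet> e1 \<le> dist (p (h v)) (p (h u))"
    using abs_inner_unit_le[OF ne(1), of "p (h v) - p (h u)"] by (simp add: dist_norm)
  also have "\<dots> \<le> 70"
    using dist_triangle[of "p (h v)" "p (h u)" "p u"] hu hv tri(2)[of "h v"] by (simp add: dist_commute)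
  \<comment> \<open>\<open>70 / (19/10) < 37\<close>. The excess \<open>2 * 37\<close>, together
    with the 4 from comparing the two lines, stays below the coefficient 80.\<close>
  finally have "real (card ?I + 1) \<le> 37" using P(5) by simp
  then have "2 * (\<alpha> u)\<^sup>2 * real (card ?I + 1) \<le> 2 * (\<alpha> u)\<^sup>2 * 37"
    by (intro mult_left_mono) auto
  moreover have "(p (h v) - p (h u)) \<bullet> e1 \<le> dist (p u) (p v) - dir u v * q u - dir v u * q v + 4 * ((\<alpha> u)\<^sup>2 + (\<alpha> v)\<^sup>2)"
  proof -
    have "(p (h v) - p (h u)) \<bullet> e1 = d \<bullet> e1 + (p (h v) - p v) \<bullet> e1 - (p (h u) - p u) \<bullet> e1"
      by (simp add: d_def inner_diff_left)
    moreover have "d \<bullet> e1 \<le> dist (p u) (p v)"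
      using abs_inner_unit_le[OF ne(1), of d] by (simp add: d_def dist_norm norm_minus_commute)
    moreover have "(p (h u) - p u) \<bullet> e1 = dir u v * q u" "(p (h v) - p v) \<bullet> f1 = - (dir v u * q v)"
      by (simp_all add: e1_def f1_def q_def)
    moreover have "\<bar>(p (h v) - p v) \<bullet> e1 - (p (h v) - p v) \<bullet> f1\<bar> \<le> 4 * ((\<alpha> u)\<^sup>2 + (\<alpha> v)\<^sup>2)"
      using near_pair(1)[of v v "h v"] hv D au av
      by (intro shift_inner_diff[OF ne ef]) (auto simp: pf dist_norm)
    ultimately show ?thesis by linarith
  qed
  moreover have "0 \<le> (\<alpha> u)\<^sup>2" "0 \<le> (\<alpha> v)\<^sup>2" by simp_all
  ultimately have "(\<Sum>(x, y)\<in>P. dist (p x) (p y)) \<le>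
      dist (p u) (p v) - dir u v * q u - dir v u * q v + 80 * ((\<alpha> u)\<^sup>2 + (\<alpha> v)\<^sup>2)"
    using P(4) unfolding distrib_left by linarith
  moreover have "(h u, x) \<in> (P \<union> P\<inverse>)\<^sup>*"
    if "x \<in> V'" "pr x = u" "0 < dir u v * ((p x - p (h u)) \<bullet> e u)" for x
    using bspec[OF P(3), of x] that by (auto simp: I1_def e1_def)
  moreover have "(h u, x) \<in> (P \<union> P\<inverse>)\<^sup>*" if "x \<in> V'" "pr x = v" "0 < dir v u * ((p x - p (h v)) \<bullet> e v)" for x
  proof -
    have "(p (h v) - p x) \<bullet> f1 = dir v u * ((p x - p (h v)) \<bullet> e v)"
      by (simp add: f1_def inner_diff_left algebra_simps)
    then show ?thesis using bspec[OF P(3), of x] that by (auto simp: I2_def)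
  qed
  moreover have "(h u, h v) \<in> (P \<union> P\<inverse>)\<^sup>*" using P(3) by blast
  moreover have "P \<subseteq> V' \<times> V'" using P(2) SV by blast
  ultimately show ?thesis
    using P(1) by (intro exI[of _ P]) blast
qed

text \<open>On a vacant side the new points form a dead end up to the farthest one. That one is
  within \<open>5 + 1\<close> of \<open>h v\<close>, and the at most four edges exceed their
  projections by \<open>8/100\<close> in total, hence the bound 7.\<close>

lemma miss_path:
  assumes v: "v \<in> F" and b: "b = 1 \<or> b = - 1"
  shows "\<exists>P. finite P \<and> P \<subseteq> V' \<times> V' \<and>
    (\<forall>x\<in>V'. pr x = v \<and> 0 < b * ((p x - p (h v)) \<bullet> e v) \<longrightarrow> (h v, x) \<in> (P \<union> P\<inverse>)\<^sup>*) \<and>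
    (\<Sum>(x, y)\<in>P. dist (p x) (p y)) \<le> 7"
proof -
  define e1 where "e1 = b *\<^sub>R e v"
  have ne: "norm e1 = 1" using b unit[OF v] by (auto simp: e1_def)
  have pe: "perp e1 w = perp (e v) w" for w using perp_unit_mult[OF b] by (simp add: e1_def)
  define X where "X = {x \<in> V'. pr x = v \<and> 0 < (p x - p (h v)) \<bullet> e1}"
  have X: "x \<in> X \<longleftrightarrow> x \<in> V' \<and> pr x = v \<and> 0 < b * ((p x - p (h v)) \<bullet> e v)" for x
    by (auto simp: X_def e1_def)
  have vV: "v \<in> V" using v F by auto
  have hv: "h v \<in> V'" "dist (p (h v)) (p v) \<le> 1" using hat vV by auto
  have Xd: "dist (p x) (p v) \<le> 5" if "x \<in> X" for x using that pr_dist[of x] by (auto simp: X)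
  show ?thesis
  proof (cases "X = {}")
    case True
    then show ?thesis using X by (intro exI[of _ "{}"]) auto
  next
    case False
    have finX: "finite X" using fin by (auto simp: X_def)
    obtain m where m: "m \<in> X" "\<And>x. x \<in> X \<Longrightarrow> p x \<bullet> e1 \<le> p m \<bullet> e1"
      using arg_min_if_finite[OF finX False, of "\<lambda>x. - (p x \<bullet> e1)"]
      by (meson linorder_not_le neg_less_iff_less)
    let ?I = "X - {m}"
    let ?S = "insert (h v) (insert m ?I)"
    have SV: "?S \<subseteq> V'" using hv m by (auto simp: X_def)
    have Sd: "dist (p x) (p v) \<le> 80" if "x \<in> ?S" for x
      using that Xd m hv by fastforce
    have ab: "0 < (p m - p (h v)) \<bullet> e1" using m by (auto simp: X_def)
    have av: "0 \<le> \<alpha> v" "\<alpha> v \<le> 1/10" using \<alpha> v by auto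
    have "\<exists>P. finite P \<and> P \<subseteq> ?S \<times> ?S \<and> (\<forall>x\<in>?S. (h v, x) \<in> (P \<union> P\<inverse>)\<^sup>*) \<and>
      (\<Sum>(x, y)\<in>P. dist (p x) (p y)) \<le> (p m - p (h v)) \<bullet> e1 + 2 * (\<alpha> v)\<^sup>2 * (card ?I + 1) \<and>
      19/10 * (card ?I + 1) \<le> (p m - p (h v)) \<bullet> e1"
    proof (rule path_along_line[OF ne av])
      show "finite ?I" using finX by auto
      show "h v \<notin> ?I" by (auto simp: X_def)
      show "h v \<noteq> m" using ab by auto
      show "2 \<le> dist (p x) (p y)" if "x \<in> ?S" "y \<in> ?S" "x \<noteq> y" for x y
        using sep' that SV by blast
      show "norm (perp e1 (p x - o' v)) \<le> \<alpha> v" if "x \<in> ?S" for x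
        unfolding pe using near[OF v _ Sd[OF that]] that SV by blast
      show "0 < (p x - p (h v)) \<bullet> e1 \<and> 0 < (p m - p x) \<bullet> e1" if "x \<in> ?I" for x
      proof -
        have x: "x \<in> X" "x \<noteq> m" "x \<in> V'" "m \<in> V'" using that m by (auto simp: X_def)
        then have "19/10 \<le> \<bar>(p m - p x) \<bullet> e v\<bar>"
          using near_pair(2)[of v x m] sep'[of x m] v Xd[of x] Xd[of m] m(1) by force
        then have "19/10 \<le> \<bar>(p m - p x) \<bullet> e1\<bar>" using b by (auto simp: e1_def)
        then show ?thesis using m(2)[OF x(1)] x by (auto simp: X_def inner_diff_left)
      qed
    qed (use ab in auto)
    then obtain P where P: "finite P" "P \<subseteq> ?S \<times> ?S" "\<forall>x\<in>?S. (h v, x) \<in> (P \<union> P\<inverse>)\<^sup>*"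
      "(\<Sum>(x, y)\<in>P. dist (p x) (p y)) \<le> (p m - p (h v)) \<bullet> e1 + 2 * (\<alpha> v)\<^sup>2 * (card ?I + 1)"
      "19/10 * (card ?I + 1) \<le> (p m - p (h v)) \<bullet> e1"
      by blast
    have "(p m - p (h v)) \<bullet> e1 \<le> dist (p m) (p (h v))"
      using abs_inner_unit_le[OF ne, of "p m - p (h v)"] by (simp add: dist_norm)
    also have "\<dots> \<le> 6"
      using dist_triangle2[of "p m" "p (h v)" "p v"] hv Xd[OF m(1)] by simp
    finally have le6: "(p m - p (h v)) \<bullet> e1 \<le> 6" .
    then have "real (card ?I + 1) \<le> 4" using P(5) by simp
    then have "2 * (\<alpha> v)\<^sup>2 * real (card ?I + 1) \<le> 2 * (1/100) * 4"
      using alpha_sq[OF v] by (intro mult_mono) auto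
    then have "(\<Sum>(x, y)\<in>P. dist (p x) (p y)) \<le> 7" using P(4) le6 by linarith
    moreover have "P \<subseteq> V' \<times> V'" using P(2) SV by blast
    moreover have "(h v, x) \<in> (P \<union> P\<inverse>)\<^sup>*"
      if "x \<in> V'" "pr x = v" "0 < b * ((p x - p (h v)) \<bullet> e v)" for x
      using P(3) that X[of x] by (cases "x = m") auto
    ultimately show ?thesis using P(1) by (intro exI[of _ P]) blast
  qed
qed

section \<open>Long edges, non-flat vertices and the refined graph\<close>

definition "N = V - F"
definition "Elong = {(u, v) \<in> E. 68 < dist (p u) (p v)}"
definition "Ebad = {(u, v) \<in> E. dist (p u) (p v) \<le> 68 \<and> (u \<in> N \<or> v \<in> N)}"

lemma E_split: "E = E1 \<union> Elong \<union> Ebad" "E1 \<inter> Elong = {}" "E1 \<inter> Ebad = {}" "Elong \<inter> Ebad = {}"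
  using connE by (auto simp: E1_def Elong_def Ebad_def N_def conn_def)

lemma card_Ebad: "card Ebad \<le> 2 * N0 * card N"
proof -
  have finN: "finite N" using fin by (simp add: N_def)
  let ?B = "\<lambda>v. {u \<in> V. dist (p u) (p v) \<le> 68}"
  let ?A = "\<Union>v\<in>N. {v} \<times> ?B v \<union> ?B v \<times> {v}"
  have "Ebad \<subseteq> ?A"
    using connE by (auto simp: Ebad_def conn_def dist_commute)
  moreover have "finite ?A" using finN fin by auto
  ultimately have "card Ebad \<le> card ?A" by (intro card_mono)
  also have "\<dots> \<le> (\<Sum>v\<in>N. card ({v} \<times> ?B v \<union> ?B v \<times> {v}))"
    by (rule card_UN_le[OF finN])
  also have "\<dots> \<le> (\<Sum>v\<in>N. 2 * N0)"
  proof (rule sum_mono)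
    fix v assume "v \<in> N"
    then have "card (?B v) \<le> N0" using pack by (simp add: N_def)
    moreover have "card ({v} \<times> ?B v \<union> ?B v \<times> {v}) \<le> card ({v} \<times> ?B v) + card (?B v \<times> {v})"
      by (rule card_Un_le)
    ultimately show "card ({v} \<times> ?B v \<union> ?B v \<times> {v}) \<le> 2 * N0"
      by (simp add: card_cartesian_product)
  qed
  finally show ?thesis by (simp add: mult.commute)
qed

text \<open>The vacant sides number \<open>2 * (card F - card E1)\<close>. As a connected graph has
  at least \<open>card V - 1\<close> edges, the edges outside \<open>E1\<close> and one more make up
  for the difference.\<close>

lemma card_Miss_le: "card Miss \<le> 2 * (card Elong + card Ebad + 1)"
proof -
  have "card F \<le> card V" using F fin by (intro card_mono)
  also have "\<dots> \<le> card E + 1" using conn_card_le fin connE by auto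
  also have "card E = card E1 + card Elong + card Ebad"
    using E_split finE by (metis card_Un_disjoint Int_Un_distrib2 Un_empty finite_Un)
  finally show ?thesis using card_Miss by simp
qed

text \<open>An edge longer than the cap loses 34 when the cap is halved and regains at most 2 from
  the motion of its ends. A short edge has slope 2, so the same motion costs 4.\<close>

lemma hat_edge_long: "(u, v) \<in> Elong \<Longrightarrow> phi 34 (dist (p (h u)) (p (h v))) \<le> phi 68 (dist (p u) (p v)) - 32"
  and hat_edge_bad: "(u, v) \<in> Ebad \<Longrightarrow> phi 34 (dist (p (h u)) (p (h v))) \<le> phi 68 (dist (p u) (p v)) + 4"
proof -
  have *: "dist (p (h u)) (p (h v)) \<le> dist (p u) (p v) + 2" if "u \<in> V" "v \<in> V"
    using hat(2)[OF that(1)] hat(2)[OF that(2)] dist_triangle[of "p (h u)" "p (h v)" "p u"]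
      dist_triangle[of "p u" "p (h v)" "p v"] by (simp add: dist_commute)
  show "(u, v) \<in> Elong \<Longrightarrow> phi 34 (dist (p (h u)) (p (h v))) \<le> phi 68 (dist (p u) (p v)) - 32"
    "(u, v) \<in> Ebad \<Longrightarrow> phi 34 (dist (p (h u)) (p (h v))) \<le> phi 68 (dist (p u) (p v)) + 4"
    using * connE by (auto simp: Elong_def Ebad_def phi_def conn_def min_def)
qed

lemma phi_bounds: "0 \<le> t \<Longrightarrow> 0 \<le> phi 34 t" "phi 34 t \<le> 2 * t"
  by (auto simp: phi_def min_def)

theorem refined_graph_exists:
  "\<exists>E'. conn V' E' \<and> gweight 34 p E' \<le>
     gweight 68 p E + 32 + 320 * (\<Sum>v\<in>F. (\<alpha> v)\<^sup>2) + 84 * N0 * card (V - F)"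
proof -
  let ?w = "\<lambda>(x, y). phi 34 (dist (p x) (p y))"
  have w0: "0 \<le> ?w z" for z using phi_bounds(1) by (auto split: prod.splits)
  have w2: "sum ?w P \<le> 2 * (\<Sum>(x, y)\<in>P. dist (p x) (p y))" for P
    unfolding sum_distrib_left using phi_bounds(2) by (intro sum_mono) (auto split: prod.splits)
  define okP where "okP u v P \<longleftrightarrow> finite P \<and> P \<subseteq> V' \<times> V' \<and> (h u, h v) \<in> (P \<union> P\<inverse>)\<^sup>* \<and>
    (\<forall>x\<in>V'. pr x = u \<and> 0 < dir u v * ((p x - p (h u)) \<bullet> e u) \<longrightarrow> (h u, x) \<in> (P \<union> P\<inverse>)\<^sup>*) \<and>
    (\<forall>x\<in>V'. pr x = v \<and> 0 < dir v u * ((p x - p (h v)) \<bullet> e v) \<longrightarrow> (h u, x) \<in> (P \<union> P\<inverse>)\<^sup>*) \<and>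
    (\<Sum>(x, y)\<in>P. dist (p x) (p y)) \<le>
      dist (p u) (p v) - dir u v * q u - dir v u * q v + 80 * ((\<alpha> u)\<^sup>2 + (\<alpha> v)\<^sup>2)" for u v P
  have "\<forall>a\<in>E1. \<exists>P. okP (fst a) (snd a) P"
    using edge_path unfolding okP_def by auto
  then obtain P where "\<forall>a\<in>E1. okP (fst a) (snd a) (P a)" by (rule bchoice[THEN exE])
  then have P0: "okP u v (P (u, v))" if "(u, v) \<in> E1" for u v using that by force
  have P: "\<And>u v. (u, v) \<in> E1 \<Longrightarrow> finite (P (u, v)) \<and> P (u, v) \<subseteq> V' \<times> V'"
    "\<And>u v. (u, v) \<in> E1 \<Longrightarrow> (h u, h v) \<in> (P (u, v) \<union> (P (u, v))\<inverse>)\<^sup>*"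
    "\<And>u v x. (u, v) \<in> E1 \<Longrightarrow> x \<in> V' \<Longrightarrow> pr x = u \<Longrightarrow> 0 < dir u v * ((p x - p (h u)) \<bullet> e u) \<Longrightarrow> (h u, x) \<in> (P (u, v) \<union> (P (u, v))\<inverse>)\<^sup>*"
    "\<And>u v x. (u, v) \<in> E1 \<Longrightarrow> x \<in> V' \<Longrightarrow> pr x = v \<Longrightarrow> 0 < dir v u * ((p x - p (h v)) \<bullet> e v) \<Longrightarrow> (h u, x) \<in> (P (u, v) \<union> (P (u, v))\<inverse>)\<^sup>*"
    "\<And>u v. (u, v) \<in> E1 \<Longrightarrow> (\<Sum>(x, y)\<in>P (u, v). dist (p x) (p y)) \<le>
      dist (p u) (p v) - dir u v * q u - dir v u * q v + 80 * ((\<alpha> u)\<^sup>2 + (\<alpha> v)\<^sup>2)"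
    using P0 unfolding okP_def by blast+
  define okR where "okR v b R \<longleftrightarrow> finite R \<and> R \<subseteq> V' \<times> V' \<and>
    (\<forall>x\<in>V'. pr x = v \<and> 0 < b * ((p x - p (h v)) \<bullet> e v) \<longrightarrow> (h v, x) \<in> (R \<union> R\<inverse>)\<^sup>*) \<and>
    (\<Sum>(x, y)\<in>R. dist (p x) (p y)) \<le> 7" for v b R
  have "\<forall>m\<in>Miss. \<exists>R. okR (fst m) (snd m) R"
    using miss_path unfolding okR_def Miss_def by auto
  then obtain R where "\<forall>m\<in>Miss. okR (fst m) (snd m) (R m)" by (rule bchoice[THEN exE])
  then have R0: "okR v b (R (v, b))" if "(v, b) \<in> Miss" for v b using that by force
  have R: "\<And>m. m \<in> Miss \<Longrightarrow> finite (R m) \<and> R m \<subseteq> V' \<times> V'"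
    "\<And>v b x. (v, b) \<in> Miss \<Longrightarrow> x \<in> V' \<Longrightarrow> pr x = v \<Longrightarrow> 0 < b * ((p x - p (h v)) \<bullet> e v) \<Longrightarrow> (h v, x) \<in> (R (v, b) \<union> (R (v, b))\<inverse>)\<^sup>*"
    "\<And>m. m \<in> Miss \<Longrightarrow> (\<Sum>(x, y)\<in>R m. dist (p x) (p y)) \<le> 7"
    using R0 unfolding okR_def by (blast | force)+
  \<comment> \<open>\<open>A\<close> refines the short flat edges, \<open>B\<close> carries over all
    other edges, \<open>C\<close> adds the dead ends on vacant sides, and \<open>D\<close> joins the
    points around a non-flat vertex by a star.\<close>
  define A where "A = (\<Union>a\<in>E1. P a)"
  define B where "B = (\<lambda>(u, v). (h u, h v)) ` (Elong \<union> Ebad)"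
  define C where "C = (\<Union>m\<in>Miss. R m)"
  define D where "D = (\<Union>v\<in>N. (\<lambda>x. (h v, x)) ` {x \<in> V'. pr x = v})"
  define E' where "E' = A \<union> B \<union> C \<union> D"
  have finN: "finite N" using fin by (simp add: N_def)
  have fEE: "finite Elong" "finite Ebad" using finE E_split(1) by (metis finite_Un)+
  have EV: "u \<in> V \<and> v \<in> V" if "(u, v) \<in> E" for u v using connE that by (auto simp: conn_def)
  have "A \<subseteq> V' \<times> V'" using P(1) by (fastforce simp: A_def)
  moreover have "B \<subseteq> V' \<times> V'" using hat(1) EV E_split(1) by (fastforce simp: B_def)
  moreover have "C \<subseteq> V' \<times> V'" using R(1) by (fastforce simp: C_def)
  moreover have "D \<subseteq> V' \<times> V'" using hat(1) by (auto simp: D_def N_def)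
  ultimately have sub: "E' \<subseteq> V' \<times> V'" by (simp add: E'_def)
  have fABCD: "finite A" "finite B" "finite C" "finite D"
    using P(1) R(1) finE1 finMiss fEE finN fin by (auto simp: A_def B_def C_def D_def)
  let ?C = "(E' \<union> E'\<inverse>)\<^sup>*"
  have mono: "(Q \<union> Q\<inverse>)\<^sup>* \<subseteq> ?C" if "Q \<subseteq> E'" for Q
    using that by (intro rtrancl_mono) auto
  have C_sym: "(x, y) \<in> ?C \<Longrightarrow> (y, x) \<in> ?C" for x y by (rule sym_rtrancl_sym)
  have PE: "P a \<subseteq> E'" if "a \<in> E1" for a using that by (auto simp: E'_def A_def)
  have RE: "R m \<subseteq> E'" if "m \<in> Miss" for m using that by (auto simp: E'_def C_def)
  have hat_conn1: "(h u, h v) \<in> ?C" if "(u, v) \<in> E" for u v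
  proof -
    consider "(u, v) \<in> E1" | "(u, v) \<in> Elong \<union> Ebad" using \<open>(u, v) \<in> E\<close> E_split(1) by blast
    then show ?thesis
    proof cases
      case 1
      then show ?thesis using P(2)[OF 1] mono[OF PE[OF 1]] by auto
    next
      case 2
      then have "(h u, h v) \<in> E'" by (force simp: E'_def B_def)
      then show ?thesis by auto
    qed
  qed
  have hat_conn: "(h u, h v) \<in> ?C" if "u \<in> V" "v \<in> V" for u v
  proof -
    have "(u, v) \<in> (E \<union> E\<inverse>)\<^sup>*" using connE that by (auto simp: conn_def)
    then show ?thesis
    proof (induction rule: rtrancl_induct)
      case (step y z)
      then have "(h y, h z) \<in> ?C" using hat_conn1 C_sym by auto
      with step show ?case by (meson rtrancl_trans)
    qed simp
  qed
  have pt_conn: "(h (pr x), x) \<in> ?C" if x: "x \<in> V'" for x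
  proof (cases "pr x \<in> F")
    case False
    then have "(h (pr x), x) \<in> E'" using x pr(1) by (auto simp: E'_def D_def N_def)
    then show ?thesis by auto
  next
    case True
    let ?v = "pr x"
    let ?t = "(p x - p (h ?v)) \<bullet> e ?v"
    have vV: "?v \<in> V" by (rule pr(1))
    show ?thesis
    proof (cases "x = h ?v")
      case True
      then show ?thesis by (metis rtrancl.rtrancl_refl)
    next
      case False
      have "2 \<le> dist (p (h ?v)) (p x)" using sep'[of "h ?v" x] hat(1)[OF vV] x False by auto
      then have t: "19/10 \<le> \<bar>?t\<bar>"
        using near_pair(2)[OF True, of "h ?v" x] hat[OF vV] x pr_dist[OF x] by auto
      \<comment> \<open>The side of \<open>h ?v\<close> on which \<open>x\<close> lies along the
        line of \<open>?v\<close>. If it is vacant, a dead end in \<open>C\<close> reaches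
        \<open>x\<close>; otherwise the path of the edge occupying it does.\<close>
      define b where "b = sgn ?t"
      have b: "b = 1 \<or> b = -1" "0 < b * ?t" using t by (auto simp: b_def sgn_if)
      show ?thesis
      proof (cases "(?v, b) \<in> Miss")
        case True
        then show ?thesis using R(2)[OF True x refl b(2)] mono[OF RE[OF True]] by auto
      next
        case False
        then obtain u where u: "(?v, u) \<in> S" "dir ?v u = b"
          using \<open>?v \<in> F\<close> b by (auto simp: Miss_def)
        then have "(?v, u) \<in> E1 \<or> (u, ?v) \<in> E1" by (auto simp: S_def)
        then show ?thesis
        proof
          assume A: "(?v, u) \<in> E1"
          then show ?thesis using P(3)[OF A x refl] b u(2) mono[OF PE[OF A]] by auto
        next
          assume A: "(u, ?v) \<in> E1"
          then have "(h u, x) \<in> ?C" using P(4)[OF A x refl] b u(2) mono[OF PE[OF A]] by auto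
          moreover have "(h ?v, h u) \<in> ?C"
            using A hat_conn1 C_sym by (auto simp: E1_def)
          ultimately show ?thesis by (meson rtrancl_trans)
        qed
      qed
    qed
  qed
  have "(x, y) \<in> ?C" if "x \<in> V'" "y \<in> V'" for x y
    using C_sym[OF pt_conn[OF that(1)]] hat_conn[OF pr(1) pr(1), of x y] pt_conn[OF that(2)]
    by (meson rtrancl_trans)
  then have conn: "conn V' E'" using sub by (auto simp: conn_def)
  have "sum ?w A \<le> (\<Sum>a\<in>E1. sum ?w (P a))"
    unfolding A_def by (rule sum_UN_le) (use finE1 P(1) w0 in \<open>auto\<close>)
  also have "\<dots> \<le> (\<Sum>(u, v)\<in>E1. phi 68 (dist (p u) (p v)) - 2 * (dir u v * q u + dir v u * q v) + 160 * ((\<alpha> u)\<^sup>2 + (\<alpha> v)\<^sup>2))"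
  proof (rule sum_mono, clarify)
    fix u v assume uv: "(u, v) \<in> E1"
    then have "phi 68 (dist (p u) (p v)) = 2 * dist (p u) (p v)"
      by (auto simp: E1_def phi_def)
    then show "sum ?w (P (u, v)) \<le> phi 68 (dist (p u) (p v)) - 2 * (dir u v * q u + dir v u * q v) + 160 * ((\<alpha> u)\<^sup>2 + (\<alpha> v)\<^sup>2)"
      using w2[of "P (u, v)"] P(5)[OF uv] by (simp add: algebra_simps)
  qed
  \<comment> \<open>Both orientations of an edge supply exactly the terms of its two ends. The later
    coefficient 320 is \<open>2 * 80\<close> from the slope of the weight, times two sides per
    vertex.\<close>
  also have "\<dots> = (\<Sum>(u, v)\<in>E1. phi 68 (dist (p u) (p v))) - 2 * (\<Sum>(v, u)\<in>S. dir v u * q v) + 160 * (\<Sum>(v, u)\<in>S. (\<alpha> v)\<^sup>2)"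
    unfolding sum_S by (simp add: case_prod_unfold sum.distrib sum_subtractf sum_distrib_left)
  finally have sA: "sum ?w A \<le> (\<Sum>(u, v)\<in>E1. phi 68 (dist (p u) (p v))) + 2 * card Miss + 320 * (\<Sum>v\<in>F. (\<alpha> v)\<^sup>2)"
    using sum_dir_q_le sum_alpha_S by simp
  have "sum ?w B \<le> (\<Sum>(u, v)\<in>Elong \<union> Ebad. phi 34 (dist (p (h u)) (p (h v))))"
  proof -
    have "sum ?w B \<le> sum (?w \<circ> (\<lambda>(u, v). (h u, h v))) (Elong \<union> Ebad)"
      unfolding B_def by (rule sum_image_le) (use fEE w0 in auto)
    then show ?thesis by (simp add: comp_def case_prod_unfold)
  qed
  also have "\<dots> = (\<Sum>(u, v)\<in>Elong. phi 34 (dist (p (h u)) (p (h v)))) + (\<Sum>(u, v)\<in>Ebad. phi 34 (dist (p (h u)) (p (h v))))"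
    using fEE E_split by (intro sum.union_disjoint) auto
  also have "(\<Sum>(u, v)\<in>Elong. phi 34 (dist (p (h u)) (p (h v)))) \<le> (\<Sum>(u, v)\<in>Elong. phi 68 (dist (p u) (p v)) - 32)"
    using hat_edge_long by (intro sum_mono) auto
  also have "(\<Sum>(u, v)\<in>Ebad. phi 34 (dist (p (h u)) (p (h v)))) \<le> (\<Sum>(u, v)\<in>Ebad. phi 68 (dist (p u) (p v)) + 4)"
    using hat_edge_bad by (intro sum_mono) auto
  finally have sB: "sum ?w B \<le> (\<Sum>(u, v)\<in>Elong. phi 68 (dist (p u) (p v))) - 32 * card Elong
      + ((\<Sum>(u, v)\<in>Ebad. phi 68 (dist (p u) (p v))) + 4 * card Ebad)"
    by (simp add: case_prod_unfold sum.distrib sum_subtractf)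
  have "sum ?w C \<le> (\<Sum>m\<in>Miss. sum ?w (R m))"
    unfolding C_def by (rule sum_UN_le) (use finMiss R(1) w0 in \<open>auto\<close>)
  also have "\<dots> \<le> (\<Sum>m\<in>Miss. 14)"
    using order_trans[OF w2 mult_left_mono[OF R(3), of _ 2]] by (intro sum_mono) simp
  finally have sC: "sum ?w C \<le> 14 * card Miss" by simp
  have "sum ?w D \<le> (\<Sum>v\<in>N. sum ?w ((\<lambda>x. (h v, x)) ` {x \<in> V'. pr x = v}))"
    unfolding D_def by (rule sum_UN_le) (use finN fin w0 in \<open>auto\<close>)
  also have "\<dots> \<le> (\<Sum>v\<in>N. 12 * real N0)"
  proof (rule sum_mono)
    fix v assume "v \<in> N"
    then have v: "v \<in> V" by (simp add: N_def)
    have sub: "{x \<in> V'. pr x = v} \<subseteq> {x \<in> V'. dist (p x) (p v) \<le> 5}" using pr_dist by auto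
    have "sum ?w ((\<lambda>x. (h v, x)) ` {x \<in> V'. pr x = v}) = (\<Sum>x\<in>{x \<in> V'. pr x = v}. phi 34 (dist (p (h v)) (p x)))"
      by (subst sum.reindex) (auto simp: inj_on_def)
    also have "\<dots> \<le> (\<Sum>x\<in>{x \<in> V'. pr x = v}. 12)"
    proof (rule sum_mono)
      fix x assume "x \<in> {x \<in> V'. pr x = v}"
      then have "dist (p x) (p v) \<le> 5" using sub by auto
      then have "dist (p (h v)) (p x) \<le> 6"
        using hat(2)[OF v] dist_triangle2[of "p (h v)" "p x" "p v"] by simp
      then show "phi 34 (dist (p (h v)) (p x)) \<le> 12" using phi_bounds(2)[of "dist (p (h v)) (p x)"] by simp
    qed
    also have "\<dots> \<le> 12 * real N0"
      using card_mono[OF _ sub] pack'[OF v] fin by simp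
    finally show "sum ?w ((\<lambda>x. (h v, x)) ` {x \<in> V'. pr x = v}) \<le> 12 * real N0" .
  qed
  finally have sD: "sum ?w D \<le> 12 * N0 * card N" by (simp add: mult.commute)
  have "gweight 34 p E' = sum ?w E'" by (simp add: gweight_def)
  also have "\<dots> \<le> sum ?w A + sum ?w B + sum ?w C + sum ?w D"
    unfolding E'_def
    using sum_Un_le[of A B ?w] sum_Un_le[of "A \<union> B" C ?w] sum_Un_le[of "A \<union> B \<union> C" D ?w] fABCD w0
    by (simp add: finite_UnI)
  also have "\<dots> \<le> gweight 68 p E + 16 * card Miss - 32 * card Elong + 4 * card Ebad
      + 320 * (\<Sum>v\<in>F. (\<alpha> v)\<^sup>2) + 12 * N0 * card N"
  proof -
    let ?v = "\<lambda>(u, v). phi 68 (dist (p u) (p v))"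
    have "gweight 68 p E = sum ?v (E1 \<union> Elong \<union> Ebad)"
      using E_split(1) by (simp add: gweight_def)
    also have "\<dots> = sum ?v (E1 \<union> Elong) + sum ?v Ebad"
      using E_split finE1 fEE by (intro sum.union_disjoint) auto
    also have "sum ?v (E1 \<union> Elong) = sum ?v E1 + sum ?v Elong"
      using E_split finE1 fEE by (intro sum.union_disjoint) auto
    finally have "gweight 68 p E = sum ?v E1 + sum ?v Elong + sum ?v Ebad" .
    then show ?thesis using sA sB sC sD by linarith
  qed
  \<comment> \<open>Each long edge absorbs \<open>16 * 2 = 32\<close>. A bad edge costs
    \<open>32 + 4\<close> and there are at most \<open>2 * N0\<close> of them per non-flat vertex,
    which gives \<open>72 + 12 = 84\<close>. The single 32 stems from the \<open>+ 1\<close> in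
    \<open>card_Miss_le\<close>.\<close>
  also have "\<dots> \<le> gweight 68 p E + 32 + 320 * (\<Sum>v\<in>F. (\<alpha> v)\<^sup>2) + 84 * N0 * card N"
  proof -
    have "real (card Miss) \<le> 2 * (real (card Elong) + real (card Ebad) + 1)"
      using of_nat_mono[OF card_Miss_le, where 'a = real] by simp
    moreover have "real (card Ebad) \<le> 2 * (real N0 * real (card N))"
      using of_nat_mono[OF card_Ebad, where 'a = real] by simp
    ultimately show ?thesis by simp
  qed
  finally show ?thesis using conn by (auto simp: N_def)
qed

end

subsection \<open>The limit curve of a flat tree\<close>

text \<open>Points at distance at least 2 cannot share an open unit ball, so they inject into the
  centres of a finite cover of the ball of radius \<open>R\<close>. Translation by \<open>c\<close>
  makes the bound uniform in \<open>c\<close>, \<open>V\<close> and \<open>p\<close>.\<close>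

lemma packing_bound:
  obtains N0 :: nat where "\<And>(V :: 'b set) (p :: 'b \<Rightarrow> 'a::euclidean_space) c. finite V \<Longrightarrow>
    (\<And>u v. u \<in> V \<Longrightarrow> v \<in> V \<Longrightarrow> u \<noteq> v \<Longrightarrow> 2 \<le> dist (p u) (p v)) \<Longrightarrow> card {u \<in> V. dist (p u) c \<le> R} \<le> N0"
proof -
  have "compact (cball (0::'a) R)" by simp
  then obtain k where k: "finite k" "cball (0::'a) R \<subseteq> (\<Union>x\<in>k. ball x 1)"
    unfolding compact_eq_totally_bounded by (meson zero_less_one)
  have "card {u \<in> V. dist (p u) c \<le> R} \<le> card k"
    if V: "finite V" "\<And>u v. u \<in> V \<Longrightarrow> v \<in> V \<Longrightarrow> u \<noteq> v \<Longrightarrow> 2 \<le> dist (p u) (p v)"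
    for V :: "'b set" and p :: "'b \<Rightarrow> 'a" and c
  proof -
    let ?U = "{u \<in> V. dist (p u) c \<le> R}"
    have "\<forall>u\<in>?U. \<exists>x. x \<in> k \<and> dist x (p u - c) < 1"
    proof
      fix u assume "u \<in> ?U"
      then have "p u - c \<in> cball 0 R" by (simp add: dist_norm norm_minus_commute)
      then have "p u - c \<in> (\<Union>x\<in>k. ball x 1)" using k(2) by (rule set_mp[rotated])
      then show "\<exists>x. x \<in> k \<and> dist x (p u - c) < 1" by auto
    qed
    then obtain g where g: "\<forall>u\<in>?U. g u \<in> k \<and> dist (g u) (p u - c) < 1"
      by (rule bchoice[THEN exE])
    have "inj_on g ?U"
    proof (rule inj_onI)
      fix u v assume uv: "u \<in> ?U" "v \<in> ?U" "g u = g v"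
      then have "dist (p u - c) (p v - c) < 2"
        using g dist_triangle_half_r[of "g u" "p u - c" 2 "p v - c"] by force
      then show "u = v" using V(2)[of u v] uv by (force simp: dist_norm)
    qed
    then show ?thesis
      using g k(1) by (intro card_inj_on_le[of g]) auto
  qed
  then show thesis using that by blast
qed

lemma minimal_simple_graph:
  assumes "finite V" "conn V E0" "0 < g"
    and "\<And>u v. u \<in> V \<Longrightarrow> v \<in> V \<Longrightarrow> u \<noteq> v \<Longrightarrow> p u \<noteq> p v"
  obtains E where "conn V E" "gweight g p E \<le> gweight g p E0"
    "\<And>u v w. (u, v) \<in> E \<Longrightarrow> w \<in> V \<Longrightarrow> dist (p u) (p w) < dist (p u) (p v) \<Longrightarrow> dist (p u) (p v) \<le> dist (p w) (p v)"
    "\<And>v. (v, v) \<notin> E" "\<And>u v. (u, v) \<in> E \<Longrightarrow> (v, u) \<notin> E"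
proof -
  obtain E1 where E1: "conn V E1" "gweight g p E1 \<le> gweight g p E0"
    "\<And>E'. conn V E' \<Longrightarrow> gweight g p E1 \<le> gweight g p E'"
    using conn_minimal[OF assms(1,2), of "\<lambda>(u, v). phi g (dist (p u) (p v))"]
    unfolding gweight_def by metis
  have fE1: "finite E1" using assms(1) E1(1) by (auto simp: conn_def intro: finite_subset)
  define E where "E = E1 - Id"
  have fE: "finite E" using fE1 by (simp add: E_def)
  have conn_sub: "conn V E'" if "E' \<subseteq> V \<times> V" "conn V D" "\<And>x y. (x, y) \<in> D \<Longrightarrow> x = y \<or> (x, y) \<in> E' \<union> E'\<inverse>" for E' D
  proof -
    have "(D \<union> D\<inverse>)\<^sup>* \<subseteq> (E' \<union> E'\<inverse>)\<^sup>*"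
    proof (rule rtrancl_subset_rtrancl, rule subrelI)
      fix x y assume "(x, y) \<in> D \<union> D\<inverse>"
      then have "x = y \<or> (x, y) \<in> E' \<union> E'\<inverse>"
        using that(3)[of x y] that(3)[of y x] by auto
      then show "(x, y) \<in> (E' \<union> E'\<inverse>)\<^sup>*" by auto
    qed
    then show ?thesis using that(1,2) by (auto simp: conn_def)
  qed
  have cE: "conn V E"
    by (rule conn_sub[OF _ E1(1)]) (use E1(1) in \<open>auto simp: E_def conn_def\<close>)
  have "gweight g p E1 = gweight g p (E1 - Id) + gweight g p (E1 \<inter> Id)"
    unfolding gweight_def using fE1 by (subst sum.union_disjoint[symmetric]) (auto intro!: sum.cong)
  moreover have "gweight g p (E1 \<inter> Id) = 0"
    unfolding gweight_def by (rule sum.neutral) (use assms(3) in \<open>auto simp: phi_def\<close>)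
  ultimately have w: "gweight g p E = gweight g p E1" by (simp add: E_def)
  show thesis
  proof (rule that[OF cE])
    show "gweight g p E \<le> gweight g p E0" using w E1 by simp
    show "(v, v) \<notin> E" for v by (simp add: E_def)
    show "dist (p u) (p v) \<le> dist (p w) (p v)"
      if "(u, v) \<in> E" "w \<in> V" "dist (p u) (p w) < dist (p u) (p v)" for u v w
      using minimal_conn_lune[OF assms(1) cE assms(3) _ that] E1(3) w by simp
    show "(v, u) \<notin> E" if uv: "(u, v) \<in> E" for u v
    proof
      assume vu: "(v, u) \<in> E"
      have "u \<noteq> v" using uv by (auto simp: E_def)
      then have "p u \<noteq> p v" using assms(4) uv cE by (auto simp: conn_def)
      then have "0 < dist (p u) (p v)" by simp
      then have "0 < phi g (dist (p u) (p v))"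
        using assms(3) by (simp add: phi_def min_def add_pos_pos)
      moreover have "gweight g p E = phi g (dist (p u) (p v)) + gweight g p (E - {(u, v)})"
        unfolding gweight_def using fE uv by (subst sum.remove[of _ "(u, v)"]) auto
      moreover have "conn V (E - {(u, v)})"
        by (rule conn_sub[OF _ cE]) (use cE vu \<open>u \<noteq> v\<close> in \<open>auto simp: conn_def\<close>)
      ultimately show False using E1(3) w by force
    qed
  qed
qed

text \<open>\<open>K\<close> depends only on the packing bound and is fixed before the nets. A
  vertex that is not flat needs no line: its cost is bounded, and \<open>(a v)\<^sup>2\<close>
  exceeds 1/100 there.\<close>

lemma refine_network:
  obtains K :: real where "0 \<le> K" and
    "\<And>(V :: 'b set) V' (p :: 'b \<Rightarrow> 'a::euclidean_space) h a E0.
      \<lbrakk>finite V; finite V'; V \<noteq> {};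
       \<And>v. v \<in> V \<Longrightarrow> h v \<in> V' \<and> dist (p (h v)) (p v) \<le> 1;
       \<And>u v. u \<in> V \<Longrightarrow> v \<in> V \<Longrightarrow> u \<noteq> v \<Longrightarrow> 4 \<le> dist (p u) (p v);
       \<And>x y. x \<in> V' \<Longrightarrow> y \<in> V' \<Longrightarrow> x \<noteq> y \<Longrightarrow> 2 \<le> dist (p x) (p y);
       \<And>x. x \<in> V' \<Longrightarrow> \<exists>v\<in>V. dist (p x) (p v) \<le> 5;
       \<And>v. v \<in> V \<Longrightarrow> 0 \<le> a v;
       \<And>v. v \<in> V \<Longrightarrow> \<exists>e o'. norm e = 1 \<and> (\<forall>y\<in>V \<union> V'. dist (p y) (p v) \<le> 80 \<longrightarrow> norm (perp e (p y - o')) \<le> a v);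
       conn V E0\<rbrakk> \<Longrightarrow>
       \<exists>E'. conn V' E' \<and> gweight 34 p E' \<le> gweight 68 p E0 + 32 + K * (\<Sum>v\<in>V. (a v)\<^sup>2)"
proof (rule packing_bound[where R = 68 and ?'b = 'b and ?'a = 'a])
  fix N0 :: nat
  assume N0: "\<And>(V :: 'b set) (p :: 'b \<Rightarrow> 'a) c. finite V \<Longrightarrow>
    (\<And>u v. u \<in> V \<Longrightarrow> v \<in> V \<Longrightarrow> u \<noteq> v \<Longrightarrow> 2 \<le> dist (p u) (p v)) \<Longrightarrow> card {u \<in> V. dist (p u) c \<le> 68} \<le> N0"
  \<comment> \<open>\<open>8400 = 84 * 100\<close>: 84 is the cost factor of a non-flat vertex, and
    100 turns the number of such vertices into a sum of \<open>(a v)\<^sup>2\<close>.\<close>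
  define K where "K = 320 + 8400 * real N0"
  have main: "\<exists>E'. conn V' E' \<and> gweight 34 p E' \<le> gweight 68 p E0 + 32 + K * (\<Sum>v\<in>V. (a v)\<^sup>2)"
    if fin: "finite V" "finite V'" "V \<noteq> {}"
      and h: "\<And>v. v \<in> V \<Longrightarrow> h v \<in> V' \<and> dist (p (h v)) (p v) \<le> 1"
      and sep: "\<And>u v. u \<in> V \<Longrightarrow> v \<in> V \<Longrightarrow> u \<noteq> v \<Longrightarrow> 4 \<le> dist (p u) (p v)"
      and sep': "\<And>x y. x \<in> V' \<Longrightarrow> y \<in> V' \<Longrightarrow> x \<noteq> y \<Longrightarrow> 2 \<le> dist (p x) (p y)"
      and cover: "\<And>x. x \<in> V' \<Longrightarrow> \<exists>v\<in>V. dist (p x) (p v) \<le> 5"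
      and a: "\<And>v. v \<in> V \<Longrightarrow> 0 \<le> a v"
      and line: "\<And>v. v \<in> V \<Longrightarrow> \<exists>e o'. norm e = 1 \<and> (\<forall>y\<in>V \<union> V'. dist (p y) (p v) \<le> 80 \<longrightarrow> norm (perp e (p y - o')) \<le> a v)"
      and conn: "conn V E0"
    for V :: "'b set" and V' and p :: "'b \<Rightarrow> 'a" and h a E0
  proof -
    define F where "F = {v \<in> V. a v \<le> 1/10}"
    have pinj: "p u \<noteq> p v" if "u \<in> V" "v \<in> V" "u \<noteq> v" for u v
      using sep[OF that] by auto
    obtain E where E: "conn V E" "gweight 68 p E \<le> gweight 68 p E0"
      "\<And>u v w. (u, v) \<in> E \<Longrightarrow> w \<in> V \<Longrightarrow> dist (p u) (p w) < dist (p u) (p v) \<Longrightarrow> dist (p u) (p v) \<le> dist (p w) (p v)"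
      "\<And>v. (v, v) \<notin> E" "\<And>u v. (u, v) \<in> E \<Longrightarrow> (v, u) \<notin> E"
      using minimal_simple_graph[OF fin(1) conn, of 68 p] pinj by auto
    have eo: "\<forall>v\<in>V. \<exists>eo. norm (fst eo) = 1 \<and> (\<forall>y\<in>V \<union> V'. dist (p y) (p v) \<le> 80 \<longrightarrow> norm (perp (fst eo) (p y - snd eo)) \<le> a v)"
    proof
      fix v assume "v \<in> V"
      then obtain e o' where "norm e = 1 \<and> (\<forall>y\<in>V \<union> V'. dist (p y) (p v) \<le> 80 \<longrightarrow> norm (perp e (p y - o')) \<le> a v)"
        using line by blast
      then show "\<exists>eo. norm (fst eo) = 1 \<and> (\<forall>y\<in>V \<union> V'. dist (p y) (p v) \<le> 80 \<longrightarrow> norm (perp (fst eo) (p y - snd eo)) \<le> a v)"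
        by (intro exI[of _ "(e, o')"]) simp
    qed
    from eo obtain eo where eo: "\<forall>v\<in>V. norm (fst (eo v)) = 1 \<and>
        (\<forall>y\<in>V \<union> V'. dist (p y) (p v) \<le> 80 \<longrightarrow> norm (perp (fst (eo v)) (p y - snd (eo v))) \<le> a v)"
      by (rule bchoice[THEN exE])
    have aF: "\<And>v. v \<in> F \<Longrightarrow> 0 \<le> a v \<and> a v \<le> 1/10" and FV: "F \<subseteq> V"
      using a by (auto simp: F_def)
    interpret tst_step V V' p h F a "\<lambda>v. fst (eo v)" "\<lambda>v. snd (eo v)" E N0
    proof
      show "card {u \<in> V. dist (p u) (p v) \<le> 68} \<le> N0" for v
        by (rule N0[OF fin(1)]) (use sep in force)
      show "card {x \<in> V'. dist (p x) (p v) \<le> 5} \<le> N0" for v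
      proof -
        have "card {x \<in> V'. dist (p x) (p v) \<le> 5} \<le> card {x \<in> V'. dist (p x) (p v) \<le> 68}"
          using fin by (intro card_mono) auto
        also have "\<dots> \<le> N0" by (rule N0[OF fin(2)]) (use sep' in force)
        finally show ?thesis .
      qed
      show "norm (fst (eo v)) = 1" if "v \<in> F" for v using eo that FV by blast
      show "norm (perp (fst (eo v)) (p y - snd (eo v))) \<le> a v"
        if "v \<in> F" "y \<in> V \<union> V'" "dist (p y) (p v) \<le> 80" for v y
        using eo that FV by blast
    qed (fact fin FV aF E(1,3-5) sep sep' cover | use h in blast)+
    have "real (card (V - F)) * (1/100) = (\<Sum>v\<in>V - F. 1/100)" by simp
    also have "\<dots> \<le> (\<Sum>v\<in>V - F. (a v)\<^sup>2)"
    proof (rule sum_mono)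
      fix v assume "v \<in> V - F"
      then have "1/10 \<le> a v" by (auto simp: F_def)
      then show "1/100 \<le> (a v)\<^sup>2" using power_mono[of "1/10" "a v" 2] by (simp add: power2_eq_square)
    qed
    also have "\<dots> \<le> (\<Sum>v\<in>V. (a v)\<^sup>2)" using fin by (intro sum_mono2) auto
    finally have "84 * real N0 * real (card (V - F)) \<le> 84 * real N0 * (100 * (\<Sum>v\<in>V. (a v)\<^sup>2))"
      by (intro mult_left_mono) auto
    moreover have "(\<Sum>v\<in>F. (a v)\<^sup>2) \<le> (\<Sum>v\<in>V. (a v)\<^sup>2)" using fin by (intro sum_mono2) (auto simp: F_def)
    ultimately have "320 * (\<Sum>v\<in>F. (a v)\<^sup>2) + 84 * N0 * card (V - F) \<le> K * (\<Sum>v\<in>V. (a v)\<^sup>2)"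
      by (simp add: K_def algebra_simps)
    then show ?thesis using refined_graph_exists E(2) by fastforce
  qed
  have "0 \<le> K" by (simp add: K_def)
  then show thesis by (rule that) (rule main)
qed

text \<open>A maximal separated set covers. The prescribed \<open>Y\<close> will be the chosen
  children of the old net, so that every old vertex survives through its child.\<close>

lemma maximal_separated:
  fixes z :: "'b \<Rightarrow> 'a::metric_space"
  assumes "finite X" "Y \<subseteq> X" "0 < \<delta>"
    and "\<And>x y. x \<in> Y \<Longrightarrow> y \<in> Y \<Longrightarrow> x \<noteq> y \<Longrightarrow> \<delta> \<le> dist (z x) (z y)"
  obtains W where "Y \<subseteq> W" "W \<subseteq> X" "\<And>x y. x \<in> W \<Longrightarrow> y \<in> W \<Longrightarrow> x \<noteq> y \<Longrightarrow> \<delta> \<le> dist (z x) (z y)"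
    "\<And>x. x \<in> X \<Longrightarrow> \<exists>w\<in>W. dist (z x) (z w) < \<delta>"
proof -
  define A where "A = {W. W \<subseteq> X \<and> (\<forall>x\<in>W. \<forall>y\<in>W. x \<noteq> y \<longrightarrow> \<delta> \<le> dist (z x) (z y))}"
  have A: "W \<in> A \<longleftrightarrow> W \<subseteq> X \<and> (\<forall>x\<in>W. \<forall>y\<in>W. x \<noteq> y \<longrightarrow> \<delta> \<le> dist (z x) (z y))" for W
    by (simp add: A_def)
  have "finite A" using assms(1) by (simp add: A_def)
  moreover have "Y \<in> A" using assms by (auto simp: A)
  ultimately obtain W where W: "W \<in> A" "Y \<subseteq> W" "\<forall>B\<in>A. W \<subseteq> B \<longrightarrow> W = B"
    using finite_has_maximal2 by blast
  show thesis
  proof (rule that[OF W(2)])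
    show "W \<subseteq> X" using W(1) by (simp add: A)
    show "\<delta> \<le> dist (z x) (z y)" if "x \<in> W" "y \<in> W" "x \<noteq> y" for x y
      using W(1) that by (simp add: A)
    fix x assume x: "x \<in> X"
    show "\<exists>w\<in>W. dist (z x) (z w) < \<delta>"
    proof (rule ccontr)
      assume no: "\<not> ?thesis"
      then have "insert x W \<in> A" using W(1) x by (auto simp: A dist_commute not_less)
      then have "x \<in> W" using W(3) by blast
      then show False using no assms(3) by force
    qed
  qed
qed

lemma perp_scaleR: "perp e (c *\<^sub>R w) = c *\<^sub>R perp e w"
  by (simp add: perp_def algebra_simps)

text \<open>Passing to half the unit of length turns the halved cap back into 68, so every
  generation can use the same refinement step.\<close>

lemma gweight_double:
  fixes z :: "'b \<Rightarrow> 'a::real_normed_vector"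
  shows "gweight 68 (\<lambda>x. 2 *\<^sub>R z x) E = 2 * gweight 34 z E"
proof -
  have "phi 68 (dist (2 *\<^sub>R a) (2 *\<^sub>R b)) = 2 * phi 34 (dist a b)" for a b :: 'a
  proof -
    have "dist (2 *\<^sub>R a) (2 *\<^sub>R b) = norm (2 *\<^sub>R (a - b))"
      by (simp only: dist_norm scaleR_diff_right)
    then have "dist (2 *\<^sub>R a) (2 *\<^sub>R b) = 2 * dist a b" by (simp add: dist_norm)
    then show ?thesis by (simp add: phi_def min_def)
  qed
  then show ?thesis by (simp add: gweight_def sum_distrib_left case_prod_unfold)
qed

lemma dist_le_gweight:
  fixes z :: "'b \<Rightarrow> 'a::metric_space"
  shows "(\<Sum>(x, y)\<in>E. dist (z x) (z y)) \<le> gweight 68 z E"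
  unfolding gweight_def by (intro sum_mono) (auto simp: phi_def)

text \<open>The flatness at \<open>P\<close> is recorded at a child \<open>R\<close>, because the
  coefficient of a cube will control its own generation and the next coarser one. The children
  chosen by net points are distinct, so a sum over all of \<open>T (Suc j)\<close>
  dominates.\<close>

locale flat_tree =
  fixes T :: "nat \<Rightarrow> 'b set" and z :: "'b \<Rightarrow> 'a::euclidean_space" and a :: "'b \<Rightarrow> real" and r B :: real
  assumes fin: "\<And>j. finite (T j)" and ne: "T 0 \<noteq> {}" and r: "0 < r"
    and up: "\<And>j R. R \<in> T (Suc j) \<Longrightarrow> \<exists>P\<in>T j. dist (z R) (z P) \<le> r / 2 ^ j"
    and down: "\<And>j P. P \<in> T j \<Longrightarrow> \<exists>R\<in>T (Suc j). dist (z R) (z P) \<le> r / 2 ^ j \<and>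
      (\<exists>e o'. norm e = 1 \<and> (\<forall>y\<in>T j \<union> T (Suc j). dist (z y) (z P) \<le> 80 * (r / 2 ^ j) \<longrightarrow>
        norm (perp e (z y - o')) \<le> a R * (r / 2 ^ j)))"
    and a: "\<And>R. 0 \<le> a R"
    and bound: "\<And>n. (\<Sum>j<n. \<Sum>R\<in>T (Suc j). (a R)\<^sup>2 * (r / 2 ^ j)) \<le> B"
begin

definition "rad j = r / 2 ^ j"

lemma rad_pos: "0 < rad j" and rad_Suc: "rad (Suc j) = rad j / 2"
  using r by (auto simp: rad_def)

definition "pos j x = (1 / rad j) *\<^sub>R z x"

lemma pos_Suc: "pos (Suc j) = (\<lambda>x. 2 *\<^sub>R pos j x)"
  by (auto simp: pos_def rad_Suc)

lemma dist_pos: "dist (pos j x) (pos j y) = dist (z x) (z y) / rad j"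
proof -
  have "dist (pos j x) (pos j y) = norm ((1 / rad j) *\<^sub>R (z x - z y))"
    by (simp add: pos_def dist_norm scaleR_diff_right)
  then show ?thesis using rad_pos[of j] by (simp add: dist_norm)
qed

lemma dist_pos_le: "dist (pos j x) (pos j y) \<le> c \<longleftrightarrow> dist (z x) (z y) \<le> c * rad j"
  and le_dist_pos: "c \<le> dist (pos j x) (pos j y) \<longleftrightarrow> c * rad j \<le> dist (z x) (z y)"
  using rad_pos[of j] by (simp_all add: dist_pos pos_divide_le_eq pos_le_divide_eq)

definition "net j V \<longleftrightarrow> V \<noteq> {} \<and> V \<subseteq> T j \<and>
  (\<forall>x\<in>V. \<forall>y\<in>V. x \<noteq> y \<longrightarrow> 4 * rad j \<le> dist (z x) (z y)) \<and>
  (\<forall>x\<in>T j. \<exists>v\<in>V. dist (z x) (z v) < 4 * rad j)"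

lemma net_step:
  obtains K where "0 \<le> K" and "\<And>j V E. net j V \<Longrightarrow> conn V E \<Longrightarrow>
    \<exists>V' E'. net (Suc j) V' \<and> conn V' E' \<and> rad (Suc j) * gweight 68 (pos (Suc j)) E' \<le>
      rad j * gweight 68 (pos j) E + 32 * rad j + K * (\<Sum>R\<in>T (Suc j). (a R)\<^sup>2 * rad j)"
proof (rule refine_network[where ?'b = 'b and ?'a = 'a])
  fix K :: real
  assume K: "0 \<le> K" and step: "\<And>(V :: 'b set) V' (p :: 'b \<Rightarrow> 'a) h a E0.
      \<lbrakk>finite V; finite V'; V \<noteq> {};
       \<And>v. v \<in> V \<Longrightarrow> h v \<in> V' \<and> dist (p (h v)) (p v) \<le> 1;
       \<And>u v. u \<in> V \<Longrightarrow> v \<in> V \<Longrightarrow> u \<noteq> v \<Longrightarrow> 4 \<le> dist (p u) (p v);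
       \<And>x y. x \<in> V' \<Longrightarrow> y \<in> V' \<Longrightarrow> x \<noteq> y \<Longrightarrow> 2 \<le> dist (p x) (p y);
       \<And>x. x \<in> V' \<Longrightarrow> \<exists>v\<in>V. dist (p x) (p v) \<le> 5;
       \<And>v. v \<in> V \<Longrightarrow> 0 \<le> a v;
       \<And>v. v \<in> V \<Longrightarrow> \<exists>e o'. norm e = 1 \<and> (\<forall>y\<in>V \<union> V'. dist (p y) (p v) \<le> 80 \<longrightarrow> norm (perp e (p y - o')) \<le> a v);
       conn V E0\<rbrakk> \<Longrightarrow>
       \<exists>E'. conn V' E' \<and> gweight 34 p E' \<le> gweight 68 p E0 + 32 + K * (\<Sum>v\<in>V. (a v)\<^sup>2)"
  have main: "\<exists>V' E'. net (Suc j) V' \<and> conn V' E' \<and> rad (Suc j) * gweight 68 (pos (Suc j)) E' \<le>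
      rad j * gweight 68 (pos j) E + 32 * rad j + K * (\<Sum>R\<in>T (Suc j). (a R)\<^sup>2 * rad j)"
    if V: "net j V" and E: "conn V E" for j V E
  proof -
    let ?q = "rad j"
    have VT: "V \<subseteq> T j" and Vne: "V \<noteq> {}"
      and sepV: "\<And>x y. x \<in> V \<Longrightarrow> y \<in> V \<Longrightarrow> x \<noteq> y \<Longrightarrow> 4 * ?q \<le> dist (z x) (z y)"
      and covV: "\<And>x. x \<in> T j \<Longrightarrow> \<exists>v\<in>V. dist (z x) (z v) < 4 * ?q"
      using V by (auto simp: net_def)
    have q: "0 < ?q" by (rule rad_pos)
    define good where "good P R \<longleftrightarrow> R \<in> T (Suc j) \<and> dist (z R) (z P) \<le> ?q \<and>
      (\<exists>e o'. norm e = 1 \<and> (\<forall>y\<in>T j \<union> T (Suc j). dist (z y) (z P) \<le> 80 * ?q \<longrightarrow>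
        norm (perp e (z y - o')) \<le> a R * ?q))" for P R
    have "\<forall>P\<in>V. \<exists>R. good P R"
      using down[of _ j] VT unfolding good_def rad_def by blast
    then obtain h where h: "\<forall>P\<in>V. good P (h P)" by (rule bchoice[THEN exE])
    have hT: "h v \<in> T (Suc j)" and hd: "dist (z (h v)) (z v) \<le> ?q" if "v \<in> V" for v
      using h that by (auto simp: good_def)
    \<comment> \<open>\<open>4 - 1 - 1 = 2\<close> in units of \<open>rad j\<close>, which is the
      separation \<open>4 * rad (Suc j)\<close> of the next net. It also makes \<open>h\<close>
      injective, so that no coefficient is counted twice.\<close>
    have hsep: "2 * ?q \<le> dist (z (h u)) (z (h v))" if "u \<in> V" "v \<in> V" "u \<noteq> v" for u v
      using sepV[OF that] hd[OF that(1)] hd[OF that(2)] dist_triangle[of "z u" "z v" "z (h u)"]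
        dist_triangle[of "z (h u)" "z v" "z (h v)"] by (simp add: dist_commute)
    have hinj: "inj_on h V"
      using hsep q by (fastforce simp: inj_on_def)
    obtain V' where V': "h ` V \<subseteq> V'" "V' \<subseteq> T (Suc j)"
      "\<And>x y. x \<in> V' \<Longrightarrow> y \<in> V' \<Longrightarrow> x \<noteq> y \<Longrightarrow> 2 * ?q \<le> dist (z x) (z y)"
      "\<And>x. x \<in> T (Suc j) \<Longrightarrow> \<exists>w\<in>V'. dist (z x) (z w) < 2 * ?q"
    proof (rule maximal_separated[OF fin[of "Suc j"], of "h ` V" "2 * ?q" z])
      show "h ` V \<subseteq> T (Suc j)" using hT by blast
      show "0 < 2 * ?q" using q by simp
      show "2 * ?q \<le> dist (z x) (z y)" if "x \<in> h ` V" "y \<in> h ` V" "x \<noteq> y" for x y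
        using that hsep by auto
    qed (rule that)
    have "net (Suc j) V'"
      using V' Vne by (auto simp: net_def rad_Suc)
    have "\<exists>E'. conn V' E' \<and> gweight 34 (pos j) E' \<le> gweight 68 (pos j) E + 32 + K * (\<Sum>v\<in>V. (a (h v))\<^sup>2)"
    proof (rule step[where h = h])
      show "finite V" "finite V'" using VT V'(2) fin finite_subset by blast+
      show "V \<noteq> {}" "conn V E" by fact+
      show "h v \<in> V' \<and> dist (pos j (h v)) (pos j v) \<le> 1" if "v \<in> V" for v
        using V'(1) hd[OF that] that by (auto simp: dist_pos_le)
      show "4 \<le> dist (pos j u) (pos j v)" if "u \<in> V" "v \<in> V" "u \<noteq> v" for u v
        using sepV[OF that] by (simp add: le_dist_pos)
      show "2 \<le> dist (pos j x) (pos j y)" if "x \<in> V'" "y \<in> V'" "x \<noteq> y" for x y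
        using V'(3)[OF that] by (simp add: le_dist_pos)
      \<comment> \<open>\<open>5 = 1 + 4\<close>: from \<open>x\<close> to its parent, and from the
        parent to the old net.\<close>
      show "\<exists>v\<in>V. dist (pos j x) (pos j v) \<le> 5" if "x \<in> V'" for x
      proof -
        obtain P where P: "P \<in> T j" "dist (z x) (z P) \<le> ?q"
          using up[of x j] \<open>x \<in> V'\<close> V'(2) unfolding rad_def by blast
        obtain v where v: "v \<in> V" "dist (z P) (z v) < 4 * ?q" using covV[OF P(1)] by blast
        have "dist (z x) (z v) \<le> 5 * ?q"
          using dist_triangle[of "z x" "z v" "z P"] P(2) v(2) by simp
        then show ?thesis using v(1) by (auto simp: dist_pos_le)
      qed
      show "0 \<le> a (h v)" for v by (rule a)
      show "\<exists>e o'. norm e = 1 \<and> (\<forall>y\<in>V \<union> V'. dist (pos j y) (pos j v) \<le> 80 \<longrightarrow> norm (perp e (pos j y - o')) \<le> a (h v))"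
        if "v \<in> V" for v
      proof -
        obtain e o' where eo: "norm e = 1" "\<forall>y\<in>T j \<union> T (Suc j). dist (z y) (z v) \<le> 80 * ?q \<longrightarrow>
          norm (perp e (z y - o')) \<le> a (h v) * ?q"
          using bspec[OF h \<open>v \<in> V\<close>] unfolding good_def by blast
        have "norm (perp e (pos j y - (1 / ?q) *\<^sub>R o')) \<le> a (h v)"
          if y: "y \<in> V \<union> V'" "dist (pos j y) (pos j v) \<le> 80" for y
        proof -
          have "norm (perp e (z y - o')) \<le> a (h v) * ?q"
            using eo(2) y VT V'(2) by (auto simp: dist_pos_le)
          moreover have "perp e (pos j y - (1 / ?q) *\<^sub>R o') = (1 / ?q) *\<^sub>R perp e (z y - o')"
            by (simp add: pos_def flip: scaleR_diff_right perp_scaleR)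
          ultimately show ?thesis using q by (simp add: pos_divide_le_eq)
        qed
        then show ?thesis using eo(1) by blast
      qed
    qed
    then obtain E' where E': "conn V' E'"
      "gweight 34 (pos j) E' \<le> gweight 68 (pos j) E + 32 + K * (\<Sum>v\<in>V. (a (h v))\<^sup>2)" by blast
    have "(\<Sum>v\<in>V. (a (h v))\<^sup>2) = (\<Sum>R\<in>h ` V. (a R)\<^sup>2)"
      using hinj by (simp add: sum.reindex)
    also have "\<dots> \<le> (\<Sum>R\<in>T (Suc j). (a R)\<^sup>2)"
      using hT fin by (intro sum_mono2) auto
    finally have "gweight 34 (pos j) E' \<le> gweight 68 (pos j) E + 32 + K * (\<Sum>R\<in>T (Suc j). (a R)\<^sup>2)"
      using E'(2) mult_left_mono[OF _ K] by fastforce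
    then have "?q * gweight 34 (pos j) E' \<le> ?q * (gweight 68 (pos j) E + 32 + K * (\<Sum>R\<in>T (Suc j). (a R)\<^sup>2))"
      using q by (intro mult_left_mono) auto
    also have "\<dots> = ?q * gweight 68 (pos j) E + 32 * ?q + K * (\<Sum>R\<in>T (Suc j). (a R)\<^sup>2 * ?q)"
      by (simp add: algebra_simps sum_distrib_left sum_distrib_right)
    finally have "rad (Suc j) * gweight 68 (pos (Suc j)) E' \<le> \<dots>"
      unfolding pos_Suc gweight_double by (simp add: rad_Suc)
    with \<open>net (Suc j) V'\<close> E'(1) show ?thesis by blast
  qed
  show thesis by (rule that[OF K]) (rule main)
qed

lemma networks:
  obtains L where "\<And>j. \<exists>V E. net j V \<and> conn V E \<and> (\<Sum>(x, y)\<in>E. dist (z x) (z y)) \<le> L"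
proof (rule net_step)
  fix K :: real
  assume K: "0 \<le> K" and step: "\<And>j V E. net j V \<Longrightarrow> conn V E \<Longrightarrow>
    \<exists>V' E'. net (Suc j) V' \<and> conn V' E' \<and> rad (Suc j) * gweight 68 (pos (Suc j)) E' \<le>
      rad j * gweight 68 (pos j) E + 32 * rad j + K * (\<Sum>R\<in>T (Suc j). (a R)\<^sup>2 * rad j)"
  obtain V0 where "V0 \<subseteq> T 0" "\<And>x y. x \<in> V0 \<Longrightarrow> y \<in> V0 \<Longrightarrow> x \<noteq> y \<Longrightarrow> 4 * rad 0 \<le> dist (z x) (z y)"
    "\<And>x. x \<in> T 0 \<Longrightarrow> \<exists>w\<in>V0. dist (z x) (z w) < 4 * rad 0"
    using maximal_separated[OF fin[of 0], of "{}" "4 * rad 0" z] rad_pos[of 0] by auto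
  then have V0: "net 0 V0" using ne by (auto simp: net_def)
  have C0: "conn V0 (V0 \<times> V0)" by (auto simp: conn_def)
  let ?W = "rad 0 * gweight 68 (pos 0) (V0 \<times> V0)"
  \<comment> \<open>\<open>64 * (rad 0 - rad j)\<close> is the sum of \<open>32 * rad i\<close> over
    \<open>i < j\<close>, since the radii halve.\<close>
  have ind: "\<exists>V E. net j V \<and> conn V E \<and> rad j * gweight 68 (pos j) E \<le>
      ?W + 64 * (rad 0 - rad j) + K * (\<Sum>i<j. \<Sum>R\<in>T (Suc i). (a R)\<^sup>2 * rad i)" for j
  proof (induction j)
    case 0
    then show ?case using V0 C0 by (intro exI conjI) auto
  next
    case (Suc j)
    then obtain V E where VE: "net j V" "conn V E" "rad j * gweight 68 (pos j) E \<le>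
      ?W + 64 * (rad 0 - rad j) + K * (\<Sum>i<j. \<Sum>R\<in>T (Suc i). (a R)\<^sup>2 * rad i)" by blast
    obtain V' E' where V': "net (Suc j) V'" "conn V' E'" "rad (Suc j) * gweight 68 (pos (Suc j)) E' \<le>
      rad j * gweight 68 (pos j) E + 32 * rad j + K * (\<Sum>R\<in>T (Suc j). (a R)\<^sup>2 * rad j)"
      using step[OF VE(1,2)] by blast
    have "rad (Suc j) * gweight 68 (pos (Suc j)) E' \<le>
      ?W + 64 * (rad 0 - rad (Suc j)) + K * (\<Sum>i<Suc j. \<Sum>R\<in>T (Suc i). (a R)\<^sup>2 * rad i)"
      using V'(3) VE(3) by (simp add: rad_Suc algebra_simps)
    then show ?case using V'(1,2) by blast
  qed
  have "\<exists>V E. net j V \<and> conn V E \<and> (\<Sum>(x, y)\<in>E. dist (z x) (z y)) \<le> ?W + 64 * rad 0 + K * B" for j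
  proof -
    obtain V E where VE: "net j V" "conn V E" "rad j * gweight 68 (pos j) E \<le>
      ?W + 64 * (rad 0 - rad j) + K * (\<Sum>i<j. \<Sum>R\<in>T (Suc i). (a R)\<^sup>2 * rad i)"
      using ind[of j] by blast
    have "(\<Sum>(x, y)\<in>E. dist (z x) (z y)) = rad j * (\<Sum>(x, y)\<in>E. dist (pos j x) (pos j y))"
      using rad_pos[of j] by (simp add: dist_pos sum_distrib_left case_prod_unfold)
    also have "\<dots> \<le> rad j * gweight 68 (pos j) E"
      using dist_le_gweight rad_pos[of j] by (intro mult_left_mono) auto
    also have "\<dots> \<le> ?W + 64 * rad 0 + K * B"
    proof -
      have "K * (\<Sum>i<j. \<Sum>R\<in>T (Suc i). (a R)\<^sup>2 * rad i) \<le> K * B"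
        using bound[of j] K by (intro mult_left_mono) (auto simp: rad_def)
      then show ?thesis using VE(3) rad_pos[of j] by simp
    qed
    finally show ?thesis using VE(1,2) by blast
  qed
  then show thesis by (rule that)
qed

lemma z_bounded: "\<exists>M. \<forall>j. \<forall>R\<in>T j. norm (z R) \<le> M"
proof -
  define M where "M = Max ((\<lambda>R. norm (z R)) ` T 0)"
  have "\<forall>R\<in>T j. norm (z R) \<le> M + 2 * (rad 0 - rad j)" for j
  proof (induction j)
    case 0
    then show ?case using fin[of 0] by (auto simp: M_def)
  next
    case (Suc j)
    show ?case
    proof
      fix R assume "R \<in> T (Suc j)"
      then obtain P where P: "P \<in> T j" "dist (z R) (z P) \<le> rad j" using up by (auto simp: rad_def)
      have "norm (z R) \<le> norm (z P) + dist (z R) (z P)"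
        using norm_triangle_sub[of "z R" "z P"] by (simp add: dist_norm)
      then show "norm (z R) \<le> M + 2 * (rad 0 - rad (Suc j))"
        using Suc P by (force simp: rad_Suc)
    qed
  qed
  then have "norm (z R) \<le> M + 2 * rad 0" if "R \<in> T j" for j R
    using that rad_pos[of j] by (smt (verit))
  then show ?thesis by blast
qed

text \<open>The curves share a Lipschitz constant, so Arzela-Ascoli yields a uniform limit along a
  subsequence \<open>k\<close>. As \<open>z (R (k n))\<close> is within \<open>4 * rad (k n)\<close>
  of the curve with index \<open>k n\<close>, its limit lies in the closure of the compact image of
  the limit curve.\<close>

theorem limit_curve:
  "\<exists>f L. L-lipschitz_on {0..1::real} f \<and>
    (\<forall>x R. (\<forall>j. R j \<in> T j) \<longrightarrow> (\<lambda>j. z (R j)) \<longlonglongrightarrow> x \<longrightarrow> x \<in> f ` {0..1})"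
proof -
  obtain L where L: "\<And>j. \<exists>V E. net j V \<and> conn V E \<and> (\<Sum>(x, y)\<in>E. dist (z x) (z y)) \<le> L"
    using networks by blast
  obtain M where M: "\<forall>j. \<forall>R\<in>T j. norm (z R) \<le> M" using z_bounded by blast
  have "\<forall>j. \<exists>f. (2 * L)-lipschitz_on {0..1::real} f \<and> (\<exists>V. net j V \<and> z ` V \<subseteq> f ` {0..1})"
  proof
    fix j
    obtain V E where VE: "net j V" "conn V E" "(\<Sum>(x, y)\<in>E. dist (z x) (z y)) \<le> L" using L by blast
    have "finite V" "V \<noteq> {}" using VE(1) finite_subset[OF _ fin[of j]] by (auto simp: net_def)
    then show "\<exists>f. (2 * L)-lipschitz_on {0..1::real} f \<and> (\<exists>V. net j V \<and> z ` V \<subseteq> f ` {0..1})"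
      using conn_lipschitz[of V E z L] VE by blast
  qed
  then obtain f where f: "\<And>j. (2 * L)-lipschitz_on {0..1::real} (f j)"
    "\<And>j. \<exists>V. net j V \<and> z ` V \<subseteq> f j ` {0..1}" by metis
  have L0: "0 \<le> 2 * L" using f(1)[of 0] lipschitz_on_nonneg by blast
  have fb: "norm (f j t) \<le> M + 2 * L" if "t \<in> {0..1}" for j t
  proof -
    obtain V where V: "net j V" "z ` V \<subseteq> f j ` {0..1}" using f(2) by blast
    then obtain v where v: "v \<in> V" "v \<in> T j" by (auto simp: net_def)
    then obtain s where s: "s \<in> {0..1}" "z v = f j s" using V by blast
    have "dist (f j t) (f j s) \<le> 2 * L * dist t s" using lipschitz_onD[OF f(1) that s(1)] .
    also have "\<dots> \<le> 2 * L * 1" using that s(1) L0 by (intro mult_left_mono) (auto simp: dist_real_def)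
    finally have "dist (f j t) (z v) \<le> 2 * L" using s by simp
    moreover have "norm (z v) \<le> M" using M v by blast
    ultimately show ?thesis using norm_triangle_sub[of "f j t" "z v"] by (simp add: dist_norm)
  qed
  obtain g k where g: "continuous_on {0..1} g" and k: "strict_mono (k :: nat \<Rightarrow> nat)"
    and lim: "\<And>e. 0 < e \<Longrightarrow> \<exists>N. \<forall>n t. n \<ge> N \<and> t \<in> {0..1} \<longrightarrow> norm (f (k n) t - g t) < e"
  proof (rule Arzela_Ascoli[of "{0..1::real}" f "M + 2 * L"])
    show "\<exists>d. 0 < d \<and> (\<forall>n y. y \<in> {0..1} \<and> norm (t - y) < d \<longrightarrow> norm (f n t - f n y) < e)"
      if "t \<in> {0..1}" "0 < e" for t e :: real
    proof (intro exI[of _ "e / (2 * L + 1)"] conjI allI impI)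
      show "0 < e / (2 * L + 1)" using that L0 by auto
      fix n y assume y: "y \<in> {0..1} \<and> norm (t - y) < e / (2 * L + 1)"
      have "norm (f n t - f n y) \<le> 2 * L * norm (t - y)"
        using lipschitz_onD[OF f(1), of t y n] that y by (simp add: dist_norm)
      also have "\<dots> \<le> (2 * L + 1) * norm (t - y)" by (intro mult_right_mono) auto
      also have "\<dots> < e" using y L0 by (simp add: pos_less_divide_eq mult.commute)
      finally show "norm (f n t - f n y) < e" .
    qed
  qed (use fb in auto)
  have ptw: "(\<lambda>n. f (k n) t) \<longlonglongrightarrow> g t" if "t \<in> {0..1}" for t
    unfolding LIMSEQ_iff using lim that by meson
  have "(2 * L)-lipschitz_on {0..1} g"
  proof (rule lipschitz_onI[OF _ L0])
    fix s t :: real assume st: "s \<in> {0..1}" "t \<in> {0..1}"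
    have "(\<lambda>n. dist (f (k n) s) (f (k n) t)) \<longlonglongrightarrow> dist (g s) (g t)"
      using ptw st by (intro tendsto_dist) auto
    then show "dist (g s) (g t) \<le> 2 * L * dist s t"
      by (rule LIMSEQ_le_const2) (use lipschitz_onD[OF f(1) st] in blast)
  qed
  moreover have "x \<in> g ` {0..1}" if R: "\<And>j. R j \<in> T j" "(\<lambda>j. z (R j)) \<longlonglongrightarrow> x" for x R
  proof -
    have "closed (g ` {0..1})"
      by (intro compact_imp_closed compact_continuous_image g) auto
    moreover have "\<exists>y\<in>g ` {0..1}. dist y x < e" if "0 < e" for e
    proof -
      have "0 < e / 3" using that by simp
      from lim[OF this] obtain N1 where N1: "\<forall>n t. n \<ge> N1 \<and> t \<in> {0..1} \<longrightarrow> norm (f (k n) t - g t) < e / 3"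
        by blast
      obtain N2 where N2: "\<forall>n\<ge>N2. dist (z (R n)) x < e / 3"
        using R(2) \<open>0 < e / 3\<close> unfolding lim_sequentially by blast
      have "(\<lambda>j. 4 * rad j) \<longlonglongrightarrow> 0"
        unfolding rad_def using LIMSEQ_divide_realpow_zero[of 2 r] tendsto_mult_right_zero by force
      then obtain N3 where N3: "\<forall>n\<ge>N3. norm (4 * rad n - 0) < e / 3"
        using \<open>0 < e / 3\<close> unfolding LIMSEQ_iff by blast
      define n where "n = max N1 (max N2 N3)"
      have kn: "n \<le> k n" using k seq_suble by blast
      obtain V where V: "net (k n) V" "z ` V \<subseteq> f (k n) ` {0..1}" using f(2) by blast
      have "\<forall>x\<in>T (k n). \<exists>v\<in>V. dist (z x) (z v) < 4 * rad (k n)"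
        using V(1) unfolding net_def by simp
      from bspec[OF this R(1)] obtain v where v: "v \<in> V" "dist (z (R (k n))) (z v) < 4 * rad (k n)"
        by blast
      obtain t where t: "t \<in> {0..1}" "z v = f (k n) t" using V(2) v(1) by blast
      have "dist (f (k n) t) (g t) < e / 3" using N1 t(1) by (auto simp: dist_norm n_def)
      moreover have "dist (z (R (k n))) x < e / 3" using N2 kn by (auto simp: n_def)
      moreover have "4 * rad (k n) < e / 3"
      proof -
        have "norm (4 * rad (k n) - 0) < e / 3" using N3 kn by (auto simp: n_def)
        then show ?thesis by (simp add: abs_if split: if_splits)
      qed
      ultimately have "dist (g t) x < e"
        using v(2) t(2) dist_triangle[of "g t" x "z v"] dist_triangle[of "z v" x "z (R (k n))"]
        by (simp add: dist_commute)
      then show ?thesis using t(1) by blast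
    qed
    ultimately show ?thesis using closed_approachable by blast
  qed
  ultimately show ?thesis by blast
qed

end

subsection \<open>Dyadic cubes and centres of mass\<close>

lemma side_pos: "0 < side k"
  by (simp add: side_def)

lemma side_add: "side (k + int i) = side k / 2 ^ i"
  by (simp add: side_def powr_diff powr_realpow field_simps flip: powr_minus_divide)

lemma side_le_iff: "side k \<le> side l \<longleftrightarrow> l \<le> k"
  by (simp add: side_def)

lemma side_0: "side 0 = 1"
  by (simp add: side_def)

text \<open>The unique cube of generation \<open>k\<close> containing \<open>x\<close>; membership,
  disjointness and nesting of dyadic cubes become equations between integers.\<close>

definition idx :: "int \<Rightarrow> real^'n \<Rightarrow> 'n::finite \<Rightarrow> int" where
  "idx k x = (\<lambda>i. \<lfloor>x $ i / side k\<rfloor>)"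

lemma mem_dcube_iff: "x \<in> dcube k j \<longleftrightarrow> j = idx k x"
proof -
  have "x \<in> dcube k j \<longleftrightarrow> (\<forall>i. \<lfloor>x $ i / side k\<rfloor> = j i)"
    using side_pos[of k] by (simp add: dcube_def floor_eq_iff pos_le_divide_eq pos_divide_less_eq)
  then show ?thesis by (auto simp: idx_def fun_eq_iff)
qed

text \<open>Nesting in arithmetic form: the floor of a quotient by a positive integer is the integer
  quotient of the floor.\<close>

lemma idx_coarser:
  assumes "k \<le> l"
  shows "idx k x = (\<lambda>i. idx l x i div 2 ^ nat (l - k))"
proof
  fix i
  have "side l = side k / 2 ^ nat (l - k)"
    using side_add[of k "nat (l - k)"] assms by simp
  then have "x $ i / side k = (x $ i / side l) / real_of_int (2 ^ nat (l - k))"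
    using side_pos[of k] by simp
  then show "idx k x i = idx l x i div 2 ^ nat (l - k)"
    unfolding idx_def by (simp only: floor_divide_real_eq_div[of "2 ^ nat (l - k)"] zero_le_power zero_le_numeral)
qed

lemma idx_eq_coarser: "k \<le> l \<Longrightarrow> idx l x = idx l y \<Longrightarrow> idx k x = idx k y"
  using idx_coarser[of k l x] idx_coarser[of k l y] by simp

definition centre :: "int \<Rightarrow> ('n::finite \<Rightarrow> int) \<Rightarrow> real^'n" where
  "centre k j = (\<chi> i. (real_of_int (j i) + 1/2) * side k)"

lemma idx_centre_dist: "\<bar>x $ i - centre k (idx k x) $ i\<bar> \<le> side k / 2"
proof -
  have "x \<in> dcube k (idx k x)" by (simp add: mem_dcube_iff)
  then have "real_of_int (idx k x i) * side k \<le> x $ i" "x $ i < (real_of_int (idx k x i) + 1) * side k"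
    by (auto simp: dcube_def)
  then show ?thesis unfolding centre_def distrib_right vec_lambda_beta by linarith
qed

lemma mem_dilate_iff:
  "x \<in> dilate lam k j \<longleftrightarrow> (\<forall>i. centre k j $ i - lam * side k / 2 \<le> x $ i \<and> x $ i < centre k j $ i + lam * side k / 2)"
  by (simp add: dilate_def centre_def)

lemma dilate_dist:
  assumes "x \<in> dilate lam k j"
  shows "\<bar>x $ i - centre k j $ i\<bar> \<le> lam * side k / 2"
proof -
  have "centre k j $ i - lam * side k / 2 \<le> x $ i" "x $ i < centre k j $ i + lam * side k / 2"
    using assms by (auto simp: mem_dilate_iff)
  then show ?thesis by linarith
qed

lemma dilateI:
  assumes "\<And>i. \<bar>x $ i - centre k j $ i\<bar> < lam * side k / 2"
  shows "x \<in> dilate lam k j"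
  unfolding mem_dilate_iff
proof (intro allI conjI)
  fix i
  show "centre k j $ i - lam * side k / 2 \<le> x $ i" "x $ i < centre k j $ i + lam * side k / 2"
    using assms[of i] by linarith+
qed

lemma norm_le_coords:
  fixes x :: "real^'n"
  assumes "\<And>i. \<bar>x $ i\<bar> \<le> C"
  shows "norm x \<le> sqrt (real CARD('n)) * C"
proof -
  have C: "0 \<le> C" using assms[of undefined] by linarith
  have "(\<Sum>i\<in>UNIV. (x $ i)\<^sup>2) \<le> (\<Sum>i\<in>(UNIV::'n set). C\<^sup>2)"
    using assms C by (intro sum_mono) (metis abs_le_square_iff abs_of_nonneg)
  then have "norm x \<le> sqrt (real CARD('n) * C\<^sup>2)"
    by (simp add: norm_vec_def L2_set_def)
  then show ?thesis using C by (simp add: real_sqrt_mult)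
qed

lemma norm_diff_le_dilate:
  fixes x y :: "real^'n"
  assumes "x \<in> dilate lam k j" "y \<in> dilate lam k j"
  shows "norm (x - y) \<le> sqrt (real CARD('n)) * (lam * side k)"
proof (rule norm_le_coords)
  fix i
  have "x $ i < centre k j $ i + lam * side k / 2" "centre k j $ i - lam * side k / 2 \<le> x $ i"
    "y $ i < centre k j $ i + lam * side k / 2" "centre k j $ i - lam * side k / 2 \<le> y $ i"
    using assms by (auto simp: mem_dilate_iff)
  then show "\<bar>(x - y) $ i\<bar> \<le> lam * side k" by (simp add: abs_le_iff)
qed

lemma bounded_dilate: "bounded (dilate lam k j)" for j :: "'n::finite \<Rightarrow> int"
proof (cases "dilate lam k j = {}")
  case False
  then obtain y where "y \<in> dilate lam k j" by blast
  then show ?thesis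
    using norm_diff_le_dilate[of _ lam k j y] unfolding bounded_def dist_norm
    by (metis norm_minus_commute)
qed simp

lemma dcube_eq_dilate: "dcube k j = dilate 1 k j"
  by (auto simp: dcube_def mem_dilate_iff centre_def algebra_simps)

lemma dcube_subset_dilate3: "dcube k j \<subseteq> dilate 3 k j"
proof
  fix x assume "x \<in> dcube k j"
  then have "\<bar>x $ i - centre k j $ i\<bar> < 3 * side k / 2" for i
    using idx_centre_dist[of x i k] side_pos[of k] by (simp add: mem_dcube_iff)
  then show "x \<in> dilate 3 k j" by (rule dilateI)
qed

lemma bounded_dcube: "bounded (dcube k j)"
  unfolding dcube_eq_dilate by (rule bounded_dilate)

lemma diameter_dcube_ge: "side k / 2 \<le> diameter (dcube k j)"
  and diameter_dilate3_pos: "0 < diameter (dilate 3 k j)" for j :: "'n::finite \<Rightarrow> int"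
proof -
  define x :: "real^'n" where "x = (\<chi> i. real_of_int (j i) * side k)"
  have x: "x \<in> dcube k j" and c: "centre k j \<in> dcube k j"
    using side_pos[of k] by (auto simp: dcube_def x_def centre_def distrib_right)
  have "side k / 2 \<le> dist (centre k j) x"
    using component_le_norm_cart[of "centre k j - x" undefined] side_pos[of k]
    by (simp add: dist_norm x_def centre_def distrib_right)
  moreover have "dist (centre k j) x \<le> diameter (dcube k j)" "dist (centre k j) x \<le> diameter (dilate 3 k j)"
    using diameter_bounded_bound[OF bounded_dcube c x] diameter_bounded_bound[OF bounded_dilate, of "centre k j" 3 k j x]
      c x dcube_subset_dilate3 by blast+
  ultimately show "side k / 2 \<le> diameter (dcube k j)" "0 < diameter (dilate 3 k j)"
    using side_pos[of k] by linarith+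
qed

lemma diameter_dilate3_le: "diameter (dilate 3 k j) \<le> sqrt (real CARD('n)) * (3 * side k)" for j :: "'n::finite \<Rightarrow> int"
  using norm_diff_le_dilate[of _ 3 k j] side_pos[of k] by (intro diameter_le) auto

lemma halfspace_borel: "{x::real^'n. a \<le> x $ i} \<in> sets borel" "{x::real^'n. x $ i < a} \<in> sets borel"
  by measurable

lemma dilate_borel: "dilate lam k j \<in> sets borel" for j :: "'n::finite \<Rightarrow> int"
proof -
  have "dilate lam k j = (\<Inter>i. {x. centre k j $ i - lam * side k / 2 \<le> x $ i} \<inter> {x. x $ i < centre k j $ i + lam * side k / 2})"
    by (auto simp: mem_dilate_iff)
  also have "\<dots> \<in> sets borel"
    by (intro sets.finite_INT sets.Int halfspace_borel) auto
  finally show ?thesis .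
qed

lemma dcube_borel: "dcube k j \<in> sets borel" for j :: "'n::finite \<Rightarrow> int"
  unfolding dcube_eq_dilate by (rule dilate_borel)

lemma finite_centres_near: "finite {j :: 'n::finite \<Rightarrow> int. \<forall>i. \<bar>centre k j $ i - a $ i\<bar> \<le> C}"
proof -
  define f where "f i = {\<lfloor>(a $ i - C) / side k\<rfloor> - 1..\<lceil>(a $ i + C) / side k\<rceil> + 1}" for i :: 'n
  have "{j. \<forall>i. \<bar>centre k j $ i - a $ i\<bar> \<le> C} \<subseteq> {j. \<forall>i. j i \<in> f i}"
  proof clarify
    fix j :: "'n \<Rightarrow> int" and i assume *: "\<forall>i. \<bar>centre k j $ i - a $ i\<bar> \<le> C"
    then have "a $ i - C \<le> (real_of_int (j i) + 1/2) * side k" "(real_of_int (j i) + 1/2) * side k \<le> a $ i + C"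
      by (auto simp: centre_def abs_le_iff algebra_simps dest!: spec[of _ i])
    then have "(a $ i - C) / side k \<le> real_of_int (j i) + 1/2" "real_of_int (j i) + 1/2 \<le> (a $ i + C) / side k"
      using side_pos[of k] by (simp_all add: pos_divide_le_eq pos_le_divide_eq)
    then show "j i \<in> f i" unfolding f_def atLeastAtMost_iff by linarith
  qed
  moreover have "finite {j. \<forall>i. j i \<in> f i}"
    using finite_set_of_finite_funs[of "UNIV :: 'n set" "\<Union>i. f i" undefined]
    by (rule finite_subset[rotated]) (auto simp: f_def)
  ultimately show ?thesis by (rule finite_subset)
qed

lemma finite_idx_image: "bounded G \<Longrightarrow> finite (idx k ` G)"
proof -
  assume "bounded G"
  then obtain C where C: "\<And>x. x \<in> G \<Longrightarrow> norm x \<le> C" by (auto simp: bounded_iff)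
  have "idx k ` G \<subseteq> {j. \<forall>i. \<bar>centre k j $ i - 0 $ i\<bar> \<le> C + side k}"
  proof clarify
    fix x i assume "x \<in> G"
    then show "\<bar>centre k (idx k x) $ i - 0 $ i\<bar> \<le> C + side k"
      using C[OF \<open>x \<in> G\<close>] component_le_norm_cart[of x i] idx_centre_dist[of x i k] side_pos[of k]
      unfolding zero_index by linarith
  qed
  then show ?thesis using finite_centres_near finite_subset by blast
qed

text \<open>Only two generations and a bounded range of centres are possible. Finiteness gives the
  \<open>Max\<close> in \<open>beta_star_sq\<close> its meaning.\<close>

lemma finite_heavy_star: "finite (heavy_star M c k j)" for j :: "'n::finite \<Rightarrow> int"
proof -
  let ?lam = "1600 * sqrt (real CARD('n))"
  have "heavy_star M c k j \<subseteq> {k - 1..k} \<times> (\<Union>k'\<in>{k - 1..k}. {j'. \<forall>i. \<bar>centre k' j' $ i - centre k j $ i\<bar> \<le> ?lam * side k / 2})"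
  proof clarify
    fix k' and j' :: "'n \<Rightarrow> int" assume "(k', j') \<in> heavy_star M c k j"
    then have *: "side k \<le> side k'" "side k' \<le> 2 * side k" "dilate 3 k' j' \<subseteq> dilate ?lam k j"
      by (auto simp: heavy_star_def delta_star_def)
    have "2 * side k = side (k - 1)" using side_add[of "k - 1" 1] by simp
    then have k: "k' \<in> {k - 1..k}" using * by (simp add: side_le_iff)
    have "centre k' j' \<in> dilate 3 k' j'" using side_pos[of k'] by (intro dilateI) auto
    then have "\<bar>centre k' j' $ i - centre k j $ i\<bar> \<le> ?lam * side k / 2" for i
      using *(3) by (intro dilate_dist) auto
    then show "k' \<in> {k - 1..k} \<and> j' \<in> (\<Union>k'\<in>{k - 1..k}. {j'. \<forall>i. \<bar>centre k' j' $ i - centre k j $ i\<bar> \<le> ?lam * side k / 2})"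
      using k by blast
  qed
  then show ?thesis
    by (rule finite_subset) (intro finite_cartesian_product finite_UN_I finite_centres_near; simp)
qed

section \<open>Averages over bounded sets and centres of mass\<close>

lemma radon_finite:
  assumes "radon_measure M" "bounded D"
  shows "emeasure M D < \<infinity>"
proof -
  have "compact (closure D)" using assms(2) by (simp add: compact_closure)
  then have "emeasure M (closure D) < \<infinity>" "closure D \<in> sets M"
    using assms(1) by (auto simp: radon_measure_def)
  then show ?thesis
    using emeasure_mono[OF closure_subset, of D M] by (metis le_less_trans)
qed

lemma radon_measurable: "radon_measure M \<Longrightarrow> f \<in> borel_measurable borel \<Longrightarrow> f \<in> borel_measurable M"
  by (auto simp: radon_measure_def cong: measurable_cong_sets)

lemma radon_set_integrable:
  fixes f :: "real^'n \<Rightarrow> 'b::{banach, second_countable_topology}"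
  assumes M: "radon_measure M" and D: "D \<in> sets borel" "bounded D" and f: "f \<in> borel_measurable borel"
    and B: "\<And>x. x \<in> D \<Longrightarrow> norm (f x) \<le> B"
  shows "set_integrable M D f"
  unfolding set_integrable_def
proof (rule integrableI_bounded_set[where A = D and B = B])
  show DM: "D \<in> sets M" using M D by (simp add: radon_measure_def)
  show "(\<lambda>x. indicat_real D x *\<^sub>R f x) \<in> borel_measurable M"
    using DM radon_measurable[OF M f] by measurable
  show "emeasure M D < \<infinity>" by (rule radon_finite[OF M D(2)])
qed (use B in auto)

text \<open>Averaging the pointwise bound \<open>f x \<le> l + l powr (1 - p) * f x powr p\<close>
  and choosing \<open>l\<close> as the power mean makes both terms equal to it, whence the factor
  2.\<close>

lemma mean_le_power_mean:
  fixes f :: "real^'n \<Rightarrow> real"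
  assumes M: "radon_measure M" and D: "D \<in> sets borel" "bounded D" and f: "f \<in> borel_measurable borel"
    and B: "\<And>x. x \<in> D \<Longrightarrow> f x \<le> B" and pos: "\<And>x. 0 \<le> f x" and \<mu>: "0 < measure M D" and p: "1 \<le> p"
  shows "(LINT x:D|M. f x) / measure M D \<le> 2 * ((LINT x:D|M. f x powr p) / measure M D) powr (1 / p)"
proof -
  have DM: "D \<in> sets M" using M D by (simp add: radon_measure_def)
  have fin: "emeasure M D < \<infinity>" by (rule radon_finite[OF M D(2)])
  have i1: "set_integrable M D f"
    using B pos by (intro radon_set_integrable[OF M D f, of B]) auto
  have i2: "set_integrable M D (\<lambda>x. f x powr p)"
  proof (rule radon_set_integrable[OF M D, of _ "B powr p"])
    show "(\<lambda>x. f x powr p) \<in> borel_measurable borel" using f by measurable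
    show "norm (f x powr p) \<le> B powr p" if "x \<in> D" for x
      using B[OF that] pos[of x] p by (auto intro: powr_mono2)
  qed
  let ?m = "(LINT x:D|M. f x powr p) / measure M D"
  have m0: "0 \<le> ?m"
    unfolding set_lebesgue_integral_def by (intro divide_nonneg_nonneg integral_nonneg) auto
  have key: "(LINT x:D|M. f x) / measure M D \<le> l + l powr (1 - p) * ?m" if l: "0 < l" for l
  proof -
    have pt: "f x \<le> l + l powr (1 - p) * f x powr p" for x
    proof (cases "f x \<le> l")
      case True
      then show ?thesis by (smt (verit) mult_nonneg_nonneg powr_ge_zero)
    next
      case False
      then have "f x = f x powr (1 - p) * f x powr p" using l by (simp flip: powr_add)
      also have "\<dots> \<le> l powr (1 - p) * f x powr p"
        using False l p by (intro mult_right_mono powr_mono2') auto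
      finally show ?thesis using l by simp
    qed
    have ic: "set_integrable M D (\<lambda>x. l)"
      using D by (intro radon_set_integrable[OF M, of _ _ l]) (use l in auto)
    have i3: "set_integrable M D (\<lambda>x. l powr (1 - p) * f x powr p)"
      using i2 by (rule set_integrable_mult_right)
    have "(LINT x:D|M. f x) \<le> (LINT x:D|M. l + l powr (1 - p) * f x powr p)"
      by (rule set_integral_mono[OF i1 set_integral_add(1)[OF ic i3]]) (rule pt)
    also have "\<dots> = (LINT x:D|M. l) + (LINT x:D|M. l powr (1 - p) * f x powr p)"
      by (rule set_integral_add(2)[OF ic i3])
    also have "(LINT x:D|M. l) = l * measure M D"
      using DM fin by (simp add: set_lebesgue_integral_def)
    also have "(LINT x:D|M. l powr (1 - p) * f x powr p) = l powr (1 - p) * (LINT x:D|M. f x powr p)"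
      by (rule set_integral_mult_right)
    finally show ?thesis using \<mu> by (simp add: field_simps)
  qed
  show ?thesis
  proof (cases "?m = 0")
    case True
    have "(LINT x:D|M. f x) / measure M D \<le> 0 + l" if "0 < l" for l
      using key[OF that] unfolding True by simp
    then have "(LINT x:D|M. f x) / measure M D \<le> 0" by (rule field_le_epsilon)
    then show ?thesis by (rule order_trans) simp
  next
    case False
    then have m: "0 < ?m" using m0 by (metis order_le_imp_less_or_eq)
    have "(t powr (1 / p)) powr (1 - p) * t = t powr ((1 / p) * (1 - p) + 1)" if "0 < t" for t
      using that by (simp add: powr_powr powr_add)
    from this[OF m] have "(?m powr (1 / p)) powr (1 - p) * ?m = ?m powr ((1 / p) * (1 - p) + 1)" .
    also have "(1 / p) * (1 - p) + 1 = 1 / p" using p by (simp add: field_simps)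
    finally have eq: "(?m powr (1 / p)) powr (1 - p) * ?m = ?m powr (1 / p)" .
    have "0 < ?m powr (1 / p)" using m by (metis powr_gt_zero less_irrefl)
    from key[OF this] show ?thesis unfolding eq mult_2 .
  qed
qed

definition cmass :: "(real^'n) measure \<Rightarrow> (real^'n) set \<Rightarrow> real^'n" where
  "cmass M D = (1 / measure M D) *\<^sub>R (LINT x:D|M. x)"

text \<open>Linear maps commute with averaging, and the norm of an average is at most the average of
  the norms. Coordinates and \<open>perp e\<close> are the two instances.\<close>

lemma cmass_linear_le:
  fixes A :: "real^'n \<Rightarrow> 'b::euclidean_space"
  assumes M: "radon_measure M" and D: "D \<in> sets borel" "bounded D" and \<mu>: "0 < measure M D" and A: "bounded_linear A"
  shows "norm (A (cmass M D - o')) \<le> (LINT x:D|M. norm (A (x - o'))) / measure M D"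
proof -
  interpret A: bounded_linear A by fact
  have DM: "D \<in> sets M" using M D by (simp add: radon_measure_def)
  have fin: "emeasure M D < \<infinity>" by (rule radon_finite[OF M D(2)])
  obtain C where C: "\<And>x. x \<in> D \<Longrightarrow> norm x \<le> C" using D(2) by (auto simp: bounded_iff)
  have i1: "set_integrable M D (\<lambda>x. x)"
    by (rule radon_set_integrable[OF M D _ C]) auto
  have i2: "set_integrable M D (\<lambda>x. o')"
    by (rule radon_set_integrable[OF M D, of _ "norm o'"]) auto
  have i3: "set_integrable M D (\<lambda>x. x - o')" by (rule set_integral_diff(1)[OF i1 i2])
  have "(LINT x:D|M. x - o') = (LINT x:D|M. x) - (LINT x:D|M. o')"
    by (rule set_integral_diff(2)[OF i1 i2])
  also have "(LINT x:D|M. o') = measure M D *\<^sub>R o'"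
    using DM fin by (simp add: set_lebesgue_integral_def)
  also have "(LINT x:D|M. x) = measure M D *\<^sub>R cmass M D" using \<mu> by (simp add: cmass_def)
  finally have eq: "measure M D *\<^sub>R (cmass M D - o') = (LINT x:D|M. x - o')"
    by (simp add: scaleR_diff_right)
  have "measure M D *\<^sub>R A (cmass M D - o') = (LINT x:D|M. A (x - o'))"
    unfolding A.scaleR[symmetric] eq
    using integral_bounded_linear[OF A i3[unfolded set_integrable_def]]
    by (simp add: set_lebesgue_integral_def A.scaleR)
  moreover have "set_integrable M D (\<lambda>x. A (x - o'))"
    using integrable_bounded_linear[OF A i3[unfolded set_integrable_def]]
    by (simp add: set_integrable_def A.scaleR)
  ultimately have "norm (measure M D *\<^sub>R A (cmass M D - o')) \<le> (LINT x:D|M. norm (A (x - o')))"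
    using set_integral_norm_bound by metis
  then show ?thesis using \<mu> by (simp add: pos_le_divide_eq mult.commute)
qed

lemma cmass_coord:
  fixes a :: "real^'n"
  assumes M: "radon_measure M" and D: "D \<in> sets borel" "bounded D" and \<mu>: "0 < measure M D"
    and C: "\<And>x. x \<in> D \<Longrightarrow> \<bar>x $ i - a $ i\<bar> \<le> C"
  shows "\<bar>cmass M D $ i - a $ i\<bar> \<le> C"
proof -
  have DM: "D \<in> sets M" using M D by (simp add: radon_measure_def)
  have fin: "emeasure M D < \<infinity>" by (rule radon_finite[OF M D(2)])
  have "norm ((cmass M D - a) $ i) \<le> (LINT x:D|M. norm ((x - a) $ i)) / measure M D"
    by (rule cmass_linear_le[OF M D \<mu>, of "\<lambda>x. x $ i" a]) (rule bounded_linear_vec_nth)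
  also have "(LINT x:D|M. norm ((x - a) $ i)) \<le> (LINT x:D|M. C)"
  proof (rule set_integral_mono)
    show "set_integrable M D (\<lambda>x. norm ((x - a) $ i))"
      by (rule radon_set_integrable[OF M D, of _ C]) (use C in auto)
    show "set_integrable M D (\<lambda>x. C)"
      by (rule radon_set_integrable[OF M D, of _ "\<bar>C\<bar>"]) auto
  qed (use C in auto)
  also have "(LINT x:D|M. C) = C * measure M D"
    using DM fin by (simp add: set_lebesgue_integral_def)
  finally show ?thesis using \<mu> by (simp add: divide_right_mono)
qed

lemma bounded_linear_perp: "bounded_linear (perp e)"
  unfolding perp_def
  by (intro bounded_linear_sub bounded_linear_ident bounded_linear_scaleR_left
      bounded_linear_compose[OF bounded_linear_scaleR_left bounded_linear_inner_left])

lemma line_perp: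
  assumes "L \<in> lines"
  obtains e o' where "norm e = 1" "\<And>x. norm (perp e (x - o')) \<le> infdist x L"
proof -
  obtain a v where v: "v \<noteq> 0" and L: "L = {a + t *\<^sub>R v | t. True}"
    using assms by (auto simp: lines_def)
  define e where "e = v /\<^sub>R norm v"
  have e: "norm e = 1" using v by (simp add: e_def)
  have v_e: "v = norm v *\<^sub>R e" using v by (simp add: e_def)
  have "norm (perp e (x - a)) \<le> infdist x L" for x
  proof -
    have ne: "L \<noteq> {}" using L by blast
    have "norm (perp e (x - a)) \<le> dist x y" if "y \<in> L" for y
    proof -
      obtain t where y: "y = a + t *\<^sub>R v" using L \<open>y \<in> L\<close> by blast
      have "perp e (t *\<^sub>R v) = 0"
        by (subst v_e) (use e in \<open>simp add: perp_def dot_square_norm\<close>)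
      moreover have "perp e (x - y) = perp e (x - a) - perp e (t *\<^sub>R v)"
        unfolding y by (simp flip: perp_diff add: algebra_simps)
      ultimately show ?thesis using norm_perp_le[OF e, of "x - y"] by (simp add: dist_norm)
    qed
    then show ?thesis using ne by (simp add: infdist_def cINF_greatest)
  qed
  with e show thesis by (rule that)
qed

text \<open>Links the \<beta> numbers to the points of the tree: the mean distance to the line
  bounds the offset of the centre of mass, and the power mean of that distance is
  \<open>diameter D * beta_p M p D L\<close>.\<close>

lemma perp_cmass_le:
  fixes M :: "(real^'n) measure"
  assumes M: "radon_measure M" and D: "D \<in> sets borel" "bounded D" and \<mu>: "emeasure M D \<noteq> 0" and d: "0 < diameter D"
    and e: "\<And>x. norm (perp e (x - o')) \<le> infdist x L" and p: "1 \<le> p"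
  shows "norm (perp e (cmass M D - o')) \<le> 2 * diameter D * beta_p M p D L"
proof -
  let ?d = "diameter D"
  have DM: "D \<in> sets M" using M D by (simp add: radon_measure_def)
  have fin: "emeasure M D < \<infinity>" by (rule radon_finite[OF M D(2)])
  have mu2: "emeasure M D = ennreal (measure M D)"
    using fin by (intro emeasure_eq_ennreal_measure) auto
  then have mu: "0 < measure M D" "emeasure M D = ennreal (measure M D)"
    using \<mu> by (auto simp: zero_less_measure_iff)
  define f where "f x = infdist x L / ?d" for x
  have f_bor: "f \<in> borel_measurable borel"
    unfolding f_def by (intro borel_measurable_continuous_onI continuous_intros) (use d in auto)
  have f0: "0 \<le> f x" for x using d by (simp add: f_def infdist_nonneg)
  obtain C where C: "\<And>x. x \<in> D \<Longrightarrow> norm x \<le> C" using D(2) by (auto simp: bounded_iff)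
  have fB: "f x \<le> (infdist 0 L + C) / ?d" if "x \<in> D" for x
    unfolding f_def using infdist_triangle[of x L 0] C[OF that] d by (intro divide_right_mono) auto
  have ip: "set_integrable M D (\<lambda>x. f x powr p)"
  proof (rule radon_set_integrable[OF M D, of _ "((infdist 0 L + C) / ?d) powr p"])
    show "(\<lambda>x. f x powr p) \<in> borel_measurable borel" using f_bor by measurable
    show "norm (f x powr p) \<le> ((infdist 0 L + C) / ?d) powr p" if "x \<in> D" for x
      using fB[OF that] f0[of x] p by (auto intro: powr_mono2)
  qed
  have "(\<integral>\<^sup>+x\<in>D. ennreal (f x powr p) \<partial>M) = (\<integral>\<^sup>+x. ennreal (indicat_real D x *\<^sub>R f x powr p) \<partial>M)"
    by (intro nn_integral_cong) (auto simp: indicator_def)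
  also have "\<dots> = ennreal (LINT x:D|M. f x powr p)"
    using ip unfolding set_integrable_def set_lebesgue_integral_def
    by (intro nn_integral_eq_integral) auto
  finally have nn: "(\<integral>\<^sup>+x\<in>D. ennreal (f x powr p) \<partial>M) = ennreal (LINT x:D|M. f x powr p)" .
  have pos: "0 \<le> (LINT x:D|M. f x powr p)"
    unfolding set_lebesgue_integral_def by (intro Bochner_Integration.integral_nonneg) auto
  have beta: "beta_p M p D L = ((LINT x:D|M. f x powr p) / measure M D) powr (1 / p)"
    using \<mu> nn mu pos unfolding beta_p_def f_def[symmetric]
    by (simp add: divide_ennreal)
  have "norm (perp e (cmass M D - o')) \<le> (LINT x:D|M. norm (perp e (x - o'))) / measure M D"
    by (rule cmass_linear_le[OF M D mu(1) bounded_linear_perp])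
  also have "\<dots> \<le> (LINT x:D|M. ?d * f x) / measure M D"
  proof (intro divide_right_mono set_integral_mono)
    have fd: "?d * f x = infdist x L" for x using d by (simp add: f_def)
    show "norm (perp e (x - o')) \<le> ?d * f x" for x using e fd by simp
    show "set_integrable M D (\<lambda>x. ?d * f x)"
      using fB f0 d by (intro radon_set_integrable[OF M D, of _ "?d * ((infdist 0 L + C) / ?d)"])
        (auto intro!: borel_measurable_times f_bor mult_left_mono simp del: times_divide_eq_right)
    show "set_integrable M D (\<lambda>x. norm (perp e (x - o')))"
    proof (rule radon_set_integrable[OF M D, of _ "infdist 0 L + C"])
      show "(\<lambda>x. norm (perp e (x - o'))) \<in> borel_measurable borel"
        unfolding perp_def by measurable
      show "norm (norm (perp e (x - o'))) \<le> infdist 0 L + C" if "x \<in> D" for x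
        using e[of x] infdist_triangle[of x L 0] C[OF that] by simp
    qed
  qed (use mu in auto)
  also have "(LINT x:D|M. ?d * f x) = ?d * (LINT x:D|M. f x)"
    by (rule set_integral_mult_right)
  also have "?d * (LINT x:D|M. f x) / measure M D \<le> ?d * (2 * beta_p M p D L)"
    using mean_le_power_mean[OF M D f_bor fB f0 mu(1) p] d unfolding beta
    by (simp add: mult_left_mono flip: times_divide_eq_right)
  finally show ?thesis by simp
qed

subsection \<open>Curves through sets of positive lower density\<close>

lemma lines_nonempty: "(lines :: (real^'n::finite) set set) \<noteq> {}"
proof -
  obtain v :: "real^'n" where "v \<noteq> 0"
    using axis_eq_0_iff[of undefined "1::real"] by (metis zero_neq_one)
  then show ?thesis unfolding lines_def by blast
qed

lemma beta_p_nonneg: "0 \<le> beta_p M p D L"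
  by (simp add: beta_p_def)

definition max_beta :: "(real^'n::finite) measure \<Rightarrow> real \<Rightarrow> real \<Rightarrow> int \<Rightarrow> ('n \<Rightarrow> int) \<Rightarrow> (real^'n) set \<Rightarrow> real" where
  "max_beta M c p k j L = Max ((\<lambda>(k', j'). (beta_p M p (dilate 3 k' j') L)\<^sup>2 * min c 1) ` heavy_star M c k j)"

lemma max_beta_ge:
  "(k', j') \<in> heavy_star M c k j \<Longrightarrow> (beta_p M p (dilate 3 k' j') L)\<^sup>2 * min c 1 \<le> max_beta M c p k j L"
  unfolding max_beta_def by (rule Max_ge) (auto simp: finite_heavy_star intro: rev_image_eqI)

lemma beta_star_sq_nonneg: "0 < c \<Longrightarrow> 0 \<le> beta_star_sq M c p k j"
proof (cases "heavy_star M c k j = {}")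
  case False
  assume c: "0 < c"
  obtain k' j' where kj: "(k', j') \<in> heavy_star M c k j" using False by (metis ex_in_conv surj_pair)
  have "0 \<le> max_beta M c p k j L" for L
    using c by (intro order_trans[OF _ max_beta_ge[OF kj]]) auto
  then show ?thesis
    using False unfolding beta_star_sq_def max_beta_def[symmetric]
    by (simp only: if_False) (rule cINF_greatest[OF lines_nonempty])
qed (simp add: beta_star_sq_def)

text \<open>A slack \<delta> takes the place of a minimising line. As the maximum stands inside the
  infimum, one line serves all heavy cubes at once.\<close>

lemma near_optimal_line:
  assumes "0 < c" "0 < \<delta>" "heavy_star M c k j \<noteq> {}"
  obtains L where "L \<in> lines" "\<And>k' j'. (k', j') \<in> heavy_star M c k j \<Longrightarrow>
    (beta_p M p (dilate 3 k' j') L)\<^sup>2 * min c 1 \<le> beta_star_sq M c p k j + \<delta>"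
proof -
  have "(INF L\<in>lines. max_beta M c p k j L) < beta_star_sq M c p k j + \<delta>"
    using assms(2,3) unfolding beta_star_sq_def max_beta_def[symmetric] by simp
  then obtain L where "L \<in> lines" "max_beta M c p k j L < beta_star_sq M c p k j + \<delta>"
    using cInf_lessD[of "max_beta M c p k j ` lines"] lines_nonempty by blast
  then show thesis using max_beta_ge that by (meson less_imp_le order_trans)
qed

locale dense_set =
  fixes M :: "(real^'n) measure" and p c :: real and m :: int and j0 :: "'n \<Rightarrow> int" and G :: "(real^'n) set"
  assumes M: "radon_measure M" and p: "1 \<le> p" and c: "0 < c"
    and G: "G \<subseteq> dcube m j0" "G \<noteq> {}"
    and heavy: "\<And>x k. x \<in> G \<Longrightarrow> m \<le> k \<Longrightarrow>
      ennreal (c * diameter (dilate 3 k (idx k x))) \<le> emeasure M (dilate 3 k (idx k x))"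
begin

definition "T i = (\<lambda>x. (m + int i, idx (m + int i) x)) ` G"
definition "z Q = cmass M (dilate 3 (fst Q) (snd Q))"
text \<open>Bounds the diameter of a tripled cube of generation \<open>m\<close> as well as the
  distance from its centre of mass to that of a child, so it can serve as the initial
  radius.\<close>

definition "r = sqrt (real CARD('n)) * (3 * side m)"
text \<open>The slack \<open>1 / card\<close> adds up to 1 over the cubes of a generation; weighted
  by the side length it forms a geometric series.\<close>

definition "\<eta> Q = beta_star_sq M c p (fst Q) (snd Q) + 1 / card (T (nat (fst Q - m)))"
text \<open>The 2 is the loss in \<open>mean_le_power_mean\<close>; dividing by
  \<open>min c 1\<close> undoes the factor in \<open>beta_star_sq\<close>.\<close>

definition "a Q = 2 * sqrt (\<eta> Q / min c 1)"

lemma TI: "x \<in> G \<Longrightarrow> (m + int i, idx (m + int i) x) \<in> T i"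
  by (simp add: T_def)

lemma finite_T: "finite (T i)"
proof -
  have "bounded G" using G(1) bounded_dcube bounded_subset by blast
  then have "finite (Pair (m + int i) ` idx (m + int i) ` G)" using finite_idx_image by blast
  then show ?thesis by (simp add: T_def image_image)
qed

lemma card_T_pos: "0 < card (T i)"
  using finite_T G(2) by (auto simp: card_gt_0_iff T_def)

lemma T_fst: "Q \<in> T i \<Longrightarrow> fst Q = m + int i"
  by (auto simp: T_def)

lemma measure_pos:
  assumes "Q \<in> T i"
  shows "0 < measure M (dilate 3 (fst Q) (snd Q))" "emeasure M (dilate 3 (fst Q) (snd Q)) \<noteq> 0"
proof -
  obtain x where x: "x \<in> G" "Q = (m + int i, idx (m + int i) x)" using assms by (auto simp: T_def)
  have "0 < ennreal (c * diameter (dilate 3 (fst Q) (snd Q)))"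
    using c diameter_dilate3_pos[of "fst Q" "snd Q"] by simp
  also have "\<dots> \<le> emeasure M (dilate 3 (fst Q) (snd Q))" using heavy[OF x(1), of "m + int i"] x(2) by simp
  finally show "emeasure M (dilate 3 (fst Q) (snd Q)) \<noteq> 0" by auto
  moreover have "emeasure M (dilate 3 (fst Q) (snd Q)) = ennreal (measure M (dilate 3 (fst Q) (snd Q)))"
    using radon_finite[OF M bounded_dilate[of 3 "fst Q" "snd Q"]] by (intro emeasure_eq_ennreal_measure) auto
  ultimately show "0 < measure M (dilate 3 (fst Q) (snd Q))"
    by (auto simp: zero_less_measure_iff)
qed

lemma z_coord: "Q \<in> T i \<Longrightarrow> \<bar>z Q $ l - centre (fst Q) (snd Q) $ l\<bar> \<le> 3/2 * side (m + int i)"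
  unfolding z_def using dilate_dist[of _ 3 "fst Q" "snd Q" l] measure_pos(1)[of Q i] T_fst[of Q i]
  by (intro cmass_coord[OF M dilate_borel bounded_dilate]) auto

abbreviation (input) "Qx i x \<equiv> (m + int i, idx (m + int i) x)"

lemma side_Suc: "side (m + int (Suc i)) = side (m + int i) / 2"
  using side_add[of "m + int i" 1] by (simp add: algebra_simps)

lemma r_div: "r / 2 ^ i = sqrt (real CARD('n)) * (3 * side (m + int i))"
  by (simp add: r_def side_add)

text \<open>In units of the parent's side, each coordinate has offsets \<open>3/4\<close> and
  \<open>1/4\<close> at the child, from centre of mass to cube centre to \<open>x\<close>, and
  \<open>1/2\<close> and \<open>3/2\<close> at the parent. They add up to exactly 3.\<close>

lemma consecutive_dist:
  assumes "x \<in> G"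
  shows "dist (z (Qx (Suc i) x)) (z (Qx i x)) \<le> r / 2 ^ i"
  unfolding r_div dist_norm
proof (rule norm_le_coords)
  fix l
  let ?s = "side (m + int i)"
  have s: "side (m + int (Suc i)) = ?s / 2" by (rule side_Suc)
  show "\<bar>(z (Qx (Suc i) x) - z (Qx i x)) $ l\<bar> \<le> 3 * ?s"
    using z_coord[OF TI[OF assms], of "Suc i" l] z_coord[OF TI[OF assms], of i l]
      idx_centre_dist[of x l "m + int i"] idx_centre_dist[of x l "m + int (Suc i)"]
    unfolding s fst_conv snd_conv vector_minus_component abs_le_iff by linarith
qed

text \<open>Here the dilation factor \<open>1600 * sqrt n\<close> is used. With \<open>s\<close> the
  side of generation \<open>i\<close>, the distance \<open>80 * (r / 2 ^ i)\<close> is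
  \<open>240 * sqrt n * s\<close>, the other coordinate offsets add up to at most
  \<open>21/4 * s\<close>, and the half side of the dilated child is
  \<open>400 * sqrt n * s\<close>.\<close>

lemma near_heavy_star:
  assumes x: "x \<in> G" and R: "R \<in> T i \<union> T (Suc i)" and d: "dist (z R) (z (Qx i x)) \<le> 80 * (r / 2 ^ i)"
  shows "R \<in> heavy_star M c (m + int (Suc i)) (idx (m + int (Suc i)) x)"
proof -
  let ?s = "side (m + int i)" and ?n = "sqrt (real CARD('n))"
  have s0: "0 < ?s" by (rule side_pos)
  have n1: "1 \<le> ?n" by simp
  have sR: "side (m + int (Suc i)) \<le> side (fst R)" "side (fst R) \<le> ?s"
    using R T_fst[of R i] T_fst[of R "Suc i"] side_Suc[of i] s0 by auto
  have zR: "\<bar>z R $ l - centre (fst R) (snd R) $ l\<bar> \<le> 3/2 * side (fst R)" for l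
    using R z_coord[of R i l] z_coord[of R "Suc i" l] T_fst[of R i] T_fst[of R "Suc i"] by auto
  have "dilate 3 (fst R) (snd R) \<subseteq> dilate (1600 * ?n) (m + int (Suc i)) (idx (m + int (Suc i)) x)"
  proof
    fix y assume y: "y \<in> dilate 3 (fst R) (snd R)"
    show "y \<in> dilate (1600 * ?n) (m + int (Suc i)) (idx (m + int (Suc i)) x)"
    proof (rule dilateI)
      fix l
      have "\<bar>y $ l - centre (fst R) (snd R) $ l\<bar> \<le> 3 * side (fst R) / 2" by (rule dilate_dist[OF y])
      moreover note zR[of l]
      moreover have "\<bar>(z R - z (Qx i x)) $ l\<bar> \<le> 240 * (?n * ?s)"
        using order_trans[OF component_le_norm_cart d[unfolded dist_norm]] by (simp add: r_div)
      moreover have "\<bar>z (Qx i x) $ l - centre (m + int i) (idx (m + int i) x) $ l\<bar> \<le> 3/2 * ?s"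
        using z_coord[OF TI[OF x]] by simp
      moreover have "\<bar>x $ l - centre (m + int i) (idx (m + int i) x) $ l\<bar> \<le> ?s / 2"
        by (rule idx_centre_dist)
      moreover have "\<bar>x $ l - centre (m + int (Suc i)) (idx (m + int (Suc i)) x) $ l\<bar> \<le> ?s / 4"
        using idx_centre_dist[of x l "m + int (Suc i)"] unfolding side_Suc by simp
      moreover note sR(2)
      moreover have "1 * ?s \<le> ?n * ?s" using n1 s0 by (intro mult_right_mono) auto
      ultimately have "\<bar>y $ l - centre (m + int (Suc i)) (idx (m + int (Suc i)) x) $ l\<bar> < 400 * (?n * ?s)"
        using s0 unfolding vector_minus_component abs_le_iff abs_less_iff by linarith
      then show "\<bar>y $ l - centre (m + int (Suc i)) (idx (m + int (Suc i)) x) $ l\<bar>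
          < 1600 * ?n * side (m + int (Suc i)) / 2"
        unfolding side_Suc by simp
    qed
  qed
  moreover have "ennreal (c * diameter (dilate 3 (fst R) (snd R))) \<le> emeasure M (dilate 3 (fst R) (snd R))"
    using R heavy by (auto simp: T_def)
  moreover have "side (fst R) \<le> 2 * side (m + int (Suc i))"
    using sR(2) unfolding side_Suc by simp
  ultimately show ?thesis
    using sR(1) by (auto simp: heavy_star_def delta_star_def case_prod_unfold)
qed

lemma eta_nonneg: "0 \<le> \<eta> Q"
  unfolding \<eta>_def using beta_star_sq_nonneg[OF c] by (intro add_nonneg_nonneg) auto

lemma line_for_cube:
  assumes x: "x \<in> G"
  shows "\<exists>e o'. norm e = 1 \<and> (\<forall>R\<in>T i \<union> T (Suc i). dist (z R) (z (Qx i x)) \<le> 80 * (r / 2 ^ i) \<longrightarrow>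
    norm (perp e (z R - o')) \<le> a (Qx (Suc i) x) * (r / 2 ^ i))"
proof -
  let ?k = "m + int (Suc i)"
  have mc: "0 < min c 1" using c by simp
  have "nat (?k - m) = Suc i" by simp
  then have eta: "\<eta> (Qx (Suc i) x) = beta_star_sq M c p ?k (idx ?k x) + 1 / card (T (Suc i))"
    by (simp add: \<eta>_def)
  have r0: "0 \<le> r / 2 ^ i" unfolding r_div using side_pos[of "m + int i"] by simp
  \<comment> \<open>The cube itself is heavy, so \<open>beta_star_sq\<close> is the infimum and not
    the default 0.\<close>
  have "Qx (Suc i) x \<in> heavy_star M c ?k (idx ?k x)"
  proof (rule near_heavy_star[OF x])
    show "Qx (Suc i) x \<in> T i \<union> T (Suc i)" using TI[OF x, of "Suc i"] by blast
    show "dist (z (Qx (Suc i) x)) (z (Qx i x)) \<le> 80 * (r / 2 ^ i)"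
      using consecutive_dist[OF x, of i] r0 by linarith
  qed
  then obtain L where L: "L \<in> lines" "\<And>k' j'. (k', j') \<in> heavy_star M c ?k (idx ?k x) \<Longrightarrow>
    (beta_p M p (dilate 3 k' j') L)\<^sup>2 * min c 1 \<le> \<eta> (Qx (Suc i) x)"
    using near_optimal_line[OF c, of "1 / card (T (Suc i))" M ?k "idx ?k x" p] card_T_pos[of "Suc i"]
    unfolding eta by (metis divide_pos_pos empty_iff of_nat_0_less_iff zero_less_one)
  obtain e o' where eo: "norm e = 1" "\<And>x. norm (perp e (x - o')) \<le> infdist x L"
    using line_perp[OF L(1)] by blast
  have "norm (perp e (z R - o')) \<le> a (Qx (Suc i) x) * (r / 2 ^ i)"
    if R: "R \<in> T i \<union> T (Suc i)" "dist (z R) (z (Qx i x)) \<le> 80 * (r / 2 ^ i)" for R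
  proof -
    let ?D = "dilate 3 (fst R) (snd R)"
    have "(fst R, snd R) \<in> heavy_star M c ?k (idx ?k x)" using near_heavy_star[OF x R] by simp
    then have "(beta_p M p ?D L)\<^sup>2 * min c 1 \<le> \<eta> (Qx (Suc i) x)" by (rule L(2))
    then have "(beta_p M p ?D L)\<^sup>2 \<le> \<eta> (Qx (Suc i) x) / min c 1"
      using mc by (simp add: pos_le_divide_eq)
    then have beta: "beta_p M p ?D L \<le> sqrt (\<eta> (Qx (Suc i) x) / min c 1)"
      by (rule real_le_rsqrt)
    have "side (fst R) \<le> side (m + int i)"
      using R(1) T_fst[of R i] T_fst[of R "Suc i"] by (auto simp: side_le_iff)
    then have "diameter ?D \<le> r / 2 ^ i"
      unfolding r_div by (intro order_trans[OF diameter_dilate3_le] mult_left_mono) auto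
    then have "2 * diameter ?D * beta_p M p ?D L \<le> 2 * (r / 2 ^ i) * sqrt (\<eta> (Qx (Suc i) x) / min c 1)"
      using beta beta_p_nonneg[of M p ?D L] r0 diameter_dilate3_pos[of "fst R" "snd R"]
      by (intro mult_mono) auto
    moreover have "emeasure M ?D \<noteq> 0" using R(1) measure_pos(2) by blast
    then have "norm (perp e (z R - o')) \<le> 2 * diameter ?D * beta_p M p ?D L"
      unfolding z_def
      by (intro perp_cmass_le[OF M dilate_borel bounded_dilate _ diameter_dilate3_pos eo(2) p])
    ultimately show ?thesis by (simp add: a_def algebra_simps)
  qed
  then show ?thesis using eo(1) by blast
qed

text \<open>\<open>24 = 4 * 6\<close>: the square of the 2 in \<open>a\<close>, and
  \<open>r / 2 ^ i\<close> as \<open>6 * sqrt n\<close> sides of the child. The separate side length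
  is the total slack of the generation.\<close>

lemma sum_a:
  "(\<Sum>R\<in>T (Suc i). (a R)\<^sup>2 * (r / 2 ^ i)) =
    24 * sqrt (real CARD('n)) / min c 1 *
    ((\<Sum>R\<in>T (Suc i). beta_star_sq M c p (fst R) (snd R) * side (fst R)) + side (m + int (Suc i)))"
proof -
  let ?C = "24 * sqrt (real CARD('n)) / min c 1" and ?s = "side (m + int (Suc i))"
  have mc: "0 < min c 1" using c by simp
  have rs: "r / 2 ^ i = 6 * sqrt (real CARD('n)) * ?s" unfolding r_div side_Suc by simp
  have "(a R)\<^sup>2 * (r / 2 ^ i) = ?C * (beta_star_sq M c p (fst R) (snd R) * side (fst R) + 1 / card (T (Suc i)) * ?s)"
    if "R \<in> T (Suc i)" for R
  proof -
    have f: "fst R = m + int (Suc i)" by (rule T_fst[OF that])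
    then have "nat (fst R - m) = Suc i" by simp
    then have eta: "\<eta> R = beta_star_sq M c p (fst R) (snd R) + 1 / card (T (Suc i))"
      by (simp add: \<eta>_def)
    have "(a R)\<^sup>2 = 4 * (\<eta> R / min c 1)"
      using eta_nonneg[of R] mc by (simp add: a_def power_mult_distrib)
    then show ?thesis unfolding rs eta f by (simp add: field_simps)
  qed
  then have "(\<Sum>R\<in>T (Suc i). (a R)\<^sup>2 * (r / 2 ^ i)) =
    (\<Sum>R\<in>T (Suc i). ?C * (beta_star_sq M c p (fst R) (snd R) * side (fst R) + 1 / card (T (Suc i)) * ?s))"
    by (rule sum.cong[OF refl])
  also have "\<dots> = ?C * ((\<Sum>R\<in>T (Suc i). beta_star_sq M c p (fst R) (snd R) * side (fst R)) + ?s)"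
    unfolding sum_distrib_left[symmetric] sum.distrib using card_T_pos[of "Suc i"] by simp
  finally show ?thesis .
qed

lemma sum_sides: "(\<Sum>i<n. side (m + int (Suc i))) \<le> side m"
proof -
  have "(\<Sum>i<n. side (m + int (Suc i))) = side m - side (m + int n)"
  proof (induction n)
    case (Suc n)
    then show ?case using side_Suc[of n] by simp
  qed simp
  then show ?thesis using side_pos[of "m + int n"] by simp
qed

lemma z_tendsto: "x \<in> G \<Longrightarrow> (\<lambda>i. z (Qx i x)) \<longlonglongrightarrow> x"
proof -
  assume x: "x \<in> G"
  have "norm (z (Qx i x) - x) \<le> r / 2 ^ i" for i
    unfolding r_div
  proof (rule norm_le_coords)
    fix l
    show "\<bar>(z (Qx i x) - x) $ l\<bar> \<le> 3 * side (m + int i)"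
      using z_coord[OF TI[OF x], of i l] idx_centre_dist[of x l "m + int i"] side_pos[of "m + int i"]
      unfolding fst_conv snd_conv vector_minus_component abs_le_iff by linarith
  qed
  moreover have "(\<lambda>i. r / 2 ^ i) \<longlonglongrightarrow> 0" by (rule LIMSEQ_divide_realpow_zero) simp
  ultimately have "(\<lambda>i. z (Qx i x) - x) \<longlonglongrightarrow> 0"
    by (intro Lim_null_comparison[of "\<lambda>i. z (Qx i x) - x"]) auto
  then show ?thesis by (simp add: LIM_zero_iff)
qed

theorem covering_curve:
  assumes S: "\<And>n. (\<Sum>i<n. \<Sum>R\<in>T (Suc i). beta_star_sq M c p (fst R) (snd R) * side (fst R)) \<le> S"
  shows "\<exists>f L. L-lipschitz_on {0..1::real} f \<and> G \<subseteq> f ` {0..1}"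
proof -
  let ?C = "24 * sqrt (real CARD('n)) / min c 1"
  interpret flat_tree T z a r "?C * (S + side m)"
  proof
    show "finite (T i)" for i by (rule finite_T)
    show "T 0 \<noteq> {}" using G(2) by (simp add: T_def)
    show "0 < r" using side_pos[of m] by (simp add: r_def)
    show "\<exists>P\<in>T i. dist (z R) (z P) \<le> r / 2 ^ i" if R: "R \<in> T (Suc i)" for i R
    proof -
      obtain x where "x \<in> G" "R = Qx (Suc i) x" using R by (auto simp: T_def)
      then show ?thesis using consecutive_dist[of x i] TI[of x i] by blast
    qed
    show "\<exists>R\<in>T (Suc i). dist (z R) (z P) \<le> r / 2 ^ i \<and>
      (\<exists>e o'. norm e = 1 \<and> (\<forall>y\<in>T i \<union> T (Suc i). dist (z y) (z P) \<le> 80 * (r / 2 ^ i) \<longrightarrow>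
        norm (perp e (z y - o')) \<le> a R * (r / 2 ^ i)))" if P: "P \<in> T i" for i P
    proof -
      obtain x where x: "x \<in> G" "P = Qx i x" using P by (auto simp: T_def)
      show ?thesis unfolding x(2)
        by (intro bexI[OF _ TI[OF x(1)]] conjI consecutive_dist line_for_cube x(1))
    qed
    show "0 \<le> a R" for R using eta_nonneg[of R] c by (simp add: a_def)
    show "(\<Sum>i<n. \<Sum>R\<in>T (Suc i). (a R)\<^sup>2 * (r / 2 ^ i)) \<le> ?C * (S + side m)" for n
    proof -
      have "(\<Sum>i<n. \<Sum>R\<in>T (Suc i). (a R)\<^sup>2 * (r / 2 ^ i)) =
        ?C * ((\<Sum>i<n. \<Sum>R\<in>T (Suc i). beta_star_sq M c p (fst R) (snd R) * side (fst R)) + (\<Sum>i<n. side (m + int (Suc i))))"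
        unfolding sum_a sum_distrib_left[symmetric] sum.distrib ..
      also have "\<dots> \<le> ?C * (S + side m)"
        using S sum_sides c by (intro mult_left_mono add_mono) auto
      finally show ?thesis .
    qed
  qed
  obtain f L where f: "L-lipschitz_on {0..1::real} f"
    "\<forall>x R. (\<forall>j. R j \<in> T j) \<longrightarrow> (\<lambda>j. z (R j)) \<longlonglongrightarrow> x \<longrightarrow> x \<in> f ` {0..1}"
    using limit_curve by blast
  have "G \<subseteq> f ` {0..1}"
  proof
    fix x assume "x \<in> G"
    then show "x \<in> f ` {0..1}"
      using f(2)[rule_format, of "\<lambda>i. Qx i x" x] TI z_tendsto by simp
  qed
  with f(1) show ?thesis by blast
qed

end

subsection \<open>Localisation to cubes that carry the set\<close>

lemma ennreal_divide_mult_self: "b \<noteq> 0 \<Longrightarrow> b < top \<Longrightarrow> a / b * b = a"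
  for a b :: ennreal
  by (simp add: ennreal_divide_times)

abbreviation dc :: "int \<times> ('n::finite \<Rightarrow> int) \<Rightarrow> (real^'n) set" where
  "dc Q \<equiv> dcube (fst Q) (snd Q)"

text \<open>The inequality is not strict, so cubes of measure zero are bad and the remaining ones
  admit division by their measure.\<close>

definition bad_cubes :: "(real^'n::finite) measure \<Rightarrow> (real^'n) set \<Rightarrow> int \<Rightarrow> real \<Rightarrow> (int \<times> ('n \<Rightarrow> int)) set" where
  "bad_cubes M B m \<epsilon> = {Q. m \<le> fst Q \<and> emeasure M (B \<inter> dc Q) \<le> ennreal \<epsilon> * emeasure M (dc Q)}"

definition bad_part :: "(real^'n::finite) measure \<Rightarrow> (real^'n) set \<Rightarrow> int \<Rightarrow> real \<Rightarrow> (real^'n) set" where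
  "bad_part M B m \<epsilon> = (\<Union>Q\<in>bad_cubes M B m \<epsilon>. dc Q)"

lemma bad_part_borel: "bad_part M B m \<epsilon> \<in> sets borel"
  unfolding bad_part_def by (intro sets.countable_UN'' dcube_borel) auto

text \<open>The maximal bad cubes are disjoint, and each carries little of \<open>B\<close>.\<close>

lemma emeasure_bad_part_le:
  fixes M :: "(real^'n::finite) measure"
  assumes M: "radon_measure M" and B: "B \<in> sets borel" "B \<subseteq> dcube m j0"
  shows "emeasure M (B \<inter> bad_part M B m \<epsilon>) \<le> ennreal \<epsilon> * emeasure M (dcube m j0)"
proof -
  let ?bad = "bad_cubes M B m \<epsilon>"
  \<comment> \<open>The maximal bad cubes, each written through a point \<open>x\<close> of it, so
    that its ancestors are the \<open>(l, idx l x)\<close>.\<close>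
  define I where "I = {(k, idx k x) | k x. x \<in> dcube m j0 \<and> m \<le> k \<and> (k, idx k x) \<in> ?bad \<and>
    (\<forall>l. m \<le> l \<and> l < k \<longrightarrow> (l, idx l x) \<notin> ?bad)}"
  have sM: "sets M = sets borel" using M by (simp add: radon_measure_def)
  have cI: "countable I" by (rule countable_subset[of _ UNIV]) auto
  have disj: "disjoint_family_on dc I"
  unfolding disjoint_family_on_def
  proof (intro ballI impI, rule ccontr)
    fix Q R assume QR: "Q \<in> I" "R \<in> I" "Q \<noteq> R" "dc Q \<inter> dc R \<noteq> {}"
    obtain k x where Q: "Q = (k, idx k x)" "m \<le> k" "Q \<in> ?bad" "\<And>l. m \<le> l \<Longrightarrow> l < k \<Longrightarrow> (l, idx l x) \<notin> ?bad"
      using QR(1) unfolding I_def by blast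
    obtain l y where R: "R = (l, idx l y)" "m \<le> l" "R \<in> ?bad" "\<And>k. m \<le> k \<Longrightarrow> k < l \<Longrightarrow> (k, idx k y) \<notin> ?bad"
      using QR(2) unfolding I_def by blast
    obtain w where "w \<in> dc Q" "w \<in> dc R" using QR(4) by blast
    then have w: "idx k x = idx k w" "idx l y = idx l w"
      using Q(1) R(1) by (simp_all add: mem_dcube_iff)
    consider "k < l" | "l < k" | "k = l" by linarith
    then show False
    proof cases
      case 1
      then have "idx k y = idx k w" using idx_eq_coarser[of k l y w] w by simp
      then show False using R(4)[OF Q(2) 1] Q(1,3) w by simp
    next
      case 2
      then have "idx l x = idx l w" using idx_eq_coarser[of l k x w] w by simp
      then show False using Q(4)[OF R(2) 2] R(1,3) w by simp
    next
      case 3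
      then show False using QR(3) Q(1) R(1) w by simp
    qed
  qed
  have cover: "B \<inter> bad_part M B m \<epsilon> \<subseteq> (\<Union>Q\<in>I. B \<inter> dc Q)"
  proof
    fix x assume x: "x \<in> B \<inter> bad_part M B m \<epsilon>"
    then obtain k where k: "m \<le> k" "(k, idx k x) \<in> ?bad"
      by (auto simp: bad_part_def mem_dcube_iff bad_cubes_def)
    define P where "P i \<longleftrightarrow> (m + int i, idx (m + int i) x) \<in> ?bad" for i
    have "P (nat (k - m))" using k by (simp add: P_def)
    then have P: "P (LEAST i. P i)" by (rule LeastI)
    define l where "l = m + int (LEAST i. P i)"
    have "(l, idx l x) \<in> ?bad" "m \<le> l" using P by (auto simp: P_def l_def)
    moreover have "(l', idx l' x) \<notin> ?bad" if "m \<le> l'" "l' < l" for l'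
      using not_less_Least[of "nat (l' - m)" P] that by (simp add: P_def l_def)
    moreover have "x \<in> dcube m j0" using x B by auto
    ultimately have "(l, idx l x) \<in> I" unfolding I_def by blast
    then show "x \<in> (\<Union>Q\<in>I. B \<inter> dc Q)" using x by (force simp: mem_dcube_iff)
  qed
  have sub: "(\<Union>Q\<in>I. dc Q) \<subseteq> dcube m j0"
    by (auto simp: I_def mem_dcube_iff dest: idx_eq_coarser)
  have meas: "dc Q \<in> sets M" "B \<inter> dc Q \<in> sets M" for Q :: "int \<times> ('n \<Rightarrow> int)"
    using sM B(1) dcube_borel by auto
  have "emeasure M (B \<inter> bad_part M B m \<epsilon>) \<le> emeasure M (\<Union>Q\<in>I. B \<inter> dc Q)"
    using meas cI by (intro emeasure_mono[OF cover] sets.countable_UN') auto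
  also have "\<dots> = (\<integral>\<^sup>+Q. emeasure M (B \<inter> dc Q) \<partial>count_space I)"
  proof (rule emeasure_UN_countable[OF meas(2) cI])
    show "disjoint_family_on (\<lambda>Q. B \<inter> dc Q) I"
      unfolding disjoint_family_on_def
    proof (intro ballI impI)
      fix Q R assume "Q \<in> I" "R \<in> I" "Q \<noteq> R"
      then have "dc Q \<inter> dc R = {}" using disj unfolding disjoint_family_on_def by blast
      then show "B \<inter> dc Q \<inter> (B \<inter> dc R) = {}" by blast
    qed
  qed
  also have "\<dots> \<le> (\<integral>\<^sup>+Q. ennreal \<epsilon> * emeasure M (dc Q) \<partial>count_space I)"
    by (intro nn_integral_mono) (auto simp: I_def bad_cubes_def)
  also have "\<dots> = ennreal \<epsilon> * (\<integral>\<^sup>+Q. emeasure M (dc Q) \<partial>count_space I)"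
    by (rule nn_integral_cmult) auto
  also have "(\<integral>\<^sup>+Q. emeasure M (dc Q) \<partial>count_space I) = emeasure M (\<Union>Q\<in>I. dc Q)"
    by (rule emeasure_UN_countable[symmetric, OF meas(1) cI disj])
  also have "\<dots> \<le> emeasure M (dcube m j0)"
    using sub meas(1)[of "(m, j0)"] by (intro emeasure_mono) auto
  finally show ?thesis by (simp add: mult_left_mono)
qed

section \<open>Measurability and integration of \<open>J\<close>\<close>

definition J_term :: "(real^'n::finite) measure \<Rightarrow> real \<Rightarrow> real \<Rightarrow> int \<times> ('n \<Rightarrow> int) \<Rightarrow> real^'n \<Rightarrow> ennreal" where
  "J_term M c p Q x = ennreal (beta_star_sq M c p (fst Q) (snd Q) * diameter (dc Q)) / emeasure M (dc Q) * indicator (dc Q) x"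

lemma J_star_eq: "J_star M c p x = (\<integral>\<^sup>+Q. J_term M c p Q x \<partial>count_space {Q. 0 \<le> fst Q})"
  by (simp add: J_star_def J_term_def)

lemma J_term_measurable: "J_term M c p Q \<in> borel_measurable borel"
  unfolding J_term_def by (intro borel_measurable_times_ennreal borel_measurable_indicator dcube_borel) simp

text \<open>The sum over a countable index set becomes a series over \<open>nat\<close>. As
  \<open>to_nat\<close> need not be onto, its range enters as an indicator.\<close>

lemma J_star_measurable:
  fixes M :: "(real^'n::finite) measure"
  shows "J_star M c p \<in> borel_measurable borel"
proof -
  let ?I = "{Q :: int \<times> ('n \<Rightarrow> int). 0 \<le> fst Q}"
  let ?R = "range (to_nat :: int \<times> ('n \<Rightarrow> int) \<Rightarrow> nat)"
  have "J_star M c p x = (\<Sum>n. J_term M c p (from_nat n) x * indicator ?I (from_nat n) * indicator ?R n)" for x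
  proof -
    have "J_star M c p x = (\<integral>\<^sup>+Q. J_term M c p Q x * indicator ?I Q \<partial>count_space UNIV)"
      unfolding J_star_eq by (rule nn_integral_count_space_indicator) simp
    also have "\<dots> = (\<integral>\<^sup>+Q. J_term M c p (from_nat (to_nat Q)) x * indicator ?I (from_nat (to_nat Q)) \<partial>count_space (UNIV :: (int \<times> ('n \<Rightarrow> int)) set))"
      by simp
    also have "\<dots> = (\<integral>\<^sup>+n. J_term M c p (from_nat n) x * indicator ?I (from_nat n) \<partial>count_space ?R)"
      by (rule nn_integral_bij_count_space) (simp add: bij_betw_def)
    also have "\<dots> = (\<integral>\<^sup>+n. J_term M c p (from_nat n) x * indicator ?I (from_nat n) * indicator ?R n \<partial>count_space UNIV)"
      by (rule nn_integral_count_space_indicator) simp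
    also have "\<dots> = (\<Sum>n. J_term M c p (from_nat n) x * indicator ?I (from_nat n) * indicator ?R n)"
      by (rule nn_integral_count_space_nat)
    finally show ?thesis .
  qed
  moreover have "(\<lambda>x. \<Sum>n. J_term M c p (from_nat n) x * indicator ?I (from_nat n) * indicator ?R n) \<in> borel_measurable borel"
    by (intro borel_measurable_suminf_order borel_measurable_times_ennreal J_term_measurable) auto
  ultimately show ?thesis by (simp cong: measurable_cong)
qed

text \<open>If \<open>Q\<close> is not bad, the part of \<open>B\<close> in it has measure above
  \<epsilon> times that of \<open>Q\<close>, so \<epsilon> times the numerator of the
  \<open>J\<close> term is at most the integral of this term over \<open>B\<close>. Tonelli and the
  bound \<open>N\<close> on \<open>B\<close> give the sum.\<close>

lemma beta_sum_bound:
  fixes M :: "(real^'n::finite) measure"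
  assumes M: "radon_measure M" and c: "0 < c" and \<epsilon>: "0 < \<epsilon>" and m: "0 \<le> m"
    and B: "B \<in> sets borel" "B \<subseteq> dcube m j0" and J: "\<And>x. x \<in> B \<Longrightarrow> J_star M c p x \<le> of_nat N"
    and T: "finite T" "\<And>Q. Q \<in> T \<Longrightarrow> m \<le> fst Q \<and> Q \<notin> bad_cubes M B m \<epsilon>"
  shows "(\<Sum>Q\<in>T. beta_star_sq M c p (fst Q) (snd Q) * side (fst Q)) \<le> 2 * real N * measure M (dcube m j0) / \<epsilon>"
proof -
  let ?b = "\<lambda>Q. beta_star_sq M c p (fst Q) (snd Q) * diameter (dc Q)"
  let ?I = "{Q :: int \<times> ('n \<Rightarrow> int). 0 \<le> fst Q}"
  have sM: "sets M = sets borel" using M by (simp add: radon_measure_def)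
  have BM: "B \<in> sets M" using B sM by simp
  have finQ: "emeasure M (dc Q) < \<infinity>" for Q :: "int \<times> ('n \<Rightarrow> int)"
    by (rule radon_finite[OF M bounded_dcube])
  have mQ: "emeasure M (dcube m j0) = ennreal (measure M (dcube m j0))"
    using finQ[of "(m, j0)"] by (intro emeasure_eq_ennreal_measure) auto
  have b0: "0 \<le> ?b Q" for Q :: "int \<times> ('n \<Rightarrow> int)"
    using beta_star_sq_nonneg[OF c] diameter_dcube_ge[of "fst Q" "snd Q"] side_pos[of "fst Q"]
    by (intro mult_nonneg_nonneg) (auto intro: order_trans[rotated])
  have step: "ennreal \<epsilon> * ennreal (?b Q) \<le> (\<integral>\<^sup>+x. J_term M c p Q x * indicator B x \<partial>M)" if "Q \<in> T" for Q
  proof -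
    let ?\<mu> = "emeasure M (dc Q)"
    have nb: "ennreal \<epsilon> * ?\<mu> < emeasure M (B \<inter> dc Q)"
      using T(2)[OF that] by (auto simp: bad_cubes_def)
    have "0 < emeasure M (B \<inter> dc Q)" using nb by (rule le_less_trans[OF zero_le])
    also have "\<dots> \<le> ?\<mu>" using sM dcube_borel by (intro emeasure_mono) auto
    finally have pos: "?\<mu> \<noteq> 0" by simp
    have "ennreal \<epsilon> * ennreal (?b Q) = ennreal \<epsilon> * (ennreal (?b Q) / ?\<mu> * ?\<mu>)"
      using pos finQ[of Q] by (subst ennreal_divide_mult_self) auto
    also have "\<dots> = ennreal (?b Q) / ?\<mu> * (ennreal \<epsilon> * ?\<mu>)"
      by (simp only: mult_ac)
    also have "\<dots> \<le> ennreal (?b Q) / ?\<mu> * emeasure M (B \<inter> dc Q)"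
      using nb by (intro mult_left_mono) auto
    also have "\<dots> = (\<integral>\<^sup>+x. ennreal (?b Q) / ?\<mu> * indicator (B \<inter> dc Q) x \<partial>M)"
      using BM sM dcube_borel by (intro nn_integral_cmult_indicator[symmetric]) auto
    also have "\<dots> = (\<integral>\<^sup>+x. J_term M c p Q x * indicator B x \<partial>M)"
      by (intro nn_integral_cong) (auto simp: J_term_def indicator_def)
    finally show ?thesis .
  qed
  have "ennreal \<epsilon> * ennreal (\<Sum>Q\<in>T. ?b Q) = (\<Sum>Q\<in>T. ennreal \<epsilon> * ennreal (?b Q))"
    using b0 by (simp add: sum_distrib_left flip: sum_ennreal)
  also have "\<dots> \<le> (\<Sum>Q\<in>T. \<integral>\<^sup>+x. J_term M c p Q x * indicator B x \<partial>M)"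
    by (rule sum_mono) (rule step)
  also have "\<dots> = (\<integral>\<^sup>+Q. (\<integral>\<^sup>+x. J_term M c p Q x * indicator B x \<partial>M) \<partial>count_space T)"
    using T(1) by (simp add: nn_integral_count_space_finite)
  also have "\<dots> \<le> (\<integral>\<^sup>+Q. (\<integral>\<^sup>+x. J_term M c p Q x * indicator B x \<partial>M) \<partial>count_space ?I)"
  proof -
    have "T \<subseteq> ?I" using T(2) m by fastforce
    then show ?thesis
      by (subst (1 2) nn_integral_count_space_indicator)
        (auto intro!: nn_integral_mono simp: indicator_def)
  qed
  also have "\<dots> = (\<integral>\<^sup>+x. (\<integral>\<^sup>+Q. J_term M c p Q x * indicator B x \<partial>count_space ?I) \<partial>M)"
    by (intro nn_integral_count_space_nn_integral[symmetric] borel_measurable_times_ennreal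
        borel_measurable_indicator BM radon_measurable[OF M J_term_measurable]) auto
  also have "\<dots> = (\<integral>\<^sup>+x. J_star M c p x * indicator B x \<partial>M)"
    unfolding J_star_eq by (intro nn_integral_cong nn_integral_multc) auto
  also have "\<dots> \<le> (\<integral>\<^sup>+x. of_nat N * indicator B x \<partial>M)"
    using J by (intro nn_integral_mono) (auto simp: indicator_def)
  also have "\<dots> = of_nat N * emeasure M B" using BM by (rule nn_integral_cmult_indicator)
  also have "\<dots> \<le> of_nat N * emeasure M (dcube m j0)"
    using B(2) sM dcube_borel by (intro mult_left_mono emeasure_mono) auto
  also have "\<dots> = ennreal (real N * measure M (dcube m j0))"
    unfolding mQ by (simp add: ennreal_mult ennreal_of_nat_eq_real_of_nat)
  finally have "\<epsilon> * (\<Sum>Q\<in>T. ?b Q) \<le> real N * measure M (dcube m j0)"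
    using \<epsilon> b0 by (simp add: sum_nonneg flip: ennreal_mult)
  then have 1: "(\<Sum>Q\<in>T. ?b Q) \<le> real N * measure M (dcube m j0) / \<epsilon>"
    using \<epsilon> by (simp add: pos_le_divide_eq mult.commute)
  \<comment> \<open>The factor 2 comes from bounding the side by twice the diameter, as in
    \<open>diameter_dcube_ge\<close>.\<close>
  have "(\<Sum>Q\<in>T. beta_star_sq M c p (fst Q) (snd Q) * side (fst Q)) \<le> (\<Sum>Q\<in>T. 2 * ?b Q)"
  proof (rule sum_mono)
    fix Q
    have "beta_star_sq M c p (fst Q) (snd Q) * side (fst Q) \<le> beta_star_sq M c p (fst Q) (snd Q) * (2 * diameter (dc Q))"
      using diameter_dcube_ge[of "fst Q" "snd Q"] beta_star_sq_nonneg[OF c] by (intro mult_left_mono) auto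
    then show "beta_star_sq M c p (fst Q) (snd Q) * side (fst Q) \<le> 2 * ?b Q" by simp
  qed
  also have "\<dots> = 2 * (\<Sum>Q\<in>T. ?b Q)" by (rule sum_distrib_left[symmetric])
  finally show ?thesis using 1 by simp
qed

text \<open>Countably many pieces make uniform the bound \<open>N\<close> for \<open>J\<close> and
  the generation \<open>m\<close> from which tripled cubes are heavy. Restriction to one cube gives
  finite measure, and a natural \<open>m\<close> keeps all cubes at side length at most 1.\<close>

definition piece :: "(real^'n::finite) measure \<Rightarrow> real \<Rightarrow> real \<Rightarrow> nat \<Rightarrow> nat \<Rightarrow> ('n \<Rightarrow> int) \<Rightarrow> (real^'n) set" where
  "piece M p c m N j0 = {x \<in> dcube (int m) j0. J_star M c p x \<le> of_nat N \<and>
     (\<forall>k\<ge>int m. ennreal (c * diameter (dilate 3 k (idx k x))) \<le> emeasure M (dilate 3 k (idx k x)))}"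

text \<open>Heaviness depends on \<open>x\<close> only through its cube, so the points violating it
  form a countable union of cubes.\<close>

lemma piece_borel: "piece M p c m N j0 \<in> sets borel"
proof -
  let ?light = "{Q. int m \<le> fst Q \<and> \<not> ennreal (c * diameter (dilate 3 (fst Q) (snd Q))) \<le> emeasure M (dilate 3 (fst Q) (snd Q))}"
  have "piece M p c m N j0 = (dcube (int m) j0 \<inter> {x. J_star M c p x \<le> of_nat N}) - (\<Union>Q\<in>?light. dc Q)"
    by (auto simp: piece_def mem_dcube_iff)
  moreover have J: "{x. J_star M c p x \<le> of_nat N} \<in> sets borel"
    using J_star_measurable[of M c p] by measurable
  moreover have L: "(\<Union>Q\<in>?light. dc Q) \<in> sets borel"
    by (intro sets.countable_UN'' dcube_borel) auto
  ultimately show ?thesis by (simp only:) (intro sets.Diff sets.Int dcube_borel J L)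
qed

lemma piece_curve:
  fixes M :: "(real^'n::finite) measure" and m N :: nat and j0 :: "'n \<Rightarrow> int"
  assumes M: "radon_measure M" and p: "1 \<le> p" and c: "0 < c" and \<epsilon>: "0 < \<epsilon>"
  defines "B \<equiv> piece M p c m N j0"
  shows "\<exists>f L. L-lipschitz_on {0..1::real} f \<and> B - bad_part M B (int m) \<epsilon> \<subseteq> f ` {0..1}"
proof (cases "B - bad_part M B (int m) \<epsilon> = {}")
  case True
  then show ?thesis
    by (intro exI[of _ "\<lambda>_. 0"] exI[of _ 0]) (simp add: True lipschitz_on_def)
next
  case False
  let ?G = "B - bad_part M B (int m) \<epsilon>"
  have B: "B \<in> sets borel" "B \<subseteq> dcube (int m) j0" "\<And>x. x \<in> B \<Longrightarrow> J_star M c p x \<le> of_nat N"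
    using piece_borel by (auto simp: B_def piece_def)
  have heavy: "ennreal (c * diameter (dilate 3 k (idx k x))) \<le> emeasure M (dilate 3 k (idx k x))"
    if "x \<in> ?G" "int m \<le> k" for x k
    using that unfolding B_def piece_def by blast
  have sub: "?G \<subseteq> dcube (int m) j0" using B(2) by blast
  interpret dense_set M p c "int m" j0 ?G
    by (rule dense_set.intro) (fact M p c sub False heavy)+
  \<comment> \<open>A cube of the tree contains a point outside the bad part, hence is not
    bad.\<close>
  have good: "int m \<le> fst Q \<and> Q \<notin> bad_cubes M B (int m) \<epsilon>" if "Q \<in> T i" for Q i
  proof -
    obtain x where x: "x \<in> ?G" "Q = (int m + int i, idx (int m + int i) x)"
      using \<open>Q \<in> T i\<close> unfolding T_def by blast
    have "x \<in> dc Q" by (simp add: x(2) mem_dcube_iff)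
    then show ?thesis using x unfolding bad_part_def by auto
  qed
  show ?thesis
  proof (rule covering_curve)
    fix n
    have "(\<Sum>i<n. \<Sum>R\<in>T (Suc i). beta_star_sq M c p (fst R) (snd R) * side (fst R)) =
      (\<Sum>R\<in>(\<Union>i<n. T (Suc i)). beta_star_sq M c p (fst R) (snd R) * side (fst R))"
    proof (rule sum.UNION_disjoint[symmetric])
      show "\<forall>i\<in>{..<n}. \<forall>j\<in>{..<n}. i \<noteq> j \<longrightarrow> T (Suc i) \<inter> T (Suc j) = {}"
      proof (intro ballI impI, rule ccontr)
        fix i j assume "i \<noteq> j" "T (Suc i) \<inter> T (Suc j) \<noteq> {}"
        then show False using T_fst[of _ "Suc i"] T_fst[of _ "Suc j"] by force
      qed
    qed (use finite_T in auto)
    also have "\<dots> \<le> 2 * real N * measure M (dcube (int m) j0) / \<epsilon>"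
      using good finite_T by (intro beta_sum_bound[OF M c \<epsilon> _ B]) auto
    finally show "(\<Sum>i<n. \<Sum>R\<in>T (Suc i). beta_star_sq M c p (fst R) (snd R) * side (fst R))
      \<le> 2 * real N * measure M (dcube (int m) j0) / \<epsilon>" .
  qed
qed

text \<open>One \<epsilon> may leave part of the piece uncovered. The points left over for every
  \<epsilon> lie in sets whose measure is at most \<epsilon> times that of the cube.\<close>

lemma piece_bad_null:
  fixes M :: "(real^'n::finite) measure" and m N :: nat and j0 :: "'n \<Rightarrow> int" and p c :: real
  assumes M: "radon_measure M"
  defines "B \<equiv> piece M p c m N j0"
  shows "(\<Inter>i::nat. B \<inter> bad_part M B (int m) (1 / real (Suc i))) \<in> null_sets M"
proof -
  let ?A = "\<lambda>i::nat. B \<inter> bad_part M B (int m) (1 / real (Suc i))"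
  have sM: "sets M = sets borel" using M by (simp add: radon_measure_def)
  have B: "B \<in> sets borel" "B \<subseteq> dcube (int m) j0"
    using piece_borel by (auto simp: B_def piece_def)
  have A: "?A i \<in> sets M" for i unfolding sM by (intro sets.Int B(1) bad_part_borel)
  have "emeasure M (dcube (int m) j0) < \<infinity>" by (rule radon_finite[OF M bounded_dcube])
  then have mQ: "emeasure M (dcube (int m) j0) = ennreal (measure M (dcube (int m) j0))"
    by (intro emeasure_eq_ennreal_measure) auto
  have le: "emeasure M (\<Inter>i. ?A i) \<le> ennreal (measure M (dcube (int m) j0) / real (Suc i))" for i
  proof -
    have "emeasure M (\<Inter>i. ?A i) \<le> emeasure M (?A i)" using A by (intro emeasure_mono) auto
    also have "\<dots> \<le> ennreal (1 / real (Suc i)) * emeasure M (dcube (int m) j0)"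
      by (rule emeasure_bad_part_le[OF M B])
    also have "\<dots> = ennreal (measure M (dcube (int m) j0) / real (Suc i))"
      unfolding mQ by (simp flip: ennreal_mult)
    finally show ?thesis .
  qed
  have "(\<lambda>i. ennreal (measure M (dcube (int m) j0) / real (Suc i))) \<longlonglongrightarrow> ennreal 0"
    by (intro tendsto_ennrealI LIMSEQ_Suc lim_const_over_n)
  then have "emeasure M (\<Inter>i. ?A i) \<le> ennreal 0"
    using le by (intro LIMSEQ_le_const) auto
  then have "emeasure M (\<Inter>i. ?A i) = 0" by simp
  moreover have "(\<Inter>i. ?A i) \<in> sets M" using A by (intro sets.countable_INT) auto
  ultimately show ?thesis by (auto intro: null_setsI)
qed

text \<open>Balls around \<open>x\<close> of radius below the side \<open>s\<close> lie in the
  tripled cube, so its measure is at least \<open>2 * s\<close> times the density bound. Because of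
  the factor \<open>3/2 * sqrt n\<close> this is \<open>c * (3 * sqrt n * s)\<close>, which
  dominates \<open>c\<close> times the diameter.\<close>

lemma mem_pieces:
  fixes M :: "(real^'n::finite) measure"
  assumes M: "radon_measure M" and c: "0 < c"
    and D: "ennreal (3/2 * sqrt (real CARD('n)) * c) < lower_density1 M x" and J: "J_star M c p x < \<infinity>"
  shows "\<exists>m N j0. x \<in> piece M p c m N j0"
proof -
  let ?K = "3/2 * sqrt (real CARD('n)) * c"
  have K: "0 \<le> ?K" using c by simp
  have "eventually (\<lambda>r. ennreal ?K < emeasure M (cball x r) / ennreal (2 * r)) (at_right 0)"
    using D unfolding lower_density1_def by (rule less_LiminfD)
  then obtain d where d: "0 < d" "\<And>r. 0 < r \<Longrightarrow> r < d \<Longrightarrow> ennreal ?K < emeasure M (cball x r) / ennreal (2 * r)"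
    unfolding eventually_at_right_field by blast
  obtain m :: nat where m: "inverse (2 ^ m) < d"
    using real_arch_pow_inv[of d "1/2"] d(1) by (auto simp: power_one_over inverse_eq_divide)
  have sm: "side (int m) < d" using side_add[of 0 m] m by (simp add: side_0 inverse_eq_divide)
  obtain N where N: "J_star M c p x \<le> of_nat N"
    using J ennreal_Ex_less_of_nat[of "J_star M c p x"] by (auto intro: less_imp_le)
  have "ennreal (c * diameter (dilate 3 k (idx k x))) \<le> emeasure M (dilate 3 k (idx k x))" if k: "int m \<le> k" for k
  proof -
    let ?D = "dilate 3 k (idx k x)" and ?s = "side k"
    have s: "0 < ?s" "?s < d" using side_pos[of k] sm k side_le_iff[of k "int m"] by auto
    have DM: "?D \<in> sets M" using M dilate_borel by (auto simp: radon_measure_def)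
    have mD: "emeasure M ?D = ennreal (measure M ?D)"
      using radon_finite[OF M bounded_dilate[of 3 k "idx k x"]] by (intro emeasure_eq_ennreal_measure) auto
    \<comment> \<open>The tripled cube is half open and may miss points of the closed ball of radius
      \<open>?s\<close>, so smaller radii are used and a limit is taken afterwards.\<close>
    have le: "2 * ?K * r \<le> measure M ?D" if r: "0 < r" "r < ?s" for r
    proof -
      have sub: "cball x r \<subseteq> ?D"
      proof
        fix y assume y: "y \<in> cball x r"
        show "y \<in> ?D"
        proof (rule dilateI)
          fix i
          have "\<bar>y $ i - x $ i\<bar> < ?s"
            using component_le_norm_cart[of "y - x" i] y r by (simp add: dist_norm norm_minus_commute)
          then show "\<bar>y $ i - centre k (idx k x) $ i\<bar> < 3 * ?s / 2"
            using idx_centre_dist[of x i k] by linarith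
        qed
      qed
      have "ennreal ?K < emeasure M (cball x r) / ennreal (2 * r)" using d(2) r s by simp
      then have "ennreal ?K * ennreal (2 * r) \<le> emeasure M (cball x r) / ennreal (2 * r) * ennreal (2 * r)"
        by (intro mult_right_mono) auto
      also have "\<dots> = emeasure M (cball x r)"
        using r by (intro ennreal_divide_mult_self) auto
      also have "\<dots> \<le> emeasure M ?D" using sub DM by (rule emeasure_mono)
      also have "ennreal ?K * ennreal (2 * r) = ennreal (?K * (2 * r))"
        using K r by (intro ennreal_mult[symmetric]) auto
      finally have "ennreal (?K * (2 * r)) \<le> ennreal (measure M ?D)"
        unfolding mD .
      then have "?K * (2 * r) \<le> measure M ?D" by (simp only: ennreal_le_iff measure_nonneg)
      then show ?thesis by (simp add: mult_ac)
    qed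
    have "2 * ?K * ?s \<le> measure M ?D"
    proof (rule field_le_mult_one_interval)
      fix t :: real assume t: "0 < t" "t < 1"
      then show "t * (2 * ?K * ?s) \<le> measure M ?D"
        using le[of "t * ?s"] s(1) by (simp add: mult_ac)
    qed
    moreover have "c * diameter ?D \<le> 2 * ?K * ?s"
      using mult_left_mono[OF diameter_dilate3_le[of k "idx k x"], of c] c by (simp add: mult_ac)
    ultimately show ?thesis unfolding mD by (simp add: ennreal_leI)
  qed
  then have "x \<in> piece M p c m N (idx (int m) x)"
    using N by (simp add: piece_def mem_dcube_iff)
  then show ?thesis by blast
qed

theorem theorem5p1:
  fixes M :: "(real^'n) measure" and p c :: real
  assumes "radon_measure M" and "1 \<le> p" and "c > 0"
  shows "restr_one_rectifiable M
           {x. ennreal (3/2 * sqrt (real CARD('n)) * c) < lower_density1 M x \<and> J_star M c p x < \<infinity>}"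
proof -
  define E where "E = {x. ennreal (3/2 * sqrt (real CARD('n)) * c) < lower_density1 M x \<and> J_star M c p x < \<infinity>}"
  define B where "B = (\<lambda>(m, N, j0). piece M p c m N (j0 :: 'n \<Rightarrow> int))"
  define lev :: "nat \<times> nat \<times> ('n \<Rightarrow> int) \<Rightarrow> int" where "lev q = int (fst q)" for q
  define U where "U q i = bad_part M (B q) (lev q) (1 / real (Suc i))" for q and i :: nat
  define fits where "fits f q i \<longleftrightarrow> (\<exists>L. L-lipschitz_on {0..1::real} f) \<and> B q - U q i \<subseteq> f ` {0..1}" for f q i
  have "\<exists>f. fits f q i" for q i
  proof -
    obtain m N j0 where q: "q = (m, N, j0)" by (cases q)
    show ?thesis
      using piece_curve[OF assms, of "1 / real (Suc i)" m N j0]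
      by (auto simp: fits_def q B_def lev_def U_def)
  qed
  then have "\<forall>qi. \<exists>f. fits f (fst qi) (snd qi)" by blast
  then obtain F where F0: "\<forall>qi. fits (F qi) (fst qi) (snd qi)" by (rule choice[THEN exE])
  have F: "\<exists>L. L-lipschitz_on {0..1::real} (F qi)" for qi
    using F0 unfolding fits_def by blast
  have FU: "B q - U q i \<subseteq> F (q, i) ` {0..1}" for q i
    using F0[THEN spec, of "(q, i)"] by (simp add: fits_def)
  \<comment> \<open>A point missed by every curve is bad for its piece at all levels
    \<open>1 / Suc i\<close>; for each of the countably many pieces such points are null.\<close>
  let ?N = "\<Union>q. \<Inter>i. B q \<inter> U q i"
  have "?N \<in> null_sets M"
  proof (rule null_sets_UN')
    fix q :: "nat \<times> nat \<times> ('n \<Rightarrow> int)"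
    obtain m N j0 where "q = (m, N, j0)" by (cases q)
    then show "(\<Inter>i. B q \<inter> U q i) \<in> null_sets M"
      using piece_bad_null[OF assms(1), of p c m N j0] by (simp add: B_def lev_def U_def)
  qed simp
  \<comment> \<open>Pairs of a piece and a level are countable, so \<open>from_nat\<close> lists
    their curves as a sequence.\<close>
  moreover have "E - (\<Union>n. F (from_nat n) ` {0..1}) \<subseteq> ?N"
  proof
    fix x assume x: "x \<in> E - (\<Union>n. F (from_nat n) ` {0..1})"
    then have "x \<in> E" by (rule DiffD1)
    then have "ennreal (3/2 * sqrt (real CARD('n)) * c) < lower_density1 M x" "J_star M c p x < \<infinity>"
      by (simp_all add: E_def)
    from mem_pieces[OF assms(1,3) this] obtain m N j0 where "x \<in> piece M p c m N j0"
      by (elim exE)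
    then have xB: "x \<in> B (m, N, j0)" by (simp add: B_def)
    have "x \<notin> F qi ` {0..1}" for qi
    proof -
      have "x \<notin> F (from_nat (to_nat qi)) ` {0..1}" using x by blast
      then show ?thesis by simp
    qed
    then have "x \<in> U (m, N, j0) i" for i using FU[of "(m, N, j0)" i] xB by blast
    with xB show "x \<in> ?N" by blast
  qed
  ultimately show ?thesis
    unfolding restr_one_rectifiable_def E_def[symmetric] using F
    by (intro exI[of _ "\<lambda>n. F (from_nat n)"] conjI allI bexI[of _ ?N])
qed

end
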